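(* Consider the system and notation described in the context, and suppose $0<a_1<\sqrt{4d_1r}$ and $L>L_1^*$. (i) If $L-x_2\ge L^*$ (large protection zone), $m\le p^{-1}e^{-|\frac{a_1}{d_1}-\frac{a_2}{d_2}|x_2}$ and $\bar w^2(x_2)\le h$, then the system possesses a unique coexistence steady state $(u,w)$, which is globally asymptotically stable. (ii) If $L-x_2<L^*$ (small protection zone), $m<\min\{\bar m,\,p^{-1}e^{-|\frac{a_1}{d_1}-\frac{a_2}{d_2}|x_2}\}$ and $\bar w^2(x_2)\le h$, then the system possesses a unique coexistence steady state $(u,w)$, which is globally asymptotically stable.
   Context: Let $d_1,d_2,r,m,p,q,h,L>0$, $a_1>0$, $a_2\ge0$ and $0<x_2\le L$. Let $\chi_{[0,x_2)}(x)=1$ for $0\le x<x_2$ and $0$ for $x_2\le x\le L$. Consider the system $u_t=d_1u_{xx}-a_1u_x+u(r-u-m\chi_{[0,x_2)}w)$, $x\in(0,L)$; $w_t=d_2w_{xx}-a_2w_x+h-qw-puw$, $x\in(0,x_2)$; $d_1u_x(0,t)-a_1u(0,t)=u_x(L,t)=0$; $d_2w_x(0,t)-a_2w(0,t)=d_2w_x(x_2,t)-a_2w(x_2,t)=0$; nonnegative, not identically zero initial data. A coexistence steady state is a time-independent solution $(u,w)$ with $u>0$ on $[0,L]$, $w>0$ on $[0,x_2]$; globally asymptotically stable means all solutions with nonnegative nontrivial initial data converge to it uniformly as $t\to\infty$. Let $\bar w$ be the unique positive solution of $d_2w''-a_2w'+h-qw=0$ on $(0,x_2)$, $d_2w'(0)-a_2w(0)=d_2w'(x_2)-a_2w(x_2)=0$.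 For $0\le y_1<y_2\le L$, $d>0$, $a\ge0$, bounded $s$, $\lambda_1(d,a,s,(y_1,y_2))$ is the principal eigenvalue of $d\varphi''-a\varphi'+s\varphi=\lambda\varphi$ on $(y_1,y_2)$, $d\varphi'(y_1)-a\varphi(y_1)=\varphi'(y_2)=0$. When $L-x_2<L^*$, $\bar m>0$ denotes the critical value of $m$ at which $\lambda_1(d_1,a_1,r-m\chi_{[0,x_2)}\bar w,(0,L))=0$ (this eigenvalue is strictly decreasing in $m$). For $0<a_1<\sqrt{4d_1r}$: $L^*=2d_1\big(\pi-\arctan\frac{\sqrt{4d_1r-a_1^2}}{a_1}\big)/\sqrt{4d_1r-a_1^2}$; $L_1^*=2d_1\arctan\big(\frac{a_1\sqrt{4d_1r-a_1^2}}{2d_1r-a_1^2}\big)/\sqrt{4d_1r-a_1^2}$ if $a_1\le\sqrt{2d_1r}$ and $L_1^*=2d_1\big(\pi+\arctan\frac{a_1\sqrt{4d_1r-a_1^2}}{2d_1r-a_1^2}\big)/\sqrt{4d_1r-a_1^2}$ if $\sqrt{2d_1r}<a_1<\sqrt{4d_1r}$. *)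

theory Defs
  imports Complex_Main
begin

definition chi :: "real \<Rightarrow> real \<Rightarrow> real" where
  "chi x2 x = (if 0 \<le> x \<and> x < x2 then 1 else 0)"

definition is_wbar :: "real \<Rightarrow> real \<Rightarrow> real \<Rightarrow> real \<Rightarrow> real \<Rightarrow> (real \<Rightarrow> real) \<Rightarrow> bool" where
  "is_wbar d2 a2 h q x2 w \<longleftrightarrow>
     (\<forall>x\<in>{0..x2}. w x > 0) \<and>
     (\<exists>w'. (\<forall>x\<in>{0..x2}. (w has_real_derivative w' x) (at x within {0..x2})) \<and>
       (\<forall>x\<in>{0<..<x2}. \<exists>w''. (w' has_real_derivative w'') (at x) \<and>
            d2 * w'' - a2 * w' x + h - q * w x = 0) \<and>
       d2 * w' 0 - a2 * w 0 = 0 \<and> d2 * w' x2 - a2 * w x2 = 0)"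

text \<open>lam is the principal eigenvalue of d phi'' - a phi' + s phi = lam phi on (y1,y2),
  d phi'(y1) - a phi(y1) = phi'(y2) = 0, i.e. the eigenvalue admitting a positive
  eigenfunction.  The eigenfunction is C^1 on [y1,y2] and the equation holds
  pointwise off a finite set (points of discontinuity of a piecewise continuous s).\<close>
definition principal_eigenvalue ::
  "real \<Rightarrow> real \<Rightarrow> (real \<Rightarrow> real) \<Rightarrow> real \<Rightarrow> real \<Rightarrow> real \<Rightarrow> bool" where
  "principal_eigenvalue d a s y1 y2 lam \<longleftrightarrow>
     (\<exists>\<phi> \<phi>' F. (\<forall>x\<in>{y1..y2}. \<phi> x > 0) \<and>
       (\<forall>x\<in>{y1..y2}. (\<phi> has_real_derivative \<phi>' x) (at x within {y1..y2})) \<and>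
       continuous_on {y1..y2} \<phi>' \<and> finite F \<and>
       (\<forall>x\<in>{y1<..<y2} - F. \<exists>\<phi>''. (\<phi>' has_real_derivative \<phi>'') (at x) \<and>
            d * \<phi>'' - a * \<phi>' x + s x * \<phi> x = lam * \<phi> x) \<and>
       d * \<phi>' y1 - a * \<phi> y1 = 0 \<and> \<phi>' y2 = 0)"

definition Lstar :: "real \<Rightarrow> real \<Rightarrow> real \<Rightarrow> real" where
  "Lstar d1 a1 r = 2 * d1 * (pi - arctan (sqrt (4*d1*r - a1^2) / a1)) / sqrt (4*d1*r - a1^2)"

text \<open>At a1^2 = 2 d1 r the arctan argument is +infinity, so arctan is pi/2.\<close>
definition L1star :: "real \<Rightarrow> real \<Rightarrow> real \<Rightarrow> real" where
  "L1star d1 a1 r =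
     (if a1^2 < 2*d1*r then
        2 * d1 * arctan (a1 * sqrt (4*d1*r - a1^2) / (2*d1*r - a1^2)) / sqrt (4*d1*r - a1^2)
      else if a1^2 = 2*d1*r then 2 * d1 * (pi/2) / sqrt (4*d1*r - a1^2)
      else 2 * d1 * (pi + arctan (a1 * sqrt (4*d1*r - a1^2) / (2*d1*r - a1^2))) / sqrt (4*d1*r - a1^2))"

text \<open>Coexistence steady state (U on [0,L], W on [0,x2]).  U is C^1 on [0,L]
  and satisfies the equation classically off x2 (where the coefficient jumps).\<close>
definition coexistence_steady_state ::
  "real \<Rightarrow> real \<Rightarrow> real \<Rightarrow> real \<Rightarrow> real \<Rightarrow> real \<Rightarrow> real \<Rightarrow> real \<Rightarrow> real \<Rightarrow> real \<Rightarrow> real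
   \<Rightarrow> (real \<Rightarrow> real) \<Rightarrow> (real \<Rightarrow> real) \<Rightarrow> bool" where
  "coexistence_steady_state d1 d2 a1 a2 r m p q h L x2 U W \<longleftrightarrow>
     (\<forall>x\<in>{0..L}. U x > 0) \<and> (\<forall>x\<in>{0..x2}. W x > 0) \<and>
     (\<exists>U'. (\<forall>x\<in>{0..L}. (U has_real_derivative U' x) (at x within {0..L})) \<and>
       continuous_on {0..L} U' \<and>
       (\<forall>x\<in>{0<..<L} - {x2}. \<exists>U''. (U' has_real_derivative U'') (at x) \<and>
            d1 * U'' - a1 * U' x + U x * (r - U x - m * chi x2 x * W x) = 0) \<and>
       d1 * U' 0 - a1 * U 0 = 0 \<and> U' L = 0) \<and>
     (\<exists>W'. (\<forall>x\<in>{0..x2}. (W has_real_derivative W' x) (at x within {0..x2})) \<and>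
       (\<forall>x\<in>{0<..<x2}. \<exists>W''. (W' has_real_derivative W'') (at x) \<and>
            d2 * W'' - a2 * W' x + h - q * W x - p * U x * W x = 0) \<and>
       d2 * W' 0 - a2 * W 0 = 0 \<and> d2 * W' x2 - a2 * W x2 = 0)"

definition is_solution ::
  "real \<Rightarrow> real \<Rightarrow> real \<Rightarrow> real \<Rightarrow> real \<Rightarrow> real \<Rightarrow> real \<Rightarrow> real \<Rightarrow> real \<Rightarrow> real \<Rightarrow> real
   \<Rightarrow> (real \<Rightarrow> real) \<Rightarrow> (real \<Rightarrow> real)
   \<Rightarrow> (real \<Rightarrow> real \<Rightarrow> real) \<Rightarrow> (real \<Rightarrow> real \<Rightarrow> real) \<Rightarrow> bool" where
  "is_solution d1 d2 a1 a2 r m p q h L x2 u0 w0 u w \<longleftrightarrow>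
     continuous_on ({0..L} \<times> {0..}) (\<lambda>(x,t). u x t) \<and>
     continuous_on ({0..x2} \<times> {0..}) (\<lambda>(x,t). w x t) \<and>
     (\<forall>x\<in>{0..L}. u x 0 = u0 x) \<and> (\<forall>x\<in>{0..x2}. w x 0 = w0 x) \<and>
     (\<forall>t>0.
       (\<exists>ux. (\<forall>x\<in>{0..L}. ((\<lambda>y. u y t) has_real_derivative ux x) (at x within {0..L})) \<and>
          continuous_on {0..L} ux \<and>
          (\<forall>x\<in>{0<..<L} - {x2}. \<exists>uxx ut. (ux has_real_derivative uxx) (at x) \<and>
              ((\<lambda>s. u x s) has_real_derivative ut) (at t) \<and>
              ut = d1 * uxx - a1 * ux x + u x t * (r - u x t - m * chi x2 x * w x t)) \<and>
          d1 * ux 0 - a1 * u 0 t = 0 \<and> ux L = 0) \<and>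
       (\<exists>wx. (\<forall>x\<in>{0..x2}. ((\<lambda>y. w y t) has_real_derivative wx x) (at x within {0..x2})) \<and>
          continuous_on {0..x2} wx \<and>
          (\<forall>x\<in>{0<..<x2}. \<exists>wxx wt. (wx has_real_derivative wxx) (at x) \<and>
              ((\<lambda>s. w x s) has_real_derivative wt) (at t) \<and>
              wt = d2 * wxx - a2 * wx x + h - q * w x t - p * u x t * w x t) \<and>
          d2 * wx 0 - a2 * w 0 t = 0 \<and> d2 * wx x2 - a2 * w x2 t = 0))"

definition admissible_initial_data ::
  "real \<Rightarrow> real \<Rightarrow> (real \<Rightarrow> real) \<Rightarrow> (real \<Rightarrow> real) \<Rightarrow> bool" where
  "admissible_initial_data L x2 u0 w0 \<longleftrightarrow>
     continuous_on {0..L} u0 \<and> continuous_on {0..x2} w0 \<and>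
     (\<forall>x\<in>{0..L}. u0 x \<ge> 0) \<and> (\<forall>x\<in>{0..x2}. w0 x \<ge> 0) \<and>
     (\<exists>x\<in>{0..L}. u0 x \<noteq> 0) \<and> (\<exists>x\<in>{0..x2}. w0 x \<noteq> 0)"

definition globally_asymptotically_stable ::
  "real \<Rightarrow> real \<Rightarrow> real \<Rightarrow> real \<Rightarrow> real \<Rightarrow> real \<Rightarrow> real \<Rightarrow> real \<Rightarrow> real \<Rightarrow> real \<Rightarrow> real
   \<Rightarrow> (real \<Rightarrow> real) \<Rightarrow> (real \<Rightarrow> real) \<Rightarrow> bool" where
  "globally_asymptotically_stable d1 d2 a1 a2 r m p q h L x2 U W \<longleftrightarrow>
     (\<forall>u0 w0 u w. admissible_initial_data L x2 u0 w0 \<longrightarrow>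
        is_solution d1 d2 a1 a2 r m p q h L x2 u0 w0 u w \<longrightarrow>
        (\<forall>\<epsilon>>0. \<exists>T. \<forall>t\<ge>T.
           (\<forall>x\<in>{0..L}. \<bar>u x t - U x\<bar> < \<epsilon>) \<and> (\<forall>x\<in>{0..x2}. \<bar>w x t - W x\<bar> < \<epsilon>)))"

definition unique_GAS_coexistence ::
  "real \<Rightarrow> real \<Rightarrow> real \<Rightarrow> real \<Rightarrow> real \<Rightarrow> real \<Rightarrow> real \<Rightarrow> real \<Rightarrow> real \<Rightarrow> real \<Rightarrow> real \<Rightarrow> bool" where
  "unique_GAS_coexistence d1 d2 a1 a2 r m p q h L x2 \<longleftrightarrow>
     (\<exists>U W. coexistence_steady_state d1 d2 a1 a2 r m p q h L x2 U W \<and>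
        globally_asymptotically_stable d1 d2 a1 a2 r m p q h L x2 U W \<and>
        (\<forall>U2 W2. coexistence_steady_state d1 d2 a1 a2 r m p q h L x2 U2 W2 \<longrightarrow>
           (\<forall>x\<in>{0..L}. U2 x = U x) \<and> (\<forall>x\<in>{0..x2}. W2 x = W x)))"

end

theory Submission
  imports Defs "HOL-Analysis.Analysis"
begin

text \<open>
  The system is competitive, hence monotone for the order \<open>(u, w) \<le> (u', w')\<close> iff \<open>u \<le> u'\<close> and
  \<open>w' \<le> w\<close>. Iterating the Green operators of constant coefficient problems from an upper pair
  \<open>(C exp (a1 x / d1), 0)\<close> and a lower pair \<open>(\<epsilon> \<phi>, \<kappa> wb)\<close> produces two ordered coexistence states,
  and the maximum principle squeezes every solution of the parabolic system between the iterates.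
  The lower pair needs a strict subsolution \<open>\<phi>\<close> of the equation linearised at \<open>u = 0\<close>: if
  \<open>T f0 \<ge> f0\<close> without equality for the positive operator \<open>T\<close> of that problem, then \<open>T (T f0)\<close> is one.
  Here \<open>f0\<close> is the Dirichlet--Neumann eigenfunction of the protection zone in case (i), and the
  eigenfunction at the critical \<open>mbar\<close> in case (ii).

  For ordered coexistence states \<open>(U1, W1) \<ge> (U2, W2)\<close> put \<open>f = U1 - U2\<close>, \<open>w = W2 - W1\<close>. Testing the
  equations of the quotients \<open>U1 / U2\<close> and \<open>W2 / W1\<close> with \<open>(R - 1)\<^sup>2 / R\<close> gives an inequality for a
  cubic form in \<open>f\<close> and \<open>w / p\<close>, which \<open>(f + e) (f - e)\<^sup>2 \<ge> 0\<close> and the two smallness conditions turn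
  into \<open>f = w = 0\<close>.
\<close>

section \<open>Maximum principles\<close>

lemma interior_max_derivatives:
  fixes f :: "real \<Rightarrow> real"
  assumes x: "l < x" "x < r"
    and f': "\<And>y. l < y \<Longrightarrow> y < r \<Longrightarrow> (f has_real_derivative f' y) (at y)"
    and f'': "(f' has_real_derivative f2) (at x)"
    and mx: "\<And>y. l < y \<Longrightarrow> y < r \<Longrightarrow> f y \<le> f x"
  shows "f' x = 0" "f2 \<le> 0"
proof -
  show z: "f' x = 0"
  proof (rule DERIV_local_max[OF f'[OF x], of "min (x-l) (r-x)"])
    show "0 < min (x-l) (r-x)" using x by simp
    show "\<forall>y. \<bar>x - y\<bar> < min (x-l) (r-x) \<longrightarrow> f y \<le> f x"
      using mx by (auto simp: abs_less_iff)
  qed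
  show "f2 \<le> 0"
  proof (rule ccontr)
    assume "\<not> f2 \<le> 0"
    then obtain e where e: "e > 0" "\<And>h. h > 0 \<Longrightarrow> h < e \<Longrightarrow> f' x < f' (x + h)"
      using DERIV_pos_inc_right[OF f''] by auto
    define k where "k = min e (r - x) / 2"
    have k: "0 < k" "k < e" "x + k < r" using e(1) x by (auto simp: k_def min_def field_simps)
    have "\<exists>c. x < c \<and> c < x + k \<and> f (x + k) - f x = (x + k - x) * f' c"
      using k x by (intro MVT2) (auto intro!: f')
    then obtain c where c: "x < c" "c < x + k" "f (x + k) - f x = k * f' c" by auto
    have "f' c > 0" using e(2)[of "c - x"] c k z by simp
    hence "f (x + k) > f x" using c(3) k(1) by (simp add: algebra_simps) 
    thus False using mx[of "x + k"] k x by simp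
  qed
qed

lemma no_max_at_convex_kink:
  fixes f :: "real \<Rightarrow> real"
  assumes x: "l < c" "c < r" and e: "e > 0"
    and f': "(f has_real_derivative D) (at c)"
    and mx: "\<And>y. l < y \<Longrightarrow> y < r \<Longrightarrow> f y + e * \<bar>y - c\<bar> \<le> f c"
  shows False
proof -
  have 1: "((\<lambda>y. f y + e * (y - c)) has_real_derivative D + e) (at c)"
    by (auto intro!: derivative_eq_intros f')
  have 2: "((\<lambda>y. f y - e * (y - c)) has_real_derivative D - e) (at c)"
    by (auto intro!: derivative_eq_intros f')
  show False
  proof (cases "D + e > 0")
    case True
    then obtain k where k: "k > 0" "\<And>h. h > 0 \<Longrightarrow> h < k \<Longrightarrow> f c + e * (c - c) < f (c + h) + e * (c + h - c)"
      using DERIV_pos_inc_right[OF 1] by auto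
    define h where "h = min k (r - c) / 2"
    have h: "h > 0" "h < k" "c + h < r" using k(1) x by (auto simp: h_def min_def field_simps)
    show False using k(2)[OF h(1,2)] mx[of "c + h"] h x by auto
  next
    case False
    hence "D - e < 0" using e by simp
    then obtain k where k: "k > 0" "\<And>h. h > 0 \<Longrightarrow> h < k \<Longrightarrow> f c - e * (c - c) < f (c - h) - e * (c - h - c)"
      using DERIV_neg_dec_left[OF 2] by auto
    define h where "h = min k (c - l) / 2"
    have h: "h > 0" "h < k" "c - h > l" using k(1) x by (auto simp: h_def min_def field_simps)
    show False using k(2)[OF h(1,2)] mx[of "c - h"] h x by auto
  qed
qed

lemma DERIV_abs_shift:
  fixes c x :: real
  assumes "x \<noteq> c"
  shows "((\<lambda>y. \<bar>y - c\<bar>) has_real_derivative sgn (x - c)) (at x)"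
    "((\<lambda>y. sgn (y - c)) has_real_derivative 0) (at x)"
proof -
  consider "x > c" | "x < c" using assms by linarith
  then have "((\<lambda>y. \<bar>y - c\<bar>) has_real_derivative sgn (x - c)) (at x) \<and>
    ((\<lambda>y. sgn (y - c)) has_real_derivative 0) (at x)"
  proof cases
    case 1
    have "((\<lambda>y. y - c) has_real_derivative 1) (at x)" by (auto intro!: derivative_eq_intros)
    hence "((\<lambda>y. \<bar>y - c\<bar>) has_real_derivative 1) (at x)"
      by (rule has_field_derivative_transform_within_open[where S="{c<..}"]) (use 1 in auto)
    moreover have "((\<lambda>y. sgn (y - c)) has_real_derivative 0) (at x)"
      by (rule has_field_derivative_transform_within_open[where S="{c<..}" and f="\<lambda>_. 1"]) (use 1 in auto)
    ultimately show ?thesis using 1 by simp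
  next
    case 2
    have "((\<lambda>y. c - y) has_real_derivative -1) (at x)" by (auto intro!: derivative_eq_intros)
    hence "((\<lambda>y. \<bar>y - c\<bar>) has_real_derivative -1) (at x)"
      by (rule has_field_derivative_transform_within_open[where S="{..<c}"]) (use 2 in auto)
    moreover have "((\<lambda>y. sgn (y - c)) has_real_derivative 0) (at x)"
      by (rule has_field_derivative_transform_within_open[where S="{..<c}" and f="\<lambda>_. -1"]) (use 2 in auto)
    ultimately show ?thesis using 2 by simp
  qed
  thus "((\<lambda>y. \<bar>y - c\<bar>) has_real_derivative sgn (x - c)) (at x)"
    "((\<lambda>y. sgn (y - c)) has_real_derivative 0) (at x)" by auto
qed

text \<open>No time derivative is available at the exceptional points \<open>S\<close> and at the end points. The
  perturbation \<open>psi\<close> below has a convex kink at each point of \<open>S\<close> and a strict inward slope at both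
  ends, so the perturbed function cannot attain its maximum there.\<close>

lemma parabolic_max_principle:
  fixes v :: "real \<Rightarrow> real \<Rightarrow> real"
  assumes lr: "l < r" and d: "0 < d" and a: "0 \<le> a" and fin: "finite S"
    and cont: "continuous_on ({l..r} \<times> {T0..T1}) (\<lambda>(x,t). v x t)"
    and init: "\<And>x. x \<in> {l..r} \<Longrightarrow> v x T0 \<le> 0"
    and ex: "\<And>t. T0 < t \<Longrightarrow> t \<le> T1 \<Longrightarrow> \<exists>vx.
        (\<forall>x\<in>{l..r}. ((\<lambda>y. v y t) has_real_derivative vx x) (at x within {l..r})) \<and>
        (v l t > 0 \<longrightarrow> a * v l t \<le> d * vx l) \<and> (v r t > 0 \<longrightarrow> d * vx r \<le> a * v r t) \<and>
        (\<forall>x\<in>{l<..<r} - S. v x t > 0 \<longrightarrow> (\<exists>vxx vt. (vx has_real_derivative vxx) (at x) \<and>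
           ((\<lambda>s. v x s) has_real_derivative vt) (at t) \<and>
           vt \<le> d * vxx - a * vx x + K * v x t))"
    and xt: "x0 \<in> {l..r}" "t0 \<in> {T0..T1}"
  shows "v x0 t0 \<le> 0"
proof -
  define al where "al = a / d"
  have al: "d * al = a" "0 \<le> al" using d a by (auto simp: al_def)
  define E where "E = (\<lambda>x t. exp (- al * x - (K + 1) * t))"
  have Epos: "E x t > 0" for x t by (simp add: E_def)
  define z where "z = (\<lambda>x t. E x t * v x t)"
  define S' where "S' = S \<inter> {l<..<r}"
  have S': "finite S'" "\<And>c. c \<in> S' \<Longrightarrow> l < c \<and> c < r" using fin by (auto simp: S'_def)
  define N where "N = real (card S') + 1"
  have N: "N \<ge> 1" by (simp add: N_def)
  define B where "B = (\<lambda>x. N * ((x - l) - (x - l)\<^sup>2 / (r - l)))"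
  define B' where "B' = (\<lambda>x. N * (1 - 2 * (x - l) / (r - l)))"
  define psi where "psi = (\<lambda>x. (\<Sum>c\<in>S'. \<bar>x - c\<bar>) + B x)"
  define psi' where "psi' = (\<lambda>x. (\<Sum>c\<in>S'. sgn (x - c)) + B' x)"
  have DB: "(B has_real_derivative B' x) (at x)" for x
    unfolding B_def B'_def divide_inverse by (auto intro!: derivative_eq_intros simp: algebra_simps)
  have DB': "(B' has_real_derivative - 2 * N / (r - l)) (at x)" for x
    unfolding B'_def divide_inverse by (auto intro!: derivative_eq_intros simp: algebra_simps)
  have Dsum: "((\<lambda>y. \<Sum>c\<in>A. \<bar>y - c\<bar>) has_real_derivative (\<Sum>c\<in>A. sgn (x - c))) (at x)"
    if "x \<notin> A" for x :: real and A
    by (intro DERIV_sum DERIV_abs_shift) (use that in auto)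
  have Dpsi: "(psi has_real_derivative psi' x) (at x)" if "x \<notin> S'" for x
    unfolding psi_def psi'_def by (intro DERIV_add DB Dsum that)
  have Dpsi': "(psi' has_real_derivative - 2 * N / (r - l)) (at x)" if "x \<notin> S'" for x
  proof -
    have "((\<lambda>y. \<Sum>c\<in>S'. sgn (y - c)) has_real_derivative (\<Sum>c\<in>S'. 0)) (at x)"
      by (intro DERIV_sum DERIV_abs_shift) (use that in auto)
    from DERIV_add[OF this DB'] show ?thesis by (simp add: psi'_def)
  qed
  have sgn_sum: "\<bar>\<Sum>c\<in>S'. sgn (x - c)\<bar> \<le> N - 1" for x
  proof -
    have "\<bar>\<Sum>c\<in>S'. sgn (x - c)\<bar> \<le> (\<Sum>c\<in>S'. \<bar>sgn (x - c)\<bar>)" by (rule sum_abs)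
    also have "\<dots> \<le> (\<Sum>c\<in>S'. 1)" by (intro sum_mono) (auto simp: sgn_if)
    finally show ?thesis by (simp add: N_def)
  qed
  have psi'_l: "psi' l \<ge> 1" using sgn_sum[of l] lr by (simp add: psi'_def B'_def)
  have "B' r = - N" using lr by (simp add: B'_def field_simps)
  hence psi'_r: "psi' r \<le> -1" using sgn_sum[of r] by (simp add: psi'_def)
  have B'_abs: "\<bar>B' x\<bar> \<le> N" if "x \<in> {l..r}" for x
  proof -
    have "0 \<le> (x - l) / (r - l)" "(x - l) / (r - l) \<le> 1" using that lr by (auto simp: divide_simps)
    hence "\<bar>1 - 2 * ((x - l) / (r - l))\<bar> \<le> 1" unfolding abs_le_iff by linarith
    hence "\<bar>1 - 2 * (x - l) / (r - l)\<bar> \<le> 1" by (simp only: times_divide_eq_right)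
    hence "N * \<bar>1 - 2 * (x - l) / (r - l)\<bar> \<le> N * 1" using N by (intro mult_left_mono) auto
    thus ?thesis using N by (simp add: B'_def abs_mult)
  qed
  have psi'_abs: "\<bar>psi' x\<bar> \<le> 2 * N" if "x \<in> {l..r}" for x
    using B'_abs[OF that] sgn_sum[of x] by (simp add: psi'_def)
  have Bpos: "B x \<ge> 0" if "x \<in> {l..r}" for x
  proof -
    have "(x - l) * (x - l) \<le> (x - l) * (r - l)" using that by (intro mult_left_mono) auto
    hence "(x - l)\<^sup>2 / (r - l) \<le> x - l" using lr by (simp add: divide_simps power2_eq_square)
    thus ?thesis using N by (simp add: B_def)
  qed
  have psi_pos: "psi x \<ge> 0" if "x \<in> {l..r}" for x
    using Bpos[OF that] by (auto simp: psi_def intro!: add_nonneg_nonneg sum_nonneg)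
  have contpsi: "continuous_on A psi" for A
    unfolding psi_def B_def using lr by (auto intro!: continuous_intros)
  obtain M where M: "\<And>x. x \<in> {l..r} \<Longrightarrow> psi x \<le> M"
  proof -
    have "bounded (psi ` {l..r})"
      by (intro compact_imp_bounded compact_continuous_image contpsi) auto
    then obtain M where "\<forall>y\<in>psi ` {l..r}. norm y \<le> M" unfolding bounded_iff by blast
    hence "\<And>x. x \<in> {l..r} \<Longrightarrow> psi x \<le> M" by force
    thus ?thesis by (rule that)
  qed
  have M0: "M \<ge> 0" using M[of l] psi_pos[of l] lr by simp
  define C where "C = M + (2 * d * N / (r - l) + 2 * a * N)"
  have C1: "2 * d * N / (r - l) + 2 * a * N \<ge> 0" using d a N lr by simp
  have main: "z x0 t0 \<le> e * C" if e: "e > 0" for e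
  proof -
    define Z where "Z = (\<lambda>x t. z x t + e * psi x)"
    have contZ: "continuous_on ({l..r} \<times> {T0..T1}) (\<lambda>p. Z (fst p) (snd p))"
    proof -
      have "continuous_on ({l..r} \<times> {T0..T1}) (\<lambda>p. v (fst p) (snd p))"
        using cont by (simp add: case_prod_unfold)
      moreover have "continuous_on ({l..r} \<times> {T0..T1}) (\<lambda>p. psi (fst p))"
        by (rule continuous_on_compose2[OF contpsi[of UNIV]]) (auto intro!: continuous_intros)
      ultimately show ?thesis unfolding Z_def z_def E_def by (intro continuous_intros) auto
    qed
    have "compact ({l..r} \<times> {T0..T1})" by (intro compact_Times) auto
    moreover have "{l..r} \<times> {T0..T1} \<noteq> {}" using xt by blast
    ultimately obtain P where P: "P \<in> {l..r} \<times> {T0..T1}"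
      "\<And>Q. Q \<in> {l..r} \<times> {T0..T1} \<Longrightarrow> Z (fst Q) (snd Q) \<le> Z (fst P) (snd P)"
      using continuous_attains_sup[OF _ _ contZ] by blast
    define x t where "x = fst P" and "t = snd P"
    have x: "x \<in> {l..r}" and t: "t \<in> {T0..T1}" using P(1) by (auto simp: x_def t_def)
    have mx: "Z y s \<le> Z x t" if "y \<in> {l..r}" "s \<in> {T0..T1}" for y s
      using P(2)[of "(y, s)"] that by (simp add: x_def t_def)
    have "Z x t \<le> e * C"
    proof (cases "v x t \<le> 0")
      case True
      hence "z x t \<le> 0" using Epos by (simp add: z_def mult_nonneg_nonpos less_imp_le)
      moreover have "e * psi x \<le> e * M" using e M x by simp
      moreover have "e * M \<le> e * C" using e C1 by (simp add: C_def)
      ultimately show ?thesis by (simp add: Z_def)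
    next
      case False
      hence vpos: "v x t > 0" by simp
      have "t \<noteq> T0" using init x vpos by fastforce
      hence tt: "T0 < t" "t \<le> T1" using t by auto
      obtain vx where vx: "\<And>y. y\<in>{l..r} \<Longrightarrow> ((\<lambda>y. v y t) has_real_derivative vx y) (at y within {l..r})"
        and bl: "v l t > 0 \<Longrightarrow> a * v l t \<le> d * vx l" and br: "v r t > 0 \<Longrightarrow> d * vx r \<le> a * v r t"
        and eq: "\<And>y. y\<in>{l<..<r} - S \<Longrightarrow> v y t > 0 \<Longrightarrow> \<exists>vxx vt. (vx has_real_derivative vxx) (at y) \<and>
           ((\<lambda>s. v y s) has_real_derivative vt) (at t) \<and>
           vt \<le> d * vxx - a * vx y + K * v y t" using ex[OF tt] by blast
      define zx where "zx = (\<lambda>y. E y t * (vx y - al * v y t))"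
      have DE: "((\<lambda>y. E y t) has_real_derivative - al * E y t) (at y within A)" for y A
        unfolding E_def by (auto intro!: derivative_eq_intros)
      have Dz: "((\<lambda>y. z y t) has_real_derivative zx y) (at y within {l..r})" if "y \<in> {l..r}" for y
        unfolding z_def zx_def
        by (rule DERIV_cong[OF DERIV_mult'[OF DE vx[OF that]]]) (simp add: algebra_simps)
      have DZ: "((\<lambda>y. Z y t) has_real_derivative zx y + e * psi' y) (at y within {l..r})"
        if "y \<in> {l..r}" "y \<notin> S'" for y
        unfolding Z_def
        by (intro DERIV_add Dz DERIV_cmult has_field_derivative_at_within[OF Dpsi] that)
      have mxt: "Z y t \<le> Z x t" if "y \<in> {l..r}" for y using mx[OF that t] .
      consider "x = l" | "x = r" | "x \<in> S'" | "l < x" "x < r" "x \<notin> S'"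
        using x unfolding atLeastAtMost_iff by linarith
      then show ?thesis
      proof cases
        case 1
        have lin: "l \<in> {l..r}" "l \<notin> S'" using lr S'(2) by auto
        have "d * (al * v l t) \<le> d * vx l" using bl vpos 1 al(1) by (simp flip: mult.assoc)
        hence "al * v l t \<le> vx l" using d by simp
        hence "zx l \<ge> 0" using Epos[of l t] by (simp add: zx_def)
        hence "zx l + e * psi' l > 0" using psi'_l e by (simp add: add_nonneg_pos)
        then obtain k where k: "k > 0" "\<And>h. h > 0 \<Longrightarrow> l + h \<in> {l..r} \<Longrightarrow> h < k \<Longrightarrow> Z l t < Z (l + h) t"
          using has_real_derivative_pos_inc_right[OF DZ[OF lin]] by blast
        define h where "h = min k (r - l) / 2"
        have h: "h > 0" "h < k" "l + h \<in> {l..r}" using k(1) lr by (auto simp: h_def min_def field_simps)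
        show ?thesis using k(2)[OF h(1,3,2)] mxt[OF h(3)] 1 by simp
      next
        case 2
        have lin: "r \<in> {l..r}" "r \<notin> S'" using lr S'(2) by auto
        have "d * (al * v r t) \<ge> d * vx r" using br vpos 2 al(1) by (simp flip: mult.assoc)
        hence "al * v r t \<ge> vx r" using d by simp
        hence "zx r \<le> 0" using Epos[of r t] by (simp add: zx_def mult_nonneg_nonpos less_imp_le)
        moreover have "e * psi' r < 0" using psi'_r e by (simp add: mult_pos_neg)
        ultimately have "zx r + e * psi' r < 0" by simp
        then obtain k where k: "k > 0" "\<And>h. h > 0 \<Longrightarrow> r - h \<in> {l..r} \<Longrightarrow> h < k \<Longrightarrow> Z r t < Z (r - h) t"
          using has_real_derivative_neg_dec_left[OF DZ[OF lin]] by blast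
        define h where "h = min k (r - l) / 2"
        have h: "h > 0" "h < k" "r - h \<in> {l..r}" using k(1) lr by (auto simp: h_def min_def field_simps)
        show ?thesis using k(2)[OF h(1,3,2)] mxt[OF h(3)] 2 by simp
      next
        case 3
        have lx: "l < x" "x < r" using S'(2)[OF 3] by auto
        define g where "g = (\<lambda>y. z y t + e * ((\<Sum>c\<in>S' - {x}. \<bar>y - c\<bar>) + B y))"
        have Zg: "Z y t = g y + e * \<bar>y - x\<bar>" for y
          unfolding Z_def g_def psi_def using sum.remove[OF S'(1) 3, of "\<lambda>c. \<bar>y - c\<bar>"]
          by (simp add: algebra_simps)
        have "at x within {l..r} = at x" using lx by (intro at_within_interior) auto
        hence "((\<lambda>y. z y t) has_real_derivative zx x) (at x)" using Dz[OF x] by simp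
        hence Dg: "(g has_real_derivative zx x + e * ((\<Sum>c\<in>S' - {x}. sgn (x - c)) + B' x)) (at x)"
          unfolding g_def by (intro DERIV_add DERIV_cmult Dsum DB) auto
        have "g y + e * \<bar>y - x\<bar> \<le> g x" if "l < y" "y < r" for y
          using mxt[of y] that by (simp add: Zg)
        from no_max_at_convex_kink[OF lx e Dg this] show ?thesis by blast
      next
        case 4
        hence xS: "x \<in> {l<..<r} - S" by (auto simp: S'_def)
        from eq[OF xS vpos] obtain vxx vt where
          vxx: "(vx has_real_derivative vxx) (at x)"
          and vt: "((\<lambda>s. v x s) has_real_derivative vt) (at t)"
          and ineq: "vt \<le> d * vxx - a * vx x + K * v x t" by blast
        have at1: "at y within {l..r} = at y" if "l < y" "y < r" for y
          using that by (intro at_within_interior) auto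
        have "finite S'" by fact
        then obtain l' r' where l': "l \<le> l'" "l' < x" and r': "x < r'" "r' \<le> r"
          and nS: "\<And>y. l' < y \<Longrightarrow> y < r' \<Longrightarrow> y \<notin> S'"
        proof -
          have "open (- S')" using S'(1) by (intro open_Compl finite_imp_closed)
          then obtain \<delta> where \<delta>: "\<delta> > 0" "ball x \<delta> \<subseteq> - S'" using 4(3) by (auto simp: open_contains_ball)
          show ?thesis
            by (rule that[of "max l (x - \<delta>)" "min r (x + \<delta>)"])
               (use \<delta> 4 in \<open>auto simp: dist_real_def subset_eq abs_less_iff\<close>)
        qed
        have DZ1: "((\<lambda>y. Z y t) has_real_derivative zx y + e * psi' y) (at y)" if "l' < y" "y < r'" for y
          using DZ[of y] at1[of y] that l' r' nS[OF that] by simp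
        have Dv: "((\<lambda>y. v y t) has_real_derivative vx x) (at x)" using vx[OF x] at1[OF 4(1,2)] by simp
        have Dzx: "(zx has_real_derivative E x t * (vxx - 2 * al * vx x + al\<^sup>2 * v x t)) (at x)"
          unfolding zx_def
          by (rule DERIV_cong[OF DERIV_mult'[OF DE DERIV_diff[OF vxx DERIV_cmult[OF Dv]]]])
             (simp add: algebra_simps power2_eq_square)
        have DZ2: "((\<lambda>y. zx y + e * psi' y) has_real_derivative
            E x t * (vxx - 2 * al * vx x + al\<^sup>2 * v x t) + e * (- 2 * N / (r - l))) (at x)"
          by (intro DERIV_add Dzx DERIV_cmult Dpsi' 4)
        have mxy: "Z y t \<le> Z x t" if "l' < y" "y < r'" for y using mxt[of y] that l' r' by simp
        note imd = interior_max_derivatives[OF l'(2) r'(1) DZ1 DZ2 mxy]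
        have Z0: "zx x + e * psi' x = 0" and
          Z2: "E x t * (vxx - 2 * al * vx x + al\<^sup>2 * v x t) + e * (- 2 * N / (r - l)) \<le> 0"
          using imd by auto
        have Dt: "((\<lambda>s. z x s) has_real_derivative E x t * (vt - (K + 1) * v x t)) (at t)"
        proof -
          have DEt: "((\<lambda>s. E x s) has_real_derivative - (K + 1) * E x t) (at t)"
            unfolding E_def by (auto intro!: derivative_eq_intros)
          show ?thesis unfolding z_def
            by (rule DERIV_cong[OF DERIV_mult'[OF DEt vt]]) (simp add: algebra_simps)
        qed
        have "E x t * (vt - (K + 1) * v x t) \<ge> 0"
        proof (rule ccontr)
          assume "\<not> ?thesis"
          then obtain k where k: "k > 0" "\<And>h. h > 0 \<Longrightarrow> h < k \<Longrightarrow> z x t < z x (t - h)"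
            using DERIV_neg_dec_left[OF Dt] by force
          define h where "h = min k (t - T0) / 2"
          have h: "h > 0" "h < k" "t - h \<in> {T0..T1}" using k(1) tt by (auto simp: h_def min_def field_simps)
          show False using k(2)[OF h(1,2)] mx[OF x h(3)] by (simp add: Z_def)
        qed
        hence "vt \<ge> (K + 1) * v x t" using Epos[of x t] by (simp add: zero_le_mult_iff)
        hence "v x t \<le> d * vxx - a * vx x" using ineq by (simp add: algebra_simps)
        hence "z x t \<le> E x t * (d * vxx - a * vx x)" using Epos[of x t] by (simp add: z_def)
        also have "\<dots> = d * (E x t * (vxx - 2 * al * vx x + al\<^sup>2 * v x t)) + a * zx x"
          unfolding zx_def al(1)[symmetric] by (simp add: algebra_simps power2_eq_square)
        also have "\<dots> \<le> d * (e * (2 * N / (r - l))) + a * (e * (2 * N))"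
        proof (intro add_mono mult_left_mono)
          have "zx x = - (e * psi' x)" using Z0 by simp
          also have "\<dots> = e * (- psi' x)" by simp
          also have "\<dots> \<le> e * (2 * N)" using psi'_abs[OF x] e by (intro mult_left_mono) auto
          finally show "zx x \<le> e * (2 * N)" .
        qed (use Z2 d a in auto)
        finally have "z x t \<le> e * (2 * d * N / (r - l) + 2 * a * N)" by (simp add: algebra_simps)
        moreover have "e * psi x \<le> e * M" using e M x by simp
        ultimately show ?thesis by (simp add: Z_def C_def algebra_simps)
      qed
    qed
    moreover have "z x0 t0 \<le> Z x0 t0" using psi_pos[OF xt(1)] e by (simp add: Z_def)
    ultimately show ?thesis using mx[OF xt] by linarith
  qed
  have "z x0 t0 \<le> 0"
  proof (rule field_le_epsilon)
    fix e :: real assume e: "e > 0"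
    have C: "C \<ge> 0" using M0 C1 by (simp add: C_def)
    have "z x0 t0 \<le> e / (C + 1) * C" using C e by (intro main) auto
    also have "\<dots> \<le> e" using C e by (simp add: field_simps)
    finally show "z x0 t0 \<le> 0 + e" by simp
  qed
  thus ?thesis using Epos[of x0 t0] by (simp add: z_def mult_le_0_iff)
qed

definition parab :: "real \<Rightarrow> real \<Rightarrow> real \<Rightarrow> real \<Rightarrow> real set \<Rightarrow> real \<Rightarrow> (real \<Rightarrow> real \<Rightarrow> real) \<Rightarrow>
    (real \<Rightarrow> real \<Rightarrow> real) \<Rightarrow> bool" where
  "parab d a b R S T z f \<longleftrightarrow> continuous_on ({0..R} \<times> {T..}) (\<lambda>(x,t). z x t) \<and>
    (\<forall>t>T. \<exists>zx. (\<forall>x\<in>{0..R}. ((\<lambda>y. z y t) has_real_derivative zx x) (at x within {0..R})) \<and>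
      (\<forall>x\<in>{0<..<R} - S. \<exists>zxx zt. (zx has_real_derivative zxx) (at x) \<and>
         ((\<lambda>s. z x s) has_real_derivative zt) (at t) \<and> zt = d * zxx - a * zx x + f x t) \<and>
      d * zx 0 = a * z 0 t \<and> zx R = b * z R t)"

definition bvp :: "real \<Rightarrow> real \<Rightarrow> real \<Rightarrow> real \<Rightarrow> real set \<Rightarrow> (real \<Rightarrow> real) \<Rightarrow> (real \<Rightarrow> real) \<Rightarrow>
    (real \<Rightarrow> real) \<Rightarrow> bool" where
  "bvp d a b R S z zx f \<longleftrightarrow>
    (\<forall>x\<in>{0..R}. (z has_real_derivative zx x) (at x within {0..R})) \<and>
    (\<forall>x\<in>{0<..<R} - S. \<exists>zxx. (zx has_real_derivative zxx) (at x) \<and> d * zxx - a * zx x + f x = 0) \<and>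
    d * zx 0 = a * z 0 \<and> zx R = b * z R"

lemma parabD:
  assumes "parab d a b R S T z f" "T < t"
  obtains zx where "\<And>x. x \<in> {0..R} \<Longrightarrow> ((\<lambda>y. z y t) has_real_derivative zx x) (at x within {0..R})"
    "\<And>x. x \<in> {0<..<R} - S \<Longrightarrow> \<exists>zxx zt. (zx has_real_derivative zxx) (at x) \<and>
         ((\<lambda>s. z x s) has_real_derivative zt) (at t) \<and> zt = d * zxx - a * zx x + f x t"
    "d * zx 0 = a * z 0 t" "zx R = b * z R t"
  using assms unfolding parab_def by blast

lemma parab_cont: "parab d a b R S T z f \<Longrightarrow> continuous_on ({0..R} \<times> {T..}) (\<lambda>(x,t). z x t)"
  by (simp add: parab_def)

lemma parab_cont_space:
  assumes "parab d a b R S T z f" "T \<le> t"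
  shows "continuous_on {0..R} (\<lambda>x. z x t)"
proof -
  have "continuous_on {0..R} ((\<lambda>(x,t). z x t) \<circ> (\<lambda>x. (x, t)))"
    by (intro continuous_on_compose continuous_on_subset[OF parab_cont[OF assms(1)]] continuous_intros)
       (use assms(2) in auto)
  thus ?thesis by (simp add: o_def)
qed

lemma bvp_cont: "bvp d a b R S z zx f \<Longrightarrow> continuous_on {0..R} z"
  unfolding bvp_def by (meson DERIV_continuous continuous_on_eq_continuous_within)

lemma parab_mono:
  assumes "parab d a b R S T z f" "S \<subseteq> S'" "T \<le> T'"
    and ff: "\<And>x t. x \<in> {0<..<R} - S' \<Longrightarrow> T' < t \<Longrightarrow> f x t = f' x t"
  shows "parab d a b R S' T' z f'"
  unfolding parab_def
proof (intro conjI allI impI)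
  show "continuous_on ({0..R} \<times> {T'..}) (\<lambda>(x,t). z x t)"
    by (rule continuous_on_subset[OF parab_cont[OF assms(1)]]) (use assms(3) in auto)
  fix t assume t: "T' < t"
  with assms(3) have "T < t" by simp
  from parabD[OF assms(1) this] obtain zx where zx:
    "\<And>x. x \<in> {0..R} \<Longrightarrow> ((\<lambda>y. z y t) has_real_derivative zx x) (at x within {0..R})"
    "\<And>x. x \<in> {0<..<R} - S \<Longrightarrow> \<exists>zxx zt. (zx has_real_derivative zxx) (at x) \<and>
         ((\<lambda>s. z x s) has_real_derivative zt) (at t) \<and> zt = d * zxx - a * zx x + f x t"
    "d * zx 0 = a * z 0 t" "zx R = b * z R t" by blast
  have "\<exists>zxx zt. (zx has_real_derivative zxx) (at x) \<and>
         ((\<lambda>s. z x s) has_real_derivative zt) (at t) \<and> zt = d * zxx - a * zx x + f' x t"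
    if "x \<in> {0<..<R} - S'" for x
    using zx(2)[of x] ff[OF that t] that assms(2) by auto
  thus "\<exists>zx. (\<forall>x\<in>{0..R}. ((\<lambda>y. z y t) has_real_derivative zx x) (at x within {0..R})) \<and>
      (\<forall>x\<in>{0<..<R} - S'. \<exists>zxx zt. (zx has_real_derivative zxx) (at x) \<and>
         ((\<lambda>s. z x s) has_real_derivative zt) (at t) \<and> zt = d * zxx - a * zx x + f' x t) \<and>
      d * zx 0 = a * z 0 t \<and> zx R = b * z R t"
    using zx by (intro exI[of _ zx]) blast
qed

lemma parab_lincomb:
  assumes "parab d a b R S T z f" "parab d a b R S T w g"
  shows "parab d a b R S T (\<lambda>x t. c * z x t + e * w x t) (\<lambda>x t. c * f x t + e * g x t)"
  unfolding parab_def
proof (intro conjI allI impI)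
  show "continuous_on ({0..R} \<times> {T..}) (\<lambda>(x,t). c * z x t + e * w x t)"
    using parab_cont[OF assms(1)] parab_cont[OF assms(2)]
    unfolding case_prod_unfold by (intro continuous_intros)
  fix t assume t: "T < t"
  from parabD[OF assms(1) t] obtain zx where zx:
    "\<And>x. x \<in> {0..R} \<Longrightarrow> ((\<lambda>y. z y t) has_real_derivative zx x) (at x within {0..R})"
    "\<And>x. x \<in> {0<..<R} - S \<Longrightarrow> \<exists>zxx zt. (zx has_real_derivative zxx) (at x) \<and>
         ((\<lambda>s. z x s) has_real_derivative zt) (at t) \<and> zt = d * zxx - a * zx x + f x t"
    "d * zx 0 = a * z 0 t" "zx R = b * z R t" by blast
  from parabD[OF assms(2) t] obtain wx where wx:
    "\<And>x. x \<in> {0..R} \<Longrightarrow> ((\<lambda>y. w y t) has_real_derivative wx x) (at x within {0..R})"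
    "\<And>x. x \<in> {0<..<R} - S \<Longrightarrow> \<exists>zxx zt. (wx has_real_derivative zxx) (at x) \<and>
         ((\<lambda>s. w x s) has_real_derivative zt) (at t) \<and> zt = d * zxx - a * wx x + g x t"
    "d * wx 0 = a * w 0 t" "wx R = b * w R t" by blast
  have i: "\<exists>zxx zt. ((\<lambda>x. c * zx x + e * wx x) has_real_derivative zxx) (at x) \<and>
         ((\<lambda>s. c * z x s + e * w x s) has_real_derivative zt) (at t) \<and>
         zt = d * zxx - a * (c * zx x + e * wx x) + (c * f x t + e * g x t)"
    if x: "x \<in> {0<..<R} - S" for x
  proof -
    from zx(2)[OF x] obtain z2 zt where 1: "(zx has_real_derivative z2) (at x)"
      "((\<lambda>s. z x s) has_real_derivative zt) (at t)" "zt = d * z2 - a * zx x + f x t" by blast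
    from wx(2)[OF x] obtain w2 wt where 2: "(wx has_real_derivative w2) (at x)"
      "((\<lambda>s. w x s) has_real_derivative wt) (at t)" "wt = d * w2 - a * wx x + g x t" by blast
    have "c * zt + e * wt = d * (c * z2 + e * w2) - a * (c * zx x + e * wx x) + (c * f x t + e * g x t)"
      unfolding 1(3) 2(3) by (simp add: algebra_simps)
    thus ?thesis using 1 2
      by (intro exI[of _ "c * z2 + e * w2"] exI[of _ "c * zt + e * wt"] conjI DERIV_add DERIV_cmult)
  qed
  have k: "((\<lambda>y. c * z y t + e * w y t) has_real_derivative c * zx x + e * wx x) (at x within {0..R})"
    if "x \<in> {0..R}" for x using zx(1)[OF that] wx(1)[OF that] by (intro DERIV_add DERIV_cmult)
  have "d * (c * zx 0 + e * wx 0) = c * (d * zx 0) + e * (d * wx 0)" by (simp add: algebra_simps)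
  also have "\<dots> = a * (c * z 0 t + e * w 0 t)" unfolding zx(3) wx(3) by (simp add: algebra_simps)
  finally have b0: "d * (c * zx 0 + e * wx 0) = a * (c * z 0 t + e * w 0 t)" .
  have bR: "c * zx R + e * wx R = b * (c * z R t + e * w R t)"
    unfolding zx(4) wx(4) by (simp add: algebra_simps)
  show "\<exists>zx. (\<forall>x\<in>{0..R}. ((\<lambda>y. c * z y t + e * w y t) has_real_derivative zx x) (at x within {0..R})) \<and>
      (\<forall>x\<in>{0<..<R} - S. \<exists>zxx zt. (zx has_real_derivative zxx) (at x) \<and>
         ((\<lambda>s. c * z x s + e * w x s) has_real_derivative zt) (at t) \<and>
         zt = d * zxx - a * zx x + (c * f x t + e * g x t)) \<and>
      d * zx 0 = a * (c * z 0 t + e * w 0 t) \<and> zx R = b * (c * z R t + e * w R t)"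
    using i k b0 bR by (intro exI[of _ "\<lambda>x. c * zx x + e * wx x"]) blast
qed

lemma parab_diff:
  assumes "parab d a b R S T z f" "parab d a b R S T w g"
  shows "parab d a b R S T (\<lambda>x t. z x t - w x t) (\<lambda>x t. f x t - g x t)"
  using parab_lincomb[OF assms, of 1 "-1"] by simp

lemma parab_minus:
  assumes "parab d a b R S T z f"
  shows "parab d a b R S T (\<lambda>x t. - z x t) (\<lambda>x t. - f x t)"
  using parab_lincomb[OF assms assms, of "-1" 0] by simp

lemma bvp_parab:
  assumes "bvp d a b R S z zx f"
  shows "parab d a b R S T (\<lambda>x t. z x) (\<lambda>x t. f x)"
  unfolding parab_def
proof (intro conjI allI impI)
  have "continuous_on ({0..R} \<times> {T..}) (\<lambda>p. z (fst p))"
    by (rule continuous_on_compose2[OF bvp_cont[OF assms]]) (auto intro!: continuous_intros)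
  thus "continuous_on ({0..R} \<times> {T..}) (\<lambda>(x,t). z x)" by (simp add: case_prod_unfold)
  fix t
  have "\<exists>zxx zt. (zx has_real_derivative zxx) (at x) \<and>
         ((\<lambda>s. z x) has_real_derivative zt) (at t) \<and> zt = d * zxx - a * zx x + f x"
    if x: "x \<in> {0<..<R} - S" for x
  proof -
    from assms x obtain zxx where "(zx has_real_derivative zxx) (at x)" "d * zxx - a * zx x + f x = 0"
      unfolding bvp_def by blast
    thus ?thesis by (intro exI[of _ zxx] exI[of _ 0]) simp
  qed
  thus "\<exists>zx. (\<forall>x\<in>{0..R}. (z has_real_derivative zx x) (at x within {0..R})) \<and>
      (\<forall>x\<in>{0<..<R} - S. \<exists>zxx zt. (zx has_real_derivative zxx) (at x) \<and>
         ((\<lambda>s. z x) has_real_derivative zt) (at t) \<and> zt = d * zxx - a * zx x + f x) \<and>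
      d * zx 0 = a * z 0 \<and> zx R = b * z R"
    using assms unfolding bvp_def by (intro exI[of _ zx]) auto
qed

lemma parab_le_exp:
  assumes par: "parab d a b R S T0 z f"
    and pos: "0 < R" "0 < d" "0 \<le> a" "d * b \<le> a" "finite S"
    and c: "\<And>t. T0 < t \<Longrightarrow> t \<le> T1 \<Longrightarrow> (c has_real_derivative c' t) (at t)"
      "continuous_on {T0..T1} c" "\<And>t. T0 < t \<Longrightarrow> t \<le> T1 \<Longrightarrow> 0 \<le> c t"
    and init: "\<And>x. x \<in> {0..R} \<Longrightarrow> z x T0 \<le> c T0 * exp (a / d * x)"
    and le: "\<And>x t. T0 < t \<Longrightarrow> t \<le> T1 \<Longrightarrow> x \<in> {0<..<R} - S \<Longrightarrow> z x t > c t * exp (a / d * x) \<Longrightarrow>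
      f x t \<le> c' t * exp (a / d * x) + K * (z x t - c t * exp (a / d * x))"
    and xt: "x \<in> {0..R}" "t \<in> {T0..T1}"
  shows "z x t \<le> c t * exp (a / d * x)"
proof -
  define e where "e = (\<lambda>x. exp (a / d * x))"
  have epos: "e x > 0" for x by (simp add: e_def)
  have De: "(e has_real_derivative a / d * e x) (at x within A)" for x A
    unfolding e_def using pos(2) by (auto intro!: derivative_eq_intros)
  define v where "v = (\<lambda>x t. z x t - c t * e x)"
  have "v x t \<le> 0"
  proof (rule parabolic_max_principle[OF pos(1,2,3,5) _ _ _ xt])
    have 1: "continuous_on ({0..R} \<times> {T0..T1}) (\<lambda>p. z (fst p) (snd p))"
      using parab_cont[OF par] unfolding case_prod_unfold by (rule continuous_on_subset) auto
    have 2: "continuous_on ({0..R} \<times> {T0..T1}) (\<lambda>p. c (snd p))"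
      by (rule continuous_on_compose2[OF c(2)]) (auto intro!: continuous_intros)
    show "continuous_on ({0..R} \<times> {T0..T1}) (\<lambda>(x, t). v x t)"
      unfolding v_def e_def case_prod_unfold by (intro continuous_intros 1 2) (use pos in auto)
    show "v x T0 \<le> 0" if "x \<in> {0..R}" for x using init[OF that] by (simp add: v_def e_def)
    fix t assume t: "T0 < t" "t \<le> T1"
    from parabD[OF par t(1)] obtain zx where zx:
      "\<And>x. x \<in> {0..R} \<Longrightarrow> ((\<lambda>y. z y t) has_real_derivative zx x) (at x within {0..R})"
      "\<And>x. x \<in> {0<..<R} - S \<Longrightarrow> \<exists>zxx zt. (zx has_real_derivative zxx) (at x) \<and>
         ((\<lambda>s. z x s) has_real_derivative zt) (at t) \<and> zt = d * zxx - a * zx x + f x t"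
      "d * zx 0 = a * z 0 t" "zx R = b * z R t" by blast
    define vx where "vx = (\<lambda>x. zx x - c t * (a / d * e x))"
    have vd: "((\<lambda>y. v y t) has_real_derivative vx x) (at x within {0..R})" if "x \<in> {0..R}" for x
      unfolding v_def vx_def by (intro DERIV_diff zx(1)[OF that] DERIV_cmult De)
    have "d * vx 0 = d * zx 0 - c t * (a * e 0)" using pos by (simp add: vx_def algebra_simps)
    also have "\<dots> = a * v 0 t" unfolding zx(3) by (simp add: v_def algebra_simps)
    finally have left: "d * vx 0 = a * v 0 t" .
    have right: "d * vx R \<le> a * v R t" if vp: "v R t > 0"
    proof -
      have "z R t > 0" using vp c(3)[OF t] epos[of R] by (simp add: v_def) (smt (verit) mult_nonneg_nonneg)
      hence "d * b * z R t \<le> a * z R t" using pos(4) by (intro mult_right_mono) auto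
      moreover have "d * vx R = d * b * z R t - c t * (a * e R)"
        unfolding vx_def zx(4) using pos by (simp add: algebra_simps)
      ultimately show ?thesis by (simp add: v_def algebra_simps)
    qed
    have int: "\<exists>vxx vt. (vx has_real_derivative vxx) (at x) \<and>
           ((\<lambda>s. v x s) has_real_derivative vt) (at t) \<and>
           vt \<le> d * vxx - a * vx x + K * v x t" if x: "x \<in> {0<..<R} - S" and vp: "v x t > 0" for x
    proof -
      from zx(2)[OF x] obtain z2 zt where z2: "(zx has_real_derivative z2) (at x)"
        "((\<lambda>s. z x s) has_real_derivative zt) (at t)" "zt = d * z2 - a * zx x + f x t" by blast
      have 1: "(vx has_real_derivative z2 - c t * (a / d * (a / d * e x))) (at x)"
        unfolding vx_def by (intro DERIV_diff z2 DERIV_cmult De)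
      have 2: "((\<lambda>s. v x s) has_real_derivative zt - c' t * e x) (at t)"
        unfolding v_def by (intro DERIV_diff z2 DERIV_cmult_right c t)
      have "f x t \<le> c' t * e x + K * v x t"
        using le[OF t x] vp by (simp add: v_def e_def)
      hence "zt - c' t * e x \<le> d * z2 - a * zx x + K * v x t" unfolding z2(3) by simp
      also have "\<dots> = d * (z2 - c t * (a / d * (a / d * e x))) - a * vx x + K * v x t"
        using pos by (simp add: vx_def algebra_simps)
      finally show ?thesis using 1 2 by blast
    qed
    show "\<exists>vx. (\<forall>x\<in>{0..R}. ((\<lambda>y. v y t) has_real_derivative vx x) (at x within {0..R})) \<and>
        (v 0 t > 0 \<longrightarrow> a * v 0 t \<le> d * vx 0) \<and> (v R t > 0 \<longrightarrow> d * vx R \<le> a * v R t) \<and>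
        (\<forall>x\<in>{0<..<R} - S. v x t > 0 \<longrightarrow> (\<exists>vxx vt. (vx has_real_derivative vxx) (at x) \<and>
           ((\<lambda>s. v x s) has_real_derivative vt) (at t) \<and>
           vt \<le> d * vxx - a * vx x + K * v x t))"
      by (intro exI[of _ vx] conjI ballI impI vd right int) (use left in auto)
  qed
  thus ?thesis by (simp add: v_def e_def)
qed

lemma parab_nonpos:
  assumes par: "parab d a b R S T0 z f"
    and pos: "0 < R" "0 < d" "0 \<le> a" "d * b \<le> a" "finite S"
    and init: "\<And>x. x \<in> {0..R} \<Longrightarrow> z x T0 \<le> 0"
    and le: "\<And>x t. T0 < t \<Longrightarrow> t \<le> T1 \<Longrightarrow> x \<in> {0<..<R} - S \<Longrightarrow> z x t > 0 \<Longrightarrow> f x t \<le> K * z x t"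
    and xt: "x \<in> {0..R}" "t \<in> {T0..T1}"
  shows "z x t \<le> 0"
  using parab_le_exp[OF par pos, of T1 "\<lambda>_. 0" "\<lambda>_. 0" K x t] init le xt by auto

lemma bounded_above_on_interval:
  fixes f :: "real \<Rightarrow> real"
  assumes "continuous_on {l..r} f"
  obtains M where "0 < M" "\<And>x. x \<in> {l..r} \<Longrightarrow> \<bar>f x\<bar> \<le> M"
proof -
  have "bounded (f ` {l..r})" by (intro compact_imp_bounded compact_continuous_image assms) auto
  then obtain M where M: "\<And>x. x \<in> {l..r} \<Longrightarrow> norm (f x) \<le> M" unfolding bounded_iff by blast
  show ?thesis by (rule that[of "\<bar>M\<bar> + 1"]) (use M in fastforce)+
qed

lemma parab_exp_decay:
  assumes par: "parab d a b R S T0 z f"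
    and pos: "0 < R" "0 < d" "0 \<le> a" "d * b \<le> a" "finite S"
    and k: "0 < k" and g: "0 \<le> g"
    and le: "\<And>x t. T0 < t \<Longrightarrow> x \<in> {0<..<R} - S \<Longrightarrow> z x t > 0 \<Longrightarrow> f x t \<le> - k * z x t + k * g"
  obtains C where "0 < C" "\<And>x t. x \<in> {0..R} \<Longrightarrow> T0 \<le> t \<Longrightarrow> z x t \<le> (g + C * exp (- k * (t - T0))) * exp (a / d * x)"
proof -
  obtain C where C: "0 < C" "\<And>x. x \<in> {0..R} \<Longrightarrow> \<bar>z x T0\<bar> \<le> C"
    using bounded_above_on_interval[OF parab_cont_space[OF par order_refl]] by blast
  define c where "c = (\<lambda>t. g + C * exp (- k * (t - T0)))"
  have c0: "c t \<ge> 0" for t using C g by (simp add: c_def)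
  show ?thesis
  proof (rule that[OF C(1)])
    fix x t assume x: "x \<in> {0..R}" and t: "T0 \<le> t"
    have "z x t \<le> c t * exp (a / d * x)"
    proof (rule parab_le_exp[OF par pos, of t c "\<lambda>t. - k * (c t - g)" "- k"])
      show "(c has_real_derivative - k * (c t - g)) (at t)" for t
        unfolding c_def by (auto intro!: derivative_eq_intros)
      show "continuous_on {T0..t} c" unfolding c_def by (intro continuous_intros)
      show "0 \<le> c t" for t by (rule c0)
      show "z x T0 \<le> c T0 * exp (a / d * x)" if "x \<in> {0..R}" for x
      proof -
        have "z x T0 \<le> (g + C) * 1" using C(2)[OF that] g by simp
        also have "\<dots> \<le> (g + C) * exp (a / d * x)"
          using C(1) g that pos by (intro mult_left_mono) auto
        finally show ?thesis by (simp add: c_def)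
      qed
      fix x s assume s: "T0 < s" and x: "x \<in> {0<..<R} - S" and zc: "z x s > c s * exp (a / d * x)"
      have "z x s > 0" using zc c0[of s] by (smt (verit) exp_ge_zero mult_nonneg_nonneg)
      hence "f x s \<le> - k * z x s + k * g" using le s x by blast
      also have "\<dots> \<le> - k * z x s + k * (g * exp (a / d * x))"
        using k g pos x by (simp add: mult_le_cancel_left1)
      also have "\<dots> = - k * (c s - g) * exp (a / d * x) + - k * (z x s - c s * exp (a / d * x))"
        by (simp add: algebra_simps)
      finally show "f x s \<le> - k * (c s - g) * exp (a / d * x) + - k * (z x s - c s * exp (a / d * x))" .
    qed (use x t in auto)
    thus "z x t \<le> (g + C * exp (- k * (t - T0))) * exp (a / d * x)" by (simp add: c_def)
  qed
qed

lemma parab_limsup_nonpos: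
  assumes par: "parab d a b R S T0 z f"
    and pos: "0 < R" "0 < d" "0 \<le> a" "d * b \<le> a" "finite S"
    and k: "0 < k"
    and le: "\<And>e. e > 0 \<Longrightarrow> \<exists>T\<ge>T0. \<forall>t>T. \<forall>x\<in>{0<..<R} - S. z x t > 0 \<longrightarrow> f x t \<le> - k * z x t + e"
    and e: "e > 0"
  shows "\<exists>T\<ge>T0. \<forall>t\<ge>T. \<forall>x\<in>{0..R}. z x t \<le> e"
proof -
  define X where "X = exp (a / d * R)"
  have X: "X > 0" by (simp add: X_def)
  define g where "g = e / X / 2"
  have g: "g > 0" using e X by (simp add: g_def)
  from le[of "k * g"] k g obtain T1 where T1: "T1 \<ge> T0"
    "\<And>t x. t > T1 \<Longrightarrow> x\<in>{0<..<R} - S \<Longrightarrow> z x t > 0 \<Longrightarrow> f x t \<le> - k * z x t + k * g" by auto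
  have par1: "parab d a b R S T1 z f" using parab_mono[OF par order_refl T1(1)] by blast
  obtain C where C: "0 < C"
    "\<And>x t. x \<in> {0..R} \<Longrightarrow> T1 \<le> t \<Longrightarrow> z x t \<le> (g + C * exp (- k * (t - T1))) * exp (a / d * x)"
    using parab_exp_decay[OF par1 pos k less_imp_le[OF g] T1(2)] by blast
  define T2 where "T2 = T1 + ln (C / g) / k"
  have T2: "C * exp (- k * (t - T1)) \<le> g" if "t \<ge> T2" for t
  proof -
    have "ln (C / g) / k \<le> t - T1" using that by (simp add: T2_def)
    hence "ln (C / g) \<le> k * (t - T1)" using k by (simp add: field_simps)
    hence "exp (ln (C / g)) \<le> exp (k * (t - T1))" by simp
    hence "C \<le> g * exp (k * (t - T1))" using C(1) g by (simp add: field_simps)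
    moreover have "exp (- k * (t - T1)) = 1 / exp (k * (t - T1))" by (simp add: exp_minus divide_inverse)
    ultimately show ?thesis by (simp add: pos_divide_le_eq)
  qed
  have "z x t \<le> e" if "t \<ge> max T1 T2" "x \<in> {0..R}" for x t
  proof -
    have "z x t \<le> (g + C * exp (- k * (t - T1))) * exp (a / d * x)" using that by (intro C) auto
    also have "\<dots> \<le> (g + g) * X"
    proof (intro mult_mono)
      show "g + C * exp (- k * (t - T1)) \<le> g + g" using T2[of t] that by simp
      show "exp (a / d * x) \<le> X" unfolding X_def using that pos by (simp add: divide_right_mono mult_left_mono)
    qed (use g in auto)
    also have "\<dots> = e" using X by (simp add: g_def)
    finally show ?thesis .
  qed
  thus ?thesis using T1(1) by (intro exI[of _ "max T1 T2"]) auto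
qed

lemma bvp_nonpos:
  assumes "bvp d a b R S z zx f"
    and pos: "0 < R" "0 < d" "0 \<le> a" "d * b \<le> a" "finite S"
    and k: "0 < k"
    and le: "\<And>x. x \<in> {0<..<R} - S \<Longrightarrow> z x > 0 \<Longrightarrow> f x \<le> - k * z x"
    and x: "x \<in> {0..R}"
  shows "z x \<le> 0"
proof (rule field_le_epsilon)
  fix e :: real assume e: "e > 0"
  have "\<exists>T\<ge>0::real. \<forall>t\<ge>T. \<forall>x\<in>{0..R}. z x \<le> e"
  proof (rule parab_limsup_nonpos[OF bvp_parab[OF assms(1), of 0] pos k _ e])
    fix e :: real assume "e > 0"
    thus "\<exists>T\<ge>0::real. \<forall>t>T. \<forall>x\<in>{0<..<R} - S. z x > 0 \<longrightarrow> f x \<le> - k * z x + e"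
      using le by (intro exI[of _ 0]) fastforce
  qed
  thus "z x \<le> 0 + e" using x by auto
qed

lemma bvp_lincomb:
  assumes "bvp d a b R S z zx f" "bvp d a b R S w wx g"
  shows "bvp d a b R S (\<lambda>x. c * z x + e * w x) (\<lambda>x. c * zx x + e * wx x) (\<lambda>x. c * f x + e * g x)"
  unfolding bvp_def
proof (intro conjI ballI)
  fix x assume "x \<in> {0..R}"
  thus "((\<lambda>x. c * z x + e * w x) has_real_derivative c * zx x + e * wx x) (at x within {0..R})"
    using assms unfolding bvp_def by (intro DERIV_add DERIV_cmult) auto
next
  fix x assume x: "x \<in> {0<..<R} - S"
  from assms x obtain z2 w2 where 1: "(zx has_real_derivative z2) (at x)" "d * z2 - a * zx x + f x = 0"
    and 2: "(wx has_real_derivative w2) (at x)" "d * w2 - a * wx x + g x = 0"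
    unfolding bvp_def by blast
  have "d * (c * z2 + e * w2) - a * (c * zx x + e * wx x) + (c * f x + e * g x) =
    c * (d * z2 - a * zx x + f x) + e * (d * w2 - a * wx x + g x)" by (simp add: algebra_simps)
  hence "d * (c * z2 + e * w2) - a * (c * zx x + e * wx x) + (c * f x + e * g x) = 0"
    using 1 2 by simp
  thus "\<exists>zxx. ((\<lambda>x. c * zx x + e * wx x) has_real_derivative zxx) (at x) \<and>
    d * zxx - a * (c * zx x + e * wx x) + (c * f x + e * g x) = 0"
    using 1 2 by (intro exI[of _ "c * z2 + e * w2"] conjI DERIV_add DERIV_cmult)
next
  have "d * (c * zx 0 + e * wx 0) = c * (d * zx 0) + e * (d * wx 0)" by (simp add: algebra_simps)
  also have "\<dots> = c * (a * z 0) + e * (a * w 0)" using assms unfolding bvp_def by metis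
  finally show "d * (c * zx 0 + e * wx 0) = a * (c * z 0 + e * w 0)" by (simp add: algebra_simps)
next
  show "c * zx R + e * wx R = b * (c * z R + e * w R)"
    using assms unfolding bvp_def by (simp add: algebra_simps)
qed

lemma bvp_diff:
  assumes "bvp d a b R S z zx f" "bvp d a b R S w wx g"
  shows "bvp d a b R S (\<lambda>x. z x - w x) (\<lambda>x. zx x - wx x) (\<lambda>x. f x - g x)"
  using bvp_lincomb[OF assms, of 1 "-1"] by simp

lemma bvp_mono:
  assumes "bvp d a b R S z zx f" "S \<subseteq> S'"
    and "\<And>x. x \<in> {0<..<R} - S' \<Longrightarrow> f x = f' x"
  shows "bvp d a b R S' z zx f'"
  using assms unfolding bvp_def by fastforce

section \<open>The Green operator of a constant coefficient boundary value problem\<close>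

definition bint :: "real \<Rightarrow> (real \<Rightarrow> real) \<Rightarrow> bool" where
  "bint R f \<longleftrightarrow> f integrable_on {0..R} \<and> (\<exists>M. \<forall>x\<in>{0..R}. \<bar>f x\<bar> \<le> M)"

lemma bint_absolutely_integrable:
  assumes "bint R f" shows "f absolutely_integrable_on {0..R}"
proof -
  from assms obtain M where "\<forall>x\<in>{0..R}. \<bar>f x\<bar> \<le> M" "f integrable_on {0..R}" by (auto simp: bint_def)
  thus ?thesis by (intro absolutely_integrable_integrable_bound[of _ _ "\<lambda>_. M"]) (auto intro: integrable_const_ivl)
qed

lemma bint_cont:
  assumes "continuous_on {0..R} f" shows "bint R f"
  using bounded_above_on_interval[OF assms] integrable_continuous_real[OF assms] unfolding bint_def by metis

lemma bint_mult:
  assumes "bint R f" "bint R g" shows "bint R (\<lambda>x. f x * g x)"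
proof -
  from assms obtain M N where M: "\<And>x. x\<in>{0..R} \<Longrightarrow> \<bar>f x\<bar> \<le> M" and N: "\<And>x. x\<in>{0..R} \<Longrightarrow> \<bar>g x\<bar> \<le> N"
    unfolding bint_def by blast
  have "(\<lambda>x. f x * g x) absolutely_integrable_on {0..R}"
  proof (rule absolutely_integrable_bounded_measurable_product_real)
    show "f \<in> borel_measurable (lebesgue_on {0..R})"
      using assms(1) by (intro integrable_imp_measurable) (auto simp: bint_def)
    show "bounded (f ` {0..R})" unfolding bounded_iff using M by (intro exI[of _ M]) auto
  qed (use bint_absolutely_integrable[OF assms(2)] in auto)
  hence "(\<lambda>x. f x * g x) integrable_on {0..R}" by (simp add: absolutely_integrable_on_def)
  moreover have "\<bar>f x * g x\<bar> \<le> M * N" if "x \<in> {0..R}" for x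
    using mult_mono[OF M[OF that] N[OF that]] M[OF that] by (simp add: abs_mult)
  ultimately show ?thesis unfolding bint_def by blast
qed

lemma bint_add:
  assumes "bint R f" "bint R g" shows "bint R (\<lambda>x. f x + g x)"
proof -
  from assms obtain M N where M: "\<And>x. x\<in>{0..R} \<Longrightarrow> \<bar>f x\<bar> \<le> M" and N: "\<And>x. x\<in>{0..R} \<Longrightarrow> \<bar>g x\<bar> \<le> N"
    unfolding bint_def by blast
  have "\<bar>f x + g x\<bar> \<le> M + N" if "x \<in> {0..R}" for x using M[OF that] N[OF that] by linarith
  thus ?thesis using assms integrable_add[of f "{0..R}" g] unfolding bint_def by blast
qed

lemma bint_diff:
  assumes "bint R f" "bint R g" shows "bint R (\<lambda>x. f x - g x)"
proof -
  have "bint R (\<lambda>x. (-1) * g x)" by (intro bint_mult assms bint_cont) auto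
  from bint_add[OF assms(1) this] show ?thesis by simp
qed

lemma bint_cong:
  assumes "bint R f" "\<And>x. x \<in> {0..R} \<Longrightarrow> f x = g x" shows "bint R g"
  using assms integrable_cong[of "{0..R}" f g] unfolding bint_def by auto

lemma dominated_convergence_bint:
  assumes "\<And>n. bint R (f n)" "\<And>n x. x \<in> {0..R} \<Longrightarrow> \<bar>f n x\<bar> \<le> M"
    and "\<And>x. x \<in> {0..R} \<Longrightarrow> (\<lambda>n. f n x) \<longlonglongrightarrow> g x"
  shows "bint R g"
proof -
  have "g integrable_on {0..R}"
    by (rule dominated_convergence(1)[of f _ "\<lambda>_. M"]) (use assms in \<open>auto simp: bint_def\<close>)
  moreover have "\<bar>g x\<bar> \<le> M" if "x \<in> {0..R}" for x
    using LIMSEQ_le_const2[OF tendsto_rabs[OF assms(3)[OF that]]] assms(2)[OF that] by blast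
  ultimately show ?thesis unfolding bint_def by blast
qed

locale green_op =
  fixes d a b K R :: real
  assumes pos: "0 < d" "0 \<le> a" "0 \<le> b" "d * b \<le> a" "0 < K" "0 < R"
begin

definition "al = a / d"
definition "m1 = (a + sqrt (a\<^sup>2 + 4 * d * K)) / (2 * d)"
definition "m2 = (a - sqrt (a\<^sup>2 + 4 * d * K)) / (2 * d)"
definition "A x = m1 * exp (m1 * x) - m2 * exp (m2 * x)"
definition "A' x = m1\<^sup>2 * exp (m1 * x) - m2\<^sup>2 * exp (m2 * x)"
definition "B x = (b - m2) * exp (m1 * (x - R)) + (m1 - b) * exp (m2 * (x - R))"
definition "B' x = (b - m2) * m1 * exp (m1 * (x - R)) + (m1 - b) * m2 * exp (m2 * (x - R))"
definition "W0 = (m1 - m2) * (m1 * (m1 - b) * exp (- m2 * R) + m2 * (b - m2) * exp (- m1 * R))"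
definition "PA f x = integral {0..x} (\<lambda>y. A y * exp (- al * y) * f y)"
definition "PB f x = integral {x..R} (\<lambda>y. B y * exp (- al * y) * f y)"
definition "green f x = (B x * PA f x + A x * PB f x) / (d * W0)"
definition "green' f x = (B' x * PA f x + A' x * PB f x) / (d * W0)"

lemma disc: "sqrt (a\<^sup>2 + 4 * d * K) > a"
  using pos by (intro real_less_rsqrt) auto

lemma m_sign: "m1 > 0" "m2 < 0"
  using disc pos by (auto simp: m1_def m2_def divide_simps)

lemma m_sum: "m1 + m2 = al"
  using pos by (simp add: m1_def m2_def al_def divide_simps)

lemma m_char: "d * m1\<^sup>2 = a * m1 + K" "d * m2\<^sup>2 = a * m2 + K"
proof -
  have s: "(sqrt (a\<^sup>2 + 4 * d * K))\<^sup>2 = a\<^sup>2 + 4 * d * K" using pos by simp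
  show "d * m1\<^sup>2 = a * m1 + K" "d * m2\<^sup>2 = a * m2 + K" unfolding m1_def m2_def
    using pos s by (simp_all add: power_divide divide_simps power2_sum power2_diff) (simp_all add: algebra_simps power2_eq_square)
qed

lemma b_le: "b \<le> al" using pos by (simp add: al_def field_simps)

lemma m1_b: "m1 - b > 0" "b - m2 > 0" "m1 - b \<ge> - m2" "m1 \<ge> b - m2"
  using m_sign m_sum b_le pos by linarith+

lemma A_pos: "A x > 0"
  using m_sign by (simp add: A_def) (smt (verit) exp_gt_zero mult_pos_pos mult_neg_pos)

lemma B_pos: "B x > 0"
  using m1_b by (simp add: B_def add_pos_pos)

lemma W0_pos: "W0 > 0"
proof -
  have "m1 * (m1 - b) \<ge> (b - m2) * (- m2)" using m1_b m_sign by (intro mult_mono) auto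
  hence "m1 * (m1 - b) * exp (- m2 * R) \<ge> (b - m2) * (- m2) * exp (- m2 * R)"
    by (intro mult_right_mono) auto
  moreover have "(b - m2) * (- m2) * exp (- m2 * R) > (b - m2) * (- m2) * exp (- m1 * R)"
    using m1_b m_sign pos by (intro mult_strict_left_mono mult_pos_pos) auto
  ultimately have "m1 * (m1 - b) * exp (- m2 * R) + m2 * (b - m2) * exp (- m1 * R) > 0"
    by (simp add: algebra_simps)
  thus ?thesis using m_sign by (simp add: W0_def)
qed

lemma wronskian: "A' x * B x - A x * B' x = W0 * exp (al * x)"
proof -
  have 1: "exp (m1 * x) * exp (m2 * (x - R)) = exp (al * x) * exp (- m2 * R)"
    "exp (m2 * x) * exp (m1 * (x - R)) = exp (al * x) * exp (- m1 * R)"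
    unfolding m_sum[symmetric] by (simp_all add: algebra_simps flip: exp_add)
  have "A' x * B x - A x * B' x = (m1 - m2) * (m1 * (m1 - b) * (exp (m1 * x) * exp (m2 * (x - R)))
     + m2 * (b - m2) * (exp (m2 * x) * exp (m1 * (x - R))))"
    unfolding A_def A'_def B_def B'_def by algebra
  thus ?thesis unfolding 1 W0_def by (simp add: algebra_simps)
qed

lemma derivs:
  "(A has_real_derivative A' x) (at x within X)" "(B has_real_derivative B' x) (at x within X)"
  "(A' has_real_derivative (a * A' x + K * A x) / d) (at x within X)"
  "(B' has_real_derivative (a * B' x + K * B x) / d) (at x within X)"
proof -
  show "(A has_real_derivative A' x) (at x within X)"
    unfolding A_def A'_def by (auto intro!: derivative_eq_intros simp: power2_eq_square)
  show "(B has_real_derivative B' x) (at x within X)"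
    unfolding B_def B'_def by (auto intro!: derivative_eq_intros simp: algebra_simps)
  have 1: "a * A' x + K * A x = m1 * (a * m1 + K) * exp (m1 * x) - m2 * (a * m2 + K) * exp (m2 * x)"
    unfolding A_def A'_def by (simp add: algebra_simps power2_eq_square)
  have 2: "a * B' x + K * B x = (b - m2) * (a * m1 + K) * exp (m1 * (x - R)) + (m1 - b) * (a * m2 + K) * exp (m2 * (x - R))"
    unfolding B_def B'_def by (simp add: algebra_simps power2_eq_square)
  show "(A' has_real_derivative (a * A' x + K * A x) / d) (at x within X)"
    unfolding 1 m_char[symmetric] unfolding A'_def using pos
    by (auto intro!: derivative_eq_intros simp: field_simps power2_eq_square)
  show "(B' has_real_derivative (a * B' x + K * B x) / d) (at x within X)"
    unfolding 2 m_char[symmetric] unfolding B'_def using pos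
    by (auto intro!: derivative_eq_intros simp: field_simps power2_eq_square)
qed

lemma bc: "d * A' 0 = a * A 0" "B' R = b * B R"
proof -
  have "d * A' 0 = d * m1\<^sup>2 - d * m2\<^sup>2" by (simp add: A'_def algebra_simps)
  thus "d * A' 0 = a * A 0" unfolding m_char by (simp add: A_def algebra_simps)
  show "B' R = b * B R" by (simp add: B'_def B_def algebra_simps)
qed

lemma conts [continuous_intros]:
  "continuous_on X A" "continuous_on X B" "continuous_on X A'" "continuous_on X B'"
  unfolding A_def B_def A'_def B'_def by (auto intro!: continuous_intros)

lemma bint_weight:
  assumes "bint R f"
  shows "bint R (\<lambda>y. A y * exp (- al * y) * f y)" "bint R (\<lambda>y. B y * exp (- al * y) * f y)"
  by (intro bint_mult[OF bint_cont assms] continuous_intros)+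

lemma weight_integrable:
  assumes "bint R f" "0 \<le> x" "y \<le> R"
  shows "(\<lambda>y. A y * exp (- al * y) * f y) integrable_on {x..y}"
    "(\<lambda>y. B y * exp (- al * y) * f y) integrable_on {x..y}"
  using bint_weight[OF assms(1)] assms(2,3)
  by (auto simp: bint_def intro: integrable_subinterval_real)

lemma P_cont:
  assumes "bint R f"
  shows "continuous_on {0..R} (PA f)" "continuous_on {0..R} (PB f)"
  using indefinite_integral_continuous_1[OF weight_integrable(1)[OF assms order_refl order_refl]]
    indefinite_integral_continuous_1'[OF weight_integrable(2)[OF assms order_refl order_refl]]
  by (simp_all add: PA_def[abs_def] PB_def[abs_def])

lemma green_cont:
  assumes "bint R f"
  shows "continuous_on {0..R} (green f)" "continuous_on {0..R} (green' f)"
  unfolding green_def[abs_def] green'_def[abs_def]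
  using P_cont[OF assms] pos W0_pos by (auto intro!: continuous_intros)

lemma green_bvp:
  assumes f: "bint R f" and S: "finite S" and fc: "\<And>x. x \<in> {0<..<R} - S \<Longrightarrow> isCont f x"
  shows "bvp d a b R S (green f) (green' f) (\<lambda>x. f x - K * green f x)"
proof -
  have W: "W0 \<noteq> 0" "d \<noteq> 0" using W0_pos pos by auto
  define e where "e = (\<lambda>y. exp (- al * y))"
  have ee: "exp (al * y) * e y = 1" for y by (simp add: e_def flip: exp_add)
  have DPA: "(PA f has_real_derivative A x * e x * f x) (at x)"
    and DPB: "(PB f has_real_derivative - (B x * e x * f x)) (at x)" if x: "x \<in> {0<..<R} - S" for x
  proof -
    have at: "at x within {0..R} = at x" using x by (intro at_within_interior) auto
    have c: "continuous (at x within {0..R} - {}) (\<lambda>y. A y * exp (- al * y) * f y)"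
       "continuous (at x within {0..R} - {}) (\<lambda>y. B y * exp (- al * y) * f y)"
      using fc[OF x] conts(1,2)[of UNIV] x
      by (auto simp: at A_def B_def intro!: continuous_intros)
    show "(PA f has_real_derivative A x * e x * f x) (at x)"
      using integral_has_vector_derivative_continuous_at[OF weight_integrable(1)[OF f order_refl order_refl] _ _ c(1)] x
      by (simp add: at has_real_derivative_iff_has_vector_derivative PA_def[abs_def] e_def)
    have "((\<lambda>x. integral {0..x} (\<lambda>y. B y * exp (- al * y) * f y)) has_real_derivative B x * e x * f x) (at x)"
      using integral_has_vector_derivative_continuous_at[OF weight_integrable(2)[OF f order_refl order_refl] _ _ c(2)] x
      by (simp add: at has_real_derivative_iff_has_vector_derivative e_def)
    hence "((\<lambda>x. integral {0..R} (\<lambda>y. B y * exp (- al * y) * f y) - integral {0..x} (\<lambda>y. B y * exp (- al * y) * f y))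
       has_real_derivative 0 - B x * e x * f x) (at x)" by (intro DERIV_diff DERIV_const)
    hence "(PB f has_real_derivative 0 - B x * e x * f x) (at x)"
    proof (rule has_field_derivative_transform_within_open[where S="{0<..<R}"])
      fix y assume "y \<in> {0<..<R}"
      thus "integral {0..R} (\<lambda>y. B y * exp (- al * y) * f y) - integral {0..y} (\<lambda>y. B y * exp (- al * y) * f y) = PB f y"
        using Henstock_Kurzweil_Integration.integral_combine[OF _ _ weight_integrable(2)[OF f order_refl order_refl], of y] by (simp add: PB_def)
    qed (use x in auto)
    thus "(PB f has_real_derivative - (B x * e x * f x)) (at x)" by simp
  qed
  have D1: "(green f has_real_derivative green' f x) (at x)" if x: "x \<in> {0<..<R} - S" for x
  proof -
    have "((\<lambda>x. B x * PA f x + A x * PB f x) has_real_derivative B' x * PA f x + A' x * PB f x) (at x)"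
      by (rule DERIV_cong[OF DERIV_add[OF DERIV_mult'[OF derivs(2) DPA[OF x]] DERIV_mult'[OF derivs(1) DPB[OF x]]]])
         (simp add: algebra_simps)
    from DERIV_cdivide[OF this] show ?thesis by (simp add: green_def[abs_def] green'_def)
  qed
  have D2: "(green' f has_real_derivative (a * green' f x + K * green f x - f x) / d) (at x)" if x: "x \<in> {0<..<R} - S" for x
  proof -
    have "((\<lambda>x. B' x * PA f x + A' x * PB f x) has_real_derivative
        B' x * (A x * e x * f x) + (a * B' x + K * B x) / d * PA f x +
        (A' x * (- (B x * e x * f x)) + (a * A' x + K * A x) / d * PB f x)) (at x)"
      by (intro DERIV_add DERIV_mult' derivs DPA DPB x)
    from DERIV_cdivide[OF this, of "d * W0"]
    have 1: "(green' f has_real_derivative (B' x * (A x * e x * f x) + (a * B' x + K * B x) / d * PA f x +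
        (A' x * (- (B x * e x * f x)) + (a * A' x + K * A x) / d * PB f x)) / (d * W0)) (at x)"
      by (simp add: green'_def[abs_def])
    have "B' x * (A x * e x * f x) + A' x * (- (B x * e x * f x)) = - (A' x * B x - A x * B' x) * e x * f x"
      by (simp add: algebra_simps)
    also have "\<dots> = - W0 * f x" unfolding wronskian using ee[of x] by (simp add: algebra_simps)
    finally have 2: "B' x * (A x * e x * f x) + A' x * (- (B x * e x * f x)) = - W0 * f x" .
    have "B' x * (A x * e x * f x) + (a * B' x + K * B x) / d * PA f x +
        (A' x * (- (B x * e x * f x)) + (a * A' x + K * A x) / d * PB f x) =
        (B' x * (A x * e x * f x) + A' x * (- (B x * e x * f x))) +
        (a * (B' x * PA f x + A' x * PB f x) + K * (B x * PA f x + A x * PB f x)) / d"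
      using W by (simp add: field_simps)
    also have "\<dots> = (a * (d * W0 * green' f x) + K * (d * W0 * green f x)) / d - W0 * f x"
      unfolding 2 using W by (simp add: green_def green'_def)
    finally have 3: "B' x * (A x * e x * f x) + (a * B' x + K * B x) / d * PA f x +
        (A' x * (- (B x * e x * f x)) + (a * A' x + K * A x) / d * PB f x) =
        (a * (d * W0 * green' f x) + K * (d * W0 * green f x)) / d - W0 * f x" .
    show ?thesis using 1 unfolding 3 by (rule DERIV_cong) (use W in \<open>simp add: field_simps\<close>)
  qed
  have D: "(green f has_real_derivative green' f x) (at x within {0..R})" if x: "x \<in> {0..R}" for x
  proof -
    have hi: "(green' f has_integral (green f y - green f 0)) {0..y}" if y: "y \<in> {0..R}" for y
    proof (rule fundamental_theorem_of_calculus_interior_strong[OF S])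
      show "continuous_on {0..y} (green f)" by (rule continuous_on_subset[OF green_cont(1)[OF f]]) (use y in auto)
      fix x assume "x \<in> {0<..<y} - S"
      thus "(green f has_vector_derivative green' f x) (at x)"
        using D1[of x] y by (simp add: has_real_derivative_iff_has_vector_derivative)
    qed (use y in auto)
    have int: "green f y = green f 0 + integral {0..y} (green' f)" if "y \<in> {0..R}" for y
      using integral_unique[OF hi[OF that]] by simp
    have "((\<lambda>y. green f 0 + integral {0..y} (green' f)) has_real_derivative 0 + green' f x) (at x within {0..R})"
      by (intro DERIV_add DERIV_const integral_has_real_derivative green_cont f x)
    hence "((\<lambda>y. green f 0 + integral {0..y} (green' f)) has_real_derivative green' f x) (at x within {0..R})" by simp
    thus ?thesis
      by (rule has_field_derivative_transform_within[where d=1]) (rule x zero_less_one int[symmetric]; assumption?)+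
  qed
  have P0: "PA f 0 = 0" "PB f R = 0" by (simp_all add: PA_def PB_def)
  have "d * green' f 0 = d * A' 0 * PB f 0 / (d * W0)" unfolding green'_def P0 by simp
  hence bcs: "d * green' f 0 = a * green f 0" unfolding bc(1) green_def P0 by simp
  have "green' f R = B' R * PA f R / (d * W0)" unfolding green'_def P0 by simp
  hence bcs': "green' f R = b * green f R" unfolding bc(2) green_def P0 by simp
  show ?thesis unfolding bvp_def
  proof (intro conjI ballI bcs bcs' D)
    fix x assume x: "x \<in> {0<..<R} - S"
    show "\<exists>zxx. (green' f has_real_derivative zxx) (at x) \<and> d * zxx - a * green' f x + (f x - K * green f x) = 0"
      by (intro exI[of _ "(a * green' f x + K * green f x - f x) / d"] conjI D2 x) (use W in simp)
  qed
qed

lemma green_mono: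
  assumes f: "bint R f" and g: "bint R g" and le: "\<And>x. x \<in> {0..R} \<Longrightarrow> f x \<le> g x" and x: "x \<in> {0..R}"
  shows "green f x \<le> green g x"
proof -
  have "PA f x \<le> PA g x" unfolding PA_def
    using x le A_pos by (intro integral_le weight_integrable f g mult_left_mono) (auto intro: less_imp_le)
  moreover have "PB f x \<le> PB g x" unfolding PB_def
    using x le B_pos by (intro integral_le weight_integrable f g mult_left_mono) (auto intro: less_imp_le)
  ultimately show ?thesis unfolding green_def using A_pos B_pos pos W0_pos
    by (intro divide_right_mono add_mono mult_left_mono) (auto intro: less_imp_le)
qed

lemma green_diff:
  assumes f: "bint R f" and g: "bint R g" and x: "x \<in> {0..R}"
  shows "green (\<lambda>x. f x - g x) x = green f x - green g x"
proof -
  have "PA (\<lambda>x. f x - g x) x = PA f x - PA g x" unfolding PA_def right_diff_distrib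
    using x by (intro integral_diff weight_integrable f g) auto
  moreover have "PB (\<lambda>x. f x - g x) x = PB f x - PB g x" unfolding PB_def right_diff_distrib
    using x by (intro integral_diff weight_integrable f g) auto
  ultimately show ?thesis by (simp add: green_def right_diff_distrib diff_divide_distrib add_divide_distrib)
qed

lemma green_zero: "green (\<lambda>_. 0) x = 0"
  by (simp add: green_def PA_def PB_def)

lemma green_pos:
  assumes f: "bint R f" and g: "continuous_on {0..R} g"
    and fg: "\<And>x. x \<in> {0..R} \<Longrightarrow> 0 \<le> g x \<and> g x \<le> f x"
    and y: "y \<in> {0..R}" "g y > 0" and x: "x \<in> {0..R}"
  shows "green f x > 0"
proof -
  have cA: "continuous_on {0..x} (\<lambda>y. A y * exp (- al * y) * g y)"
    and cB: "continuous_on {x..R} (\<lambda>y. B y * exp (- al * y) * g y)"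
    by (intro continuous_intros continuous_on_subset[OF g]; use x in auto)+
  have nn: "0 \<le> A y * exp (- al * y) * g y" "0 \<le> B y * exp (- al * y) * g y" if "y \<in> {0..R}" for y
    using fg[OF that] A_pos[of y] B_pos[of y] by simp_all
  have PA0: "PA g x \<ge> 0" unfolding PA_def
    by (rule integral_nonneg[OF integrable_continuous_real[OF cA]]) (use nn(1) x in simp)
  have PB0: "PB g x \<ge> 0" unfolding PB_def
    by (rule integral_nonneg[OF integrable_continuous_real[OF cB]]) (use nn(2) x in simp)
  have "PA g x > 0 \<or> PB g x > 0"
  proof (cases "y \<le> x \<and> 0 < x")
    case True
    have "integral {0..x} (\<lambda>y. A y * exp (- al * y) * g y) = 0 \<longleftrightarrow>
        (\<forall>y\<in>{0..x}. A y * exp (- al * y) * g y = 0)"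
      by (rule integral_eq_0_iff[OF cA]) (use True nn(1) x in auto)
    moreover have "A y * exp (- al * y) * g y \<noteq> 0" "y \<in> {0..x}" using True y A_pos[of y] by auto
    ultimately have "integral {0..x} (\<lambda>y. A y * exp (- al * y) * g y) \<noteq> 0" by blast
    thus ?thesis using PA0 by (auto simp: PA_def)
  next
    case False
    have "x < R" "y \<in> {x..R}" using False y x pos by auto
    have "integral {x..R} (\<lambda>y. B y * exp (- al * y) * g y) = 0 \<longleftrightarrow>
        (\<forall>y\<in>{x..R}. B y * exp (- al * y) * g y = 0)"
      by (rule integral_eq_0_iff[OF cB]) (use \<open>x < R\<close> nn(2) x in auto)
    moreover have "B y * exp (- al * y) * g y \<noteq> 0" using y B_pos[of y] by auto
    ultimately have "integral {x..R} (\<lambda>y. B y * exp (- al * y) * g y) \<noteq> 0" using \<open>y \<in> {x..R}\<close> by blast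
    thus ?thesis using PB0 by (auto simp: PB_def)
  qed
  hence "B x * PA g x + A x * PB g x > 0"
    using PA0 PB0 A_pos[of x] B_pos[of x] by (auto intro: add_pos_nonneg add_nonneg_pos)
  hence "green g x > 0" using pos W0_pos by (simp add: green_def)
  also have "green g x \<le> green f x" using fg by (intro green_mono f bint_cont g x) auto
  finally show ?thesis .
qed

lemma green_tendsto:
  assumes f: "\<And>n. bint R (f n)" and bd: "\<And>n x. x \<in> {0..R} \<Longrightarrow> \<bar>f n x\<bar> \<le> M"
    and lim: "\<And>x. x \<in> {0..R} \<Longrightarrow> (\<lambda>n. f n x) \<longlonglongrightarrow> g x" and x: "x \<in> {0..R}"
  shows "(\<lambda>n. green (f n) x) \<longlonglongrightarrow> green g x"
proof -
  have gen: "(\<lambda>n. integral {l..u} (\<lambda>y. w y * f n y)) \<longlonglongrightarrow> integral {l..u} (\<lambda>y. w y * g y)"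
    if lu: "0 \<le> l" "u \<le> R" and w: "continuous_on {0..R} w" for l u and w :: "real \<Rightarrow> real"
  proof -
    obtain N where N: "0 < N" "\<And>x. x \<in> {0..R} \<Longrightarrow> \<bar>w x\<bar> \<le> N" using bounded_above_on_interval[OF w] by blast
    show ?thesis
    proof (rule dominated_convergence(2)[where h="\<lambda>_. N * M"])
      fix n show "(\<lambda>y. w y * f n y) integrable_on {l..u}"
        using bint_mult[OF bint_cont[OF w] f[of n]] lu by (auto simp: bint_def intro: integrable_subinterval_real)
      fix x assume x: "x \<in> {l..u}"
      have "\<bar>w x\<bar> * \<bar>f n x\<bar> \<le> N * M" using N bd[of x n] x lu by (intro mult_mono) auto
      thus "norm (w x * f n x) \<le> N * M" by (simp add: abs_mult)
    next
      fix x assume "x \<in> {l..u}"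
      thus "(\<lambda>n. w x * f n x) \<longlonglongrightarrow> w x * g x" using lu by (intro tendsto_intros lim) auto
    qed (rule integrable_const_ivl)
  qed
  have "(\<lambda>n. PA (f n) x) \<longlonglongrightarrow> PA g x" "(\<lambda>n. PB (f n) x) \<longlonglongrightarrow> PB g x"
    unfolding PA_def PB_def using x by (auto intro!: gen continuous_intros)
  thus ?thesis unfolding green_def using pos W0_pos by (intro tendsto_intros) auto
qed

lemma green_unique:
  assumes z: "bvp d a b R S z zx (\<lambda>x. f x - K * z x)"
    and f: "bint R f" and S: "finite S" and fc: "\<And>x. x \<in> {0<..<R} - S \<Longrightarrow> isCont f x"
    and x: "x \<in> {0..R}"
  shows "z x = green f x"
proof -
  note g = green_bvp[OF f S fc]
  have "z x - green f x \<le> 0"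
    by (rule bvp_nonpos[OF bvp_diff[OF z g] pos(6,1,2,4) S pos(5) _ x]) (simp_all add: right_diff_distrib)
  moreover have "green f x - z x \<le> 0"
    by (rule bvp_nonpos[OF bvp_diff[OF g z] pos(6,1,2,4) S pos(5) _ x]) (simp_all add: right_diff_distrib)
  ultimately show ?thesis by simp
qed

end

section \<open>Strict subsolutions near zero density\<close>

lemma elliptic_max_principle:
  fixes y yx :: "real \<Rightarrow> real"
  assumes lr: "l < r" and d: "0 < d" and a: "0 \<le> a" and fin: "finite S" and K: "0 < K"
    and der: "\<And>x. x \<in> {l..r} \<Longrightarrow> (y has_real_derivative yx x) (at x within {l..r})"
    and left: "y l > 0 \<Longrightarrow> a * y l \<le> d * yx l" and right: "y r > 0 \<Longrightarrow> d * yx r \<le> a * y r"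
    and int: "\<And>x. x \<in> {l<..<r} - S \<Longrightarrow> y x > 0 \<Longrightarrow>
      \<exists>yxx. (yx has_real_derivative yxx) (at x) \<and> K * y x \<le> d * yxx - a * yx x"
    and x: "x \<in> {l..r}"
  shows "y x \<le> 0"
proof -
  define E where "E = (\<lambda>x. exp (a / d * x))"
  have E: "E x > 0" for x by (simp add: E_def)
  have DE: "(E has_real_derivative a / d * E x) (at x within A)" for x A
    unfolding E_def using d by (auto intro!: derivative_eq_intros)
  have cE: "continuous_on A E" for A unfolding E_def using d by (intro continuous_intros) auto
  have cy: "continuous_on {l..r} y" using der DERIV_continuous continuous_on_eq_continuous_within by blast
  obtain C where C: "0 < C" "\<And>x. x \<in> {l..r} \<Longrightarrow> \<bar>y x / E x\<bar> \<le> C"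
  proof -
    have "continuous_on {l..r} (\<lambda>x. y x / E x)"
      using E by (intro continuous_on_divide cy cE) (simp add: less_imp_neq[symmetric])
    from bounded_above_on_interval[OF this] that show ?thesis by blast
  qed
  have main: "y x \<le> C * exp (- K * t) * E x" if t: "t \<ge> 0" for t
  proof -
    define v where "v = (\<lambda>x t. y x - C * exp (- K * t) * E x)"
    have "v x t \<le> 0"
    proof (rule parabolic_max_principle[OF lr d a fin, of 0 t v "- K"])
      have "continuous_on ({l..r} \<times> {0..t}) (\<lambda>p. y (fst p))"
        by (rule continuous_on_compose2[OF cy]) (auto intro!: continuous_intros)
      moreover have "continuous_on ({l..r} \<times> {0..t}) (\<lambda>p. E (fst p))"
        by (rule continuous_on_compose2[OF cE[of UNIV]]) (auto intro!: continuous_intros)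
      ultimately show "continuous_on ({l..r} \<times> {0..t}) (\<lambda>(x, t). v x t)"
        unfolding v_def case_prod_unfold by (intro continuous_intros) auto
      show "v x 0 \<le> 0" if "x \<in> {l..r}" for x
        using C(2)[OF that] E[of x] by (simp add: v_def abs_le_iff pos_divide_le_eq)
      fix s assume s: "0 < s" "s \<le> t"
      define c where "c = C * exp (- K * s)"
      have c: "c > 0" using C by (simp add: c_def)
      have vp: "y x > 0" if "v x s > 0" for x
      proof -
        have "c * E x > 0" using c E by simp
        thus ?thesis using that by (simp add: v_def c_def)
      qed
      define vx where "vx = (\<lambda>x. yx x - c * (a / d * E x))"
      have 1: "((\<lambda>y. v y s) has_real_derivative vx x) (at x within {l..r})" if "x \<in> {l..r}" for x
        unfolding v_def vx_def c_def[symmetric] by (intro DERIV_diff der that DERIV_cmult DE)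
      have eq: "d * vx x = d * yx x - a * (c * E x)" "a * v x s = a * y x - a * (c * E x)" for x
        using d by (simp_all add: vx_def v_def c_def algebra_simps)
      have 2: "\<exists>vxx vt. (vx has_real_derivative vxx) (at x) \<and> ((\<lambda>s. v x s) has_real_derivative vt) (at s) \<and>
           vt \<le> d * vxx - a * vx x + - K * v x s" if x: "x \<in> {l<..<r} - S" and v: "v x s > 0" for x
      proof -
        obtain y2 where y2: "(yx has_real_derivative y2) (at x)" "K * y x \<le> d * y2 - a * yx x"
          using int[OF x vp[OF v]] by blast
        have 3: "(vx has_real_derivative y2 - c * (a / d * (a / d * E x))) (at x)"
          unfolding vx_def by (intro DERIV_diff y2 DERIV_cmult DE)
        have 4: "((\<lambda>s. v x s) has_real_derivative K * c * E x) (at s)"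
          unfolding v_def c_def by (auto intro!: derivative_eq_intros)
        have "d * (y2 - c * (a / d * (a / d * E x))) - a * vx x = d * y2 - a * yx x"
          using d by (simp add: vx_def algebra_simps)
        moreover have "- K * v x s = - K * y x + K * c * E x" by (simp add: v_def c_def algebra_simps)
        ultimately have "K * c * E x \<le> d * (y2 - c * (a / d * (a / d * E x))) - a * vx x + - K * v x s"
          using y2(2) by linarith
        thus ?thesis using 3 4 by blast
      qed
      show "\<exists>vx. (\<forall>x\<in>{l..r}. ((\<lambda>y. v y s) has_real_derivative vx x) (at x within {l..r})) \<and>
        (v l s > 0 \<longrightarrow> a * v l s \<le> d * vx l) \<and> (v r s > 0 \<longrightarrow> d * vx r \<le> a * v r s) \<and>
        (\<forall>x\<in>{l<..<r} - S. v x s > 0 \<longrightarrow> (\<exists>vxx vt. (vx has_real_derivative vxx) (at x) \<and>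
           ((\<lambda>s. v x s) has_real_derivative vt) (at s) \<and> vt \<le> d * vxx - a * vx x + - K * v x s))"
        by (intro exI[of _ vx] conjI ballI impI 1 2) (use eq vp left right in auto)
    qed (use x t in auto)
    thus ?thesis by (simp add: v_def)
  qed
  show ?thesis
  proof (rule ccontr)
    assume "\<not> y x \<le> 0"
    hence y: "y x > 0" by simp
    have CE: "C * E x > 0" using C E by simp
    define t where "t = max 0 (ln (2 * C * E x / y x) / K)"
    have "ln (2 * C * E x / y x) / K \<le> t" by (simp add: t_def)
    hence "ln (2 * C * E x / y x) \<le> K * t" using K by (simp add: field_simps)
    hence "exp (ln (2 * C * E x / y x)) \<le> exp (K * t)" by simp
    hence "2 * C * E x \<le> y x * exp (K * t)" using y CE by (simp add: field_simps)
    moreover have "y x * exp (K * t) \<le> C * E x"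
    proof -
      have "y x \<le> C * exp (- K * t) * E x" by (rule main) (simp add: t_def)
      hence "y x * exp (K * t) \<le> C * exp (- K * t) * E x * exp (K * t)" by simp
      also have "\<dots> = C * E x * (exp (- K * t) * exp (K * t))" by simp
      also have "\<dots> = C * E x" by (simp flip: exp_add)
      finally show ?thesis .
    qed
    ultimately show False using CE by linarith
  qed
qed

lemma positive_min_on_interval:
  fixes f :: "real \<Rightarrow> real"
  assumes "continuous_on {l..r} f" "\<And>x. x \<in> {l..r} \<Longrightarrow> f x > 0"
  obtains e where "0 < e" "\<And>x. x \<in> {l..r} \<Longrightarrow> e \<le> f x"
proof (cases "l \<le> r")
  case True
  with continuous_attains_inf[of "{l..r}" f] assms that show ?thesis by (metis atLeastatMost_empty_iff compact_Icc)
qed (use that[of 1] in auto)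

locale model =
  fixes d1 d2 r m p q h L a1 a2 x2 :: real and wb :: "real \<Rightarrow> real"
  assumes ppos: "d1 > 0" "d2 > 0" "r > 0" "m > 0" "p > 0" "q > 0" "h > 0" "L > 0"
    "a1 > 0" "a2 \<ge> 0" "0 < x2" "x2 \<le> L"
    and wbar: "is_wbar d2 a2 h q x2 wb"
begin

lemma wb_pos: "x \<in> {0..x2} \<Longrightarrow> wb x > 0"
  using wbar by (auto simp: is_wbar_def)

lemma wb_bvp: obtains wb' where "bvp d2 a2 (a2 / d2) x2 {} wb wb' (\<lambda>x. h - q * wb x)"
proof -
  from wbar obtain w' where w: "\<forall>x\<in>{0..x2}. (wb has_real_derivative w' x) (at x within {0..x2})"
    "\<forall>x\<in>{0<..<x2}. \<exists>w''. (w' has_real_derivative w'') (at x) \<and> d2 * w'' - a2 * w' x + h - q * wb x = 0"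
    "d2 * w' 0 - a2 * wb 0 = 0" "d2 * w' x2 - a2 * wb x2 = 0" by (auto simp: is_wbar_def)
  have "bvp d2 a2 (a2 / d2) x2 {} wb w' (\<lambda>x. h - q * wb x)" unfolding bvp_def
    using w ppos by (fastforce simp: field_simps)
  thus ?thesis by (rule that)
qed

lemma wb_cont: "continuous_on {0..x2} wb"
  using wb_bvp bvp_cont by metis

lemma bint_chi:
  assumes "continuous_on {0..x2} w"
  shows "bint L (\<lambda>x. chi x2 x * w x)"
proof -
  have "(\<lambda>x. chi x2 x) integrable_on {0..L}"
  proof (rule Henstock_Kurzweil_Integration.integrable_combine[of 0 x2])
    show "(\<lambda>x. chi x2 x) integrable_on {0..x2}"
      by (rule integrable_spike_finite[of "{x2}" _ _ "\<lambda>_. 1"]) (auto simp: chi_def)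
    show "(\<lambda>x. chi x2 x) integrable_on {x2..L}"
      by (rule integrable_eq[of "\<lambda>_. 0"]) (auto simp: chi_def)
  qed (use ppos in auto)
  moreover have "\<bar>chi x2 x\<bar> \<le> 1" for x by (simp add: chi_def)
  ultimately have 1: "bint L (chi x2)" unfolding bint_def by blast
  have "continuous_on {0..L} (\<lambda>x. w (min x x2))"
    by (rule continuous_on_compose2[OF assms]) (use ppos in \<open>auto intro!: continuous_intros\<close>)
  from bint_mult[OF 1 bint_cont[OF this]] show ?thesis
    by (rule bint_cong) (auto simp: chi_def)
qed

lemma isCont_chi:
  assumes "continuous_on {0..x2} w" and x: "x \<in> {0<..<L} - {x2}"
  shows "isCont (\<lambda>x. chi x2 x * w x) x"
proof (cases "x < x2")
  case True
  have "isCont w x" using continuous_on_interior[OF assms(1), of x] True x by auto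
  moreover have "eventually (\<lambda>y. y \<in> {0<..<x2}) (nhds x)"
    by (rule eventually_nhds_in_open) (use True x in auto)
  hence "eventually (\<lambda>y. chi x2 y * w y = w y) (nhds x)"
    by eventually_elim (auto simp: chi_def)
  ultimately show ?thesis using isCont_cong by metis
next
  case False
  have "eventually (\<lambda>y. y \<in> {x2<..}) (nhds x)"
    by (rule eventually_nhds_in_open) (use False x in auto)
  hence "eventually (\<lambda>y. chi x2 y * w y = 0) (nhds x)"
    by eventually_elim (auto simp: chi_def)
  thus ?thesis using isCont_cong[of "\<lambda>y. chi x2 y * w y" "\<lambda>_. 0"] by simp
qed

lemma isCont_on: "continuous_on {0..L} u \<Longrightarrow> x \<in> {0<..<L} - {x2} \<Longrightarrow> isCont u x" for u :: "real \<Rightarrow> real"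
  using continuous_on_interior[of "{0..L}" u x] by auto

definition "sp m' x = r - m' * chi x2 x * wb x"

lemma sp_bint: "bint L (sp m')"
proof -
  have "bint L (\<lambda>x. r - m' * (chi x2 x * wb x))"
    by (intro bint_diff bint_mult bint_chi wb_cont bint_cont continuous_intros)
  thus ?thesis by (rule bint_cong) (simp add: sp_def)
qed

lemma sp_isCont: "x \<in> {0<..<L} - {x2} \<Longrightarrow> isCont (sp m') x"
proof -
  assume "x \<in> {0<..<L} - {x2}"
  hence "isCont (\<lambda>x. r - m' * (chi x2 x * wb x)) x"
    by (intro continuous_intros isCont_chi wb_cont)
  thus ?thesis by (simp add: sp_def[abs_def] mult.assoc)
qed

lemma strict_subsolution:
  assumes K: "0 < K" "\<And>x. x \<in> {0..L} \<Longrightarrow> 1 \<le> K + sp m' x"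
    and f0: "continuous_on {0..L} f0" "\<And>x. x \<in> {0..L} \<Longrightarrow> 0 \<le> f0 x"
    and T: "\<And>x. x \<in> {0..L} \<Longrightarrow> f0 x \<le> green_op.green d1 a1 0 K L (\<lambda>x. (K + sp m' x) * f0 x) x"
    and y: "y \<in> {0..L}" "f0 y \<noteq> green_op.green d1 a1 0 K L (\<lambda>x. (K + sp m' x) * f0 x) y"
  shows "\<exists>\<phi> \<phi>x g \<delta>. \<delta> > 0 \<and> (\<forall>x\<in>{0..L}. \<phi> x > 0) \<and> bvp d1 a1 0 L {x2} \<phi> \<phi>x g \<and>
    (\<forall>x\<in>{0<..<L} - {x2}. g x \<le> (sp m' x - \<delta>) * \<phi> x)"
proof -
  interpret G: green_op d1 a1 0 K L using K ppos by unfold_locales auto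
  define T where "T = (\<lambda>f. G.green (\<lambda>x. (K + sp m' x) * f x))"
  have Tb: "bint L (\<lambda>x. (K + sp m' x) * f x)" if "continuous_on {0..L} f" for f
    by (intro bint_mult bint_add sp_bint bint_cont that continuous_intros)
  have Tc: "continuous_on {0..L} (T f)" if "continuous_on {0..L} f" for f
    unfolding T_def by (rule G.green_cont(1)[OF Tb[OF that]])
  define f1 where "f1 = T f0"
  define f2 where "f2 = T f1"
  have c1: "continuous_on {0..L} f1" and c2: "continuous_on {0..L} f2"
    using Tc f0(1) by (auto simp: f1_def f2_def)
  have f01: "f0 x \<le> f1 x" if "x \<in> {0..L}" for x using T[OF that] by (simp add: f1_def T_def)
  have f12: "f1 x < f2 x" if x: "x \<in> {0..L}" for x
  proof -
    have "G.green (\<lambda>x. (K + sp m' x) * f1 x - (K + sp m' x) * f0 x) x > 0"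
    proof (rule G.green_pos[where g="\<lambda>x. f1 x - f0 x", OF _ _ _ y(1) _ x])
      show "bint L (\<lambda>x. (K + sp m' x) * f1 x - (K + sp m' x) * f0 x)"
        by (intro bint_diff Tb c1 f0)
      show "continuous_on {0..L} (\<lambda>x. f1 x - f0 x)" by (intro continuous_intros c1 f0)
      show "0 < f1 y - f0 y" using f01[OF y(1)] y(2) by (auto simp: f1_def T_def)
      fix x assume x: "x \<in> {0..L}"
      have "1 * (f1 x - f0 x) \<le> (K + sp m' x) * (f1 x - f0 x)"
        using K(2)[OF x] f01[OF x] by (intro mult_right_mono) auto
      thus "0 \<le> f1 x - f0 x \<and> f1 x - f0 x \<le> (K + sp m' x) * f1 x - (K + sp m' x) * f0 x"
        using f01[OF x] by (simp add: right_diff_distrib)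
    qed
    thus ?thesis using G.green_diff[OF Tb[OF c1] Tb[OF f0(1)] x] by (simp add: f2_def f1_def T_def)
  qed
  have f2p: "f2 x > 0" if "x \<in> {0..L}" for x using f12[OF that] f01[OF that] f0(2)[OF that] by simp
  have p21: "f2 x - f1 x > 0" if "x \<in> {0..L}" for x using f12[OF that] by simp
  obtain e where e: "0 < e" "\<And>x. x \<in> {0..L} \<Longrightarrow> e \<le> f2 x - f1 x"
    using positive_min_on_interval[OF continuous_on_diff[OF c2 c1] p21] by blast
  obtain M where M: "0 < M" "\<And>x. x \<in> {0..L} \<Longrightarrow> \<bar>f2 x\<bar> \<le> M"
    using bounded_above_on_interval[OF c2] by blast
  have ic: "isCont (\<lambda>x. (K + sp m' x) * f1 x) x" if "x \<in> {0<..<L} - {x2}" for x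
    using sp_isCont[OF that, of m'] isCont_on[OF c1 that] by (intro continuous_intros)
  have b: "bvp d1 a1 0 L {x2} f2 (G.green' (\<lambda>x. (K + sp m' x) * f1 x)) (\<lambda>x. (K + sp m' x) * f1 x - K * f2 x)"
    unfolding f2_def T_def
    by (rule G.green_bvp[OF Tb[OF c1] _ ic]) simp_all
  have g: "(K + sp m' x) * f1 x - K * f2 x \<le> (sp m' x - e / M) * f2 x" if x: "x \<in> {0..L}" for x
  proof -
    have "e / M * f2 x \<le> e / M * M" using M(2)[OF x] M(1) e(1) by (intro mult_left_mono) auto
    also have "\<dots> = e" using M(1) by simp
    also have "\<dots> \<le> 1 * (f2 x - f1 x)" using e(2)[OF x] by simp
    also have "\<dots> \<le> (K + sp m' x) * (f2 x - f1 x)" using K(2)[OF x] f12[OF x] by (intro mult_right_mono) auto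
    finally show ?thesis by (simp add: algebra_simps)
  qed
  show ?thesis
    by (intro exI[of _ f2] exI[of _ "G.green' (\<lambda>x. (K + sp m' x) * f1 x)"]
        exI[of _ "\<lambda>x. (K + sp m' x) * f1 x - K * f2 x"] exI[of _ "e / M"] conjI)
       (use e(1) M(1) f2p b g in auto)
qed

lemma sp_lower_bound:
  assumes "0 \<le> m'"
  obtains K where "0 < K" "\<And>x. x \<in> {0..L} \<Longrightarrow> 1 \<le> K + sp m' x"
proof -
  obtain M where M: "0 < M" "\<And>x. x \<in> {0..x2} \<Longrightarrow> \<bar>wb x\<bar> \<le> M" using bounded_above_on_interval[OF wb_cont] by blast
  show ?thesis
  proof (rule that[of "1 + m' * M"])
    show "0 < 1 + m' * M" using assms M by (simp add: add_pos_nonneg)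
    fix x assume x: "x \<in> {0..L}"
    show "1 \<le> 1 + m' * M + sp m' x"
    proof (cases "x < x2")
      case True
      have "m' * wb x \<le> m' * M" using M(2)[of x] assms x True by (intro mult_left_mono) auto
      thus ?thesis using ppos x True by (simp add: sp_def chi_def)
    next
      case False
      thus ?thesis using ppos assms M by (simp add: sp_def chi_def)
    qed
  qed
qed

lemma subsolution_small_zone:
  assumes m': "0 \<le> m'" "m' < mbar"
    and pe: "principal_eigenvalue d1 a1 (\<lambda>x. r - mbar * chi x2 x * wb x) 0 L 0"
  shows "\<exists>\<phi> \<phi>x g \<delta>. \<delta> > 0 \<and> (\<forall>x\<in>{0..L}. \<phi> x > 0) \<and> bvp d1 a1 0 L {x2} \<phi> \<phi>x g \<and>
    (\<forall>x\<in>{0<..<L} - {x2}. g x \<le> (sp m' x - \<delta>) * \<phi> x)"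
proof -
  obtain K where K: "0 < K" "\<And>x. x \<in> {0..L} \<Longrightarrow> 1 \<le> K + sp m' x" using sp_lower_bound[OF m'(1)] by blast
  interpret G: green_op d1 a1 0 K L using K ppos by unfold_locales auto
  from pe obtain f f' F where f: "\<And>x. x\<in>{0..L} \<Longrightarrow> f x > 0"
    and fd: "\<forall>x\<in>{0..L}. (f has_real_derivative f' x) (at x within {0..L})"
    and F: "finite F"
    and fi: "\<And>x. x\<in>{0<..<L} - F \<Longrightarrow> \<exists>f2. (f' has_real_derivative f2) (at x) \<and>
            d1 * f2 - a1 * f' x + (r - mbar * chi x2 x * wb x) * f x = 0 * f x"
    and fb: "d1 * f' 0 - a1 * f 0 = 0" "f' L = 0" unfolding principal_eigenvalue_def by blast
  have b: "bvp d1 a1 0 L (insert x2 F) f f' (\<lambda>x. (K + sp mbar x) * f x - K * f x)"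
    unfolding bvp_def
  proof (intro conjI ballI)
    fix x assume "x \<in> {0<..<L} - insert x2 F"
    with fi[of x] show "\<exists>zxx. (f' has_real_derivative zxx) (at x) \<and>
        d1 * zxx - a1 * f' x + ((K + sp mbar x) * f x - K * f x) = 0"
      by (auto simp: sp_def algebra_simps)
  qed (use fd fb in auto)
  have fc: "continuous_on {0..L} f" using bvp_cont[OF b] .
  have Tb: "bint L (\<lambda>x. (K + sp m'' x) * f x)" for m''
    by (intro bint_mult bint_add sp_bint bint_cont fc continuous_intros)
  have eq: "f x = G.green (\<lambda>x. (K + sp mbar x) * f x) x" if "x \<in> {0..L}" for x
  proof (rule G.green_unique[OF b Tb _ _ that])
    show "finite (insert x2 F)" using F by simp
    show "isCont (\<lambda>x. (K + sp mbar x) * f x) x" if "x \<in> {0<..<L} - insert x2 F" for x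
      using sp_isCont[of x mbar] isCont_on[OF fc, of x] that by (intro continuous_intros) auto
  qed
  have wf: "continuous_on {0..x2} (\<lambda>x. (mbar - m') * wb x * f x)"
    by (intro continuous_intros wb_cont continuous_on_subset[OF fc]) (use ppos in auto)
  obtain e where e: "0 < e" "\<And>x. x \<in> {0..x2} \<Longrightarrow> e \<le> (mbar - m') * wb x * f x"
    by (rule positive_min_on_interval[OF wf]) (use wb_pos f m' ppos in auto)
  have strict: "f x < G.green (\<lambda>x. (K + sp m' x) * f x) x" if x: "x \<in> {0..L}" for x
  proof -
    have "G.green (\<lambda>x. (K + sp m' x) * f x - (K + sp mbar x) * f x) x > 0"
    proof (rule G.green_pos[where g="\<lambda>x. e * (max 0 (x2 - x) / x2)" and y=0])
      show "bint L (\<lambda>x. (K + sp m' x) * f x - (K + sp mbar x) * f x)" by (intro bint_diff Tb)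
      show "continuous_on {0..L} (\<lambda>x. e * (max 0 (x2 - x) / x2))"
        using ppos by (intro continuous_intros) auto
      fix x assume x: "x \<in> {0..L}"
      have eq: "(K + sp m' x) * f x - (K + sp mbar x) * f x = (mbar - m') * chi x2 x * wb x * f x"
        by (simp add: sp_def algebra_simps)
      have "e * (max 0 (x2 - x) / x2) \<le> (mbar - m') * chi x2 x * wb x * f x"
      proof (cases "x < x2")
        case True
        have "e * (max 0 (x2 - x) / x2) \<le> e * 1"
          using e x True ppos by (intro mult_left_mono) (auto simp: divide_simps)
        also have "\<dots> \<le> (mbar - m') * wb x * f x" using e(2)[of x] x True by simp
        finally show ?thesis using x True by (simp add: chi_def)
      qed (use ppos in \<open>auto simp: chi_def max_def\<close>)
      thus "0 \<le> e * (max 0 (x2 - x) / x2) \<and> e * (max 0 (x2 - x) / x2) \<le> (K + sp m' x) * f x - (K + sp mbar x) * f x"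
        unfolding eq using e ppos by auto
    qed (use x e ppos in auto)
    thus ?thesis using G.green_diff[OF Tb Tb x, of m' mbar] eq[OF x] by simp
  qed
  have "(0::real) \<in> {0..L}" using ppos by auto
  thus ?thesis
    using strict_subsolution[OF K fc _ _ _ ] strict f by (smt (verit) less_imp_le)
qed

lemma subsolution_large_zone:
  assumes m': "0 \<le> m'" and a1: "a1 < sqrt (4 * d1 * r)" and L: "L - x2 \<ge> Lstar d1 a1 r"
  shows "\<exists>\<phi> \<phi>x g \<delta>. \<delta> > 0 \<and> (\<forall>x\<in>{0..L}. \<phi> x > 0) \<and> bvp d1 a1 0 L {x2} \<phi> \<phi>x g \<and>
    (\<forall>x\<in>{0<..<L} - {x2}. g x \<le> (sp m' x - \<delta>) * \<phi> x)"
proof -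
  obtain K where K: "0 < K" "\<And>x. x \<in> {0..L} \<Longrightarrow> 1 \<le> K + sp m' x" using sp_lower_bound[OF m'] by blast
  interpret G: green_op d1 a1 0 K L using K ppos by unfold_locales auto
  define D where "D = sqrt (4 * d1 * r - a1\<^sup>2)"
  have "a1\<^sup>2 < (sqrt (4 * d1 * r))\<^sup>2" using a1 ppos by (intro power_strict_mono) auto
  hence D2: "4 * d1 * r - a1\<^sup>2 > 0" using ppos by simp
  hence D: "D > 0" "D\<^sup>2 = 4 * d1 * r - a1\<^sup>2" by (auto simp: D_def)
  define be where "be = D / (2 * d1)"
  have be: "be > 0" using D ppos by (simp add: be_def)
  define al where "al = a1 / d1"
  have al: "al > 0" "d1 * al = a1" using ppos by (auto simp: al_def)
  define th where "th = arctan (D / a1)"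
  have th: "0 < th" "th < pi / 2" using D ppos arctan_ubound by (auto simp: th_def)
  have Ls: "be * Lstar d1 a1 r = pi - th"
    using D ppos by (simp add: Lstar_def be_def th_def D_def)
  define l where "l = L - Lstar d1 a1 r"
  have Lpos: "Lstar d1 a1 r > 0" using Ls th be pi_half_less_two zero_less_mult_pos[of be "Lstar d1 a1 r"] by linarith
  have l: "x2 \<le> l" "l < L" "0 < l" using L Lpos ppos by (auto simp: l_def)
  define psi where "psi = (\<lambda>x. exp (al / 2 * x) * sin (be * (x - l)))"
  define psi' where "psi' = (\<lambda>x. exp (al / 2 * x) * (al / 2 * sin (be * (x - l)) + be * cos (be * (x - l))))"
  define psi2 where "psi2 = (\<lambda>x. exp (al / 2 * x) * ((al\<^sup>2 / 4 - be\<^sup>2) * sin (be * (x - l)) + al * be * cos (be * (x - l))))"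
  have Dpsi: "(psi has_real_derivative psi' x) (at x within X)" for x X
    unfolding psi_def psi'_def by (auto intro!: derivative_eq_intros simp: algebra_simps)
  have Dpsi': "(psi' has_real_derivative psi2 x) (at x within X)" for x X
    unfolding psi2_def psi'_def by (auto intro!: derivative_eq_intros simp: field_simps power2_eq_square)
  have "d1 * (al\<^sup>2 / 4 - be\<^sup>2) - a1 * (al / 2) + r = 0"
  proof -
    have "4 * d1 * (d1 * (al\<^sup>2 / 4 - be\<^sup>2) - a1 * (al / 2) + r) = (d1 * al)\<^sup>2 - (2 * d1 * be)\<^sup>2 - 2 * a1 * (d1 * al) + 4 * d1 * r"
      by (simp add: algebra_simps power2_eq_square)
    also have "2 * d1 * be = D" using ppos by (simp add: be_def)
    finally have "4 * d1 * (d1 * (al\<^sup>2 / 4 - be\<^sup>2) - a1 * (al / 2) + r) = 0"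
      unfolding al(2) D(2) by (simp add: algebra_simps power2_eq_square)
    thus ?thesis using ppos by simp
  qed
  moreover have "d1 * psi2 x - a1 * psi' x + r * psi x =
      exp (al / 2 * x) * ((d1 * (al\<^sup>2 / 4 - be\<^sup>2) - a1 * (al / 2) + r) * sin (be * (x - l)) + (d1 * al - a1) * (be * cos (be * (x - l))))" for x
    unfolding psi_def psi'_def psi2_def by (simp add: algebra_simps)
  ultimately have ode: "d1 * psi2 x - a1 * psi' x + r * psi x = 0" for x using al by simp
  have psiL: "psi' L = 0"
  proof -
    have bl: "be * (L - l) = pi - th" using Ls by (simp add: l_def)
    have "sin th = cos th * (D / a1)"
      using tan_arctan[of "D / a1"] cos_gt_zero_pi[of th] th by (simp add: th_def tan_def field_simps)
    moreover have "al / 2 * (D / a1) = be" using ppos by (simp add: al_def be_def)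
    ultimately have "al / 2 * sin th - be * cos th = 0" by (metis diff_self mult.assoc mult.commute)
    thus ?thesis unfolding psi'_def bl by simp
  qed
  have psi_nn: "psi x \<ge> 0" if "x \<in> {l..L}" for x
  proof -
    have "be * (x - l) \<le> be * Lstar d1 a1 r" using that be by (intro mult_left_mono) (auto simp: l_def)
    hence "0 \<le> be * (x - l)" "be * (x - l) \<le> pi" using that be th Ls by auto
    thus ?thesis by (simp add: psi_def sin_ge_zero)
  qed
  define f0 where "f0 = (\<lambda>x. if x \<le> l then 0 else psi x)"
  have "psi l = 0" by (simp add: psi_def)
  have cpsi: "continuous_on X psi" for X unfolding psi_def by (intro continuous_intros)
  have f0c: "continuous_on {0..L} f0"
  proof -
    have "{0..L} = {0..l} \<union> {l..L}" using l by auto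
    moreover have "continuous_on ({0..l} \<union> {l..L}) (\<lambda>x. if x \<le> l then 0 else psi x)"
      by (rule continuous_on_If) (use \<open>psi l = 0\<close> cpsi in auto)
    ultimately show ?thesis by (simp add: f0_def[abs_def])
  qed
  have f0n: "0 \<le> f0 x" if "x \<in> {0..L}" for x using psi_nn that by (auto simp: f0_def)
  define F where "F = (\<lambda>x. (K + sp m' x) * f0 x)"
  have Fb: "bint L F" unfolding F_def by (intro bint_mult bint_add sp_bint bint_cont f0c continuous_intros)
  have Fge: "f0 x \<le> F x" if "x \<in> {0..L}" for x
    using mult_right_mono[OF K(2)[OF that] f0n[OF that]] by (simp add: F_def)
  have ic: "isCont F x" if "x \<in> {0<..<L} - {x2}" for x
    unfolding F_def using sp_isCont[OF that, of m'] isCont_on[OF f0c that] by (intro continuous_intros)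
  have Gb: "bvp d1 a1 0 L {x2} (G.green F) (G.green' F) (\<lambda>x. F x - K * G.green F x)"
    by (rule G.green_bvp[OF Fb _ ic]) simp_all
  have Gpos: "G.green F x > 0" if "x \<in> {0..L}" for x
  proof (rule G.green_pos[OF Fb f0c _ _ _ that])
    define y where "y = l + pi / 4 / be"
    have be_y: "be * (y - l) = pi / 4" using be by (simp add: y_def)
    have "be * (y - l) \<le> be * Lstar d1 a1 r" using Ls be_y th by linarith
    hence "y - l \<le> Lstar d1 a1 r" using be by simp
    hence y: "y \<le> L" "l < y" using be by (auto simp: l_def y_def)
    show "y \<in> {0..L}" using y l by auto
    have "sin (be * (y - l)) > 0" unfolding be_y by (intro sin_gt_zero) auto
    thus "f0 y > 0" using y by (simp add: f0_def psi_def)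
  qed (use f0n Fge in auto)
  have le: "psi x - G.green F x \<le> 0" if x: "x \<in> {l..L}" for x
  proof (rule elliptic_max_principle[OF l(2) ppos(1) less_imp_le[OF ppos(9)] _ K(1) _ _ _ _ x, of "{x2}" "\<lambda>x. psi x - G.green F x" "\<lambda>x. psi' x - G.green' F x"])
    fix x assume "x \<in> {l..L}"
    moreover have "{l..L} \<subseteq> {0..L}" using l by auto
    ultimately show "((\<lambda>x. psi x - G.green F x) has_real_derivative psi' x - G.green' F x) (at x within {l..L})"
      using Gb unfolding bvp_def by (intro DERIV_diff Dpsi) (meson DERIV_subset subsetD)
  next
    assume "0 < psi l - G.green F l"
    hence False using Gpos[of l] l \<open>psi l = 0\<close> by simp
    thus "a1 * (psi l - G.green F l) \<le> d1 * (psi' l - G.green' F l)" ..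
  next
    assume "0 < psi L - G.green F L"
    moreover have "G.green' F L = 0" using Gb by (simp add: bvp_def)
    ultimately show "d1 * (psi' L - G.green' F L) \<le> a1 * (psi L - G.green F L)" using psiL ppos by simp
  next
    fix x assume x: "x \<in> {l<..<L} - {x2}"
    hence "x \<in> {0<..<L} - {x2}" using l by auto
    then obtain g2 where g2: "(G.green' F has_real_derivative g2) (at x)"
      "d1 * g2 - a1 * G.green' F x + (F x - K * G.green F x) = 0" using Gb unfolding bvp_def by blast
    have Fx: "F x = (K + r) * psi x" using x l by (simp add: F_def sp_def f0_def chi_def)
    show "\<exists>yxx. ((\<lambda>x. psi' x - G.green' F x) has_real_derivative yxx) (at x) \<and>
        K * (psi x - G.green F x) \<le> d1 * yxx - a1 * (psi' x - G.green' F x)"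
    proof (intro exI conjI)
      show "((\<lambda>x. psi' x - G.green' F x) has_real_derivative psi2 x - g2) (at x)" by (intro DERIV_diff Dpsi' g2)
      have "d1 * (psi2 x - g2) - a1 * (psi' x - G.green' F x) = (d1 * psi2 x - a1 * psi' x) - (d1 * g2 - a1 * G.green' F x)"
        by (simp add: algebra_simps)
      also have "\<dots> = - r * psi x + (F x - K * G.green F x)" using ode[of x] g2(2) by linarith
      also have "\<dots> = K * (psi x - G.green F x)" unfolding Fx by (simp add: algebra_simps)
      finally show "K * (psi x - G.green F x) \<le> d1 * (psi2 x - g2) - a1 * (psi' x - G.green' F x)" by simp
    qed
  qed auto
  have T: "f0 x \<le> G.green F x" if "x \<in> {0..L}" for x
    using le[of x] Gpos[OF that] that by (auto simp: f0_def)
  have "f0 0 \<noteq> G.green F 0" using Gpos[of 0] l ppos by (simp add: f0_def)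
  thus ?thesis using strict_subsolution[OF K f0c f0n T[unfolded F_def], of 0] ppos by (simp add: F_def)
qed

end

section \<open>Ordered coexistence states coincide\<close>

lemma (in green_op) bvp_deriv_cont:
  assumes z: "bvp d a b R S z zx (\<lambda>x. f x - K * z x)"
    and f: "bint R f" and S: "finite S" and fc: "\<And>x. x \<in> {0<..<R} - S \<Longrightarrow> isCont f x"
  shows "continuous_on {0..R} zx"
proof -
  have eq: "green' f x = zx x" if x: "x \<in> {0..R}" for x
  proof -
    have "(green f has_real_derivative green' f x) (at x within {0..R})"
      using green_bvp[OF f S fc] x by (simp add: bvp_def)
    hence 1: "(z has_real_derivative green' f x) (at x within {0..R})"
      by (rule has_field_derivative_transform_within[where d=1]) (use x green_unique[OF z f S fc] in auto)
    have 2: "(z has_real_derivative zx x) (at x within {0..R})" using z x by (simp add: bvp_def)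
    show ?thesis
      using vector_derivative_unique_within_closed_interval[of 0 R x z "green' f x" "zx x"] 1 2 x pos
      by (simp add: has_real_derivative_iff_has_vector_derivative)
  qed
  show ?thesis by (rule continuous_on_eq[OF green_cont(2)[OF f] eq])
qed

definition ratio_flux :: "real \<Rightarrow> real \<Rightarrow> (real \<Rightarrow> real) \<Rightarrow> (real \<Rightarrow> real) \<Rightarrow> (real \<Rightarrow> real) \<Rightarrow> (real \<Rightarrow> real) \<Rightarrow> real \<Rightarrow> real" where
  "ratio_flux d a y yx z zx x =
    d * exp (- a / d * x) * (yx x * z x - y x * zx x) * (y x / z x + z x / y x - 2)"

lemma ratio_flux_deriv:
  assumes d: "0 < d" and yz: "0 < z x" "z x \<le> y x"
    and der: "(y has_real_derivative yx x) (at x)" "(z has_real_derivative zx x) (at x)"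
      "(yx has_real_derivative yxx) (at x)" "(zx has_real_derivative zxx) (at x)"
    and eq: "d * yxx - a * yx x + f = 0" "d * zxx - a * zx x + g = 0"
  shows "\<exists>D. (ratio_flux d a y yx z zx has_real_derivative D) (at x) \<and>
    exp (- a / d * x) * ((y x - z x)\<^sup>2 / (y x * z x)) * (g * y x - f * z x) \<le> D"
proof -
  define E where "E = exp (- a / d * x)"
  define N where "N = yx x * z x - y x * zx x"
  define G where "G = y x / z x + z x / y x - 2"
  have yp: "y x > 0" using yz by simp
  have DE: "((\<lambda>x. exp (- a / d * x)) has_real_derivative - a / d * E) (at x)"
    unfolding E_def using d by (auto intro!: derivative_eq_intros)
  have DN: "((\<lambda>x. yx x * z x - y x * zx x) has_real_derivative yxx * z x - y x * zxx) (at x)"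
    by (auto intro!: derivative_eq_intros der)
  have DG: "((\<lambda>x. y x / z x + z x / y x - 2) has_real_derivative N / (z x)\<^sup>2 - N / (y x)\<^sup>2) (at x)"
  proof (rule DERIV_cong)
    show "((\<lambda>x. y x / z x + z x / y x - 2) has_real_derivative
        (yx x * z x - y x * zx x) / (z x * z x) + (zx x * y x - z x * yx x) / (y x * y x) - 0) (at x)"
      by (intro DERIV_diff DERIV_add DERIV_divide DERIV_const der) (use yz yp in auto)
    have 1: "zx x * y x - z x * yx x = - N" by (simp add: N_def)
    show "(yx x * z x - y x * zx x) / (z x * z x) + (zx x * y x - z x * yx x) / (y x * y x) - 0 =
        N / (z x)\<^sup>2 - N / (y x)\<^sup>2" unfolding 1 N_def[symmetric] by (simp add: power2_eq_square)
  qed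
  have DD: "(ratio_flux d a y yx z zx has_real_derivative
      d * E * N * (N / (z x)\<^sup>2 - N / (y x)\<^sup>2) + (d * E * (yxx * z x - y x * zxx) + d * (- a / d * E) * N) * G) (at x)"
    unfolding ratio_flux_def[abs_def] E_def N_def G_def
    by (rule DERIV_mult'[OF DERIV_mult'[OF DERIV_cmult[OF DE[unfolded E_def]] DN] DG[unfolded N_def]])
  have e1: "d * E * (yxx * z x - y x * zxx) + d * (- a / d * E) * N = E * (g * y x - f * z x)"
  proof -
    have "d * E * (yxx * z x - y x * zxx) + d * (- a / d * E) * N
      = E * ((d * yxx - a * yx x) * z x - y x * (d * zxx - a * zx x))"
      using d by (simp add: N_def algebra_simps)
    also have "d * yxx - a * yx x = - f" using eq(1) by simp
    also have "d * zxx - a * zx x = - g" using eq(2) by simp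
    finally show ?thesis by (simp add: algebra_simps)
  qed
  have e2: "d * E * N * (N / (z x)\<^sup>2 - N / (y x)\<^sup>2) \<ge> 0"
  proof -
    have eqN: "d * E * N * (N / (z x)\<^sup>2 - N / (y x)\<^sup>2) = d * E * N\<^sup>2 * (1 / (z x)\<^sup>2 - 1 / (y x)\<^sup>2)"
      by (simp add: algebra_simps power2_eq_square)
    have "1 / (y x)\<^sup>2 \<le> 1 / (z x)\<^sup>2" using yz yp by (intro divide_left_mono power_mono) auto
    thus ?thesis unfolding eqN using d by (intro mult_nonneg_nonneg) (auto simp: E_def)
  qed
  have eG: "G = (y x - z x)\<^sup>2 / (y x * z x)"
    using yz yp by (simp add: G_def field_simps power2_eq_square)
  have "E * G * (g * y x - f * z x) \<le> d * E * N * (N / (z x)\<^sup>2 - N / (y x)\<^sup>2) + E * (g * y x - f * z x) * G"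
    using e2 by (simp add: mult.commute mult.left_commute)
  thus ?thesis using DD unfolding e1 eG[symmetric] E_def[symmetric] by blast
qed

lemma cubic_form_nonneg:
  fixes f e k s c :: real
  assumes "0 \<le> f" "0 \<le> e" "0 < s" "s \<le> k" "k \<le> 1" "c \<le> s"
  shows "0 \<le> f^3 - c * f\<^sup>2 * e - k * (f * e\<^sup>2 - e^3)"
proof -
  have sq: "0 \<le> f^3 - f\<^sup>2 * e - (f * e\<^sup>2 - e^3)"
  proof -
    have "f^3 - f\<^sup>2 * e - (f * e\<^sup>2 - e^3) = (f + e) * (f - e)\<^sup>2"
      by (simp add: power2_eq_square power3_eq_cube algebra_simps)
    thus ?thesis using assms by simp
  qed
  show ?thesis
  proof (cases "e \<le> f")
    case True
    hence "f * e\<^sup>2 - e^3 \<ge> 0" using mult_right_mono[of e f "e\<^sup>2"] by (simp add: power2_eq_square power3_eq_cube)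
    hence "k * (f * e\<^sup>2 - e^3) \<le> 1 * (f * e\<^sup>2 - e^3)" using assms by (intro mult_right_mono) auto
    moreover have "c * (f\<^sup>2 * e) \<le> 1 * (f\<^sup>2 * e)" using assms by (intro mult_right_mono) auto
    ultimately show ?thesis using sq by simp
  next
    case False
    hence "f * e\<^sup>2 - e^3 \<le> 0" using mult_right_mono[of f e "e\<^sup>2"] by (simp add: power2_eq_square power3_eq_cube)
    hence "k * (f * e\<^sup>2 - e^3) \<le> s * (f * e\<^sup>2 - e^3)" using assms by (intro mult_right_mono_neg) auto
    moreover have "c * (f\<^sup>2 * e) \<le> s * (f\<^sup>2 * e)" using assms by (intro mult_right_mono) auto
    moreover have "s * f^3 \<le> 1 * f^3" using assms by (intro mult_right_mono) auto
    moreover have "0 \<le> s * (f^3 - f\<^sup>2 * e - (f * e\<^sup>2 - e^3))" using sq assms by simp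
    ultimately show ?thesis by (simp add: algebra_simps)
  qed
qed

lemma nondecreasing_no_gain:
  fixes \<Phi> :: "real \<Rightarrow> real"
  assumes "\<And>x. l < x \<Longrightarrow> x < u \<Longrightarrow> \<exists>D. (\<Phi> has_real_derivative D) (at x) \<and> J x \<le> D \<and> 0 \<le> J x"
    and "continuous_on {l..u} \<Phi>" and "\<Phi> u \<le> \<Phi> l" and x: "l < x" "x < u"
  shows "J x = 0"
proof -
  have mono: "\<Phi> s \<le> \<Phi> t" if "l \<le> s" "s \<le> t" "t \<le> u" for s t
  proof (rule DERIV_nonneg_imp_increasing_open[OF that(2)])
    fix y assume "s < y" "y < t"
    hence "l < y" "y < u" using that by auto
    from assms(1)[OF this] show "\<exists>D. (\<Phi> has_real_derivative D) (at y) \<and> 0 \<le> D" by (meson order_trans)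
  next
    show "continuous_on {s..t} \<Phi>" by (rule continuous_on_subset[OF assms(2)]) (use that in auto)
  qed
  have const: "\<Phi> y = \<Phi> l" if "y \<in> {l..u}" for y using mono[of l y] mono[of y u] that assms(3) by simp
  obtain D where D: "(\<Phi> has_real_derivative D) (at x)" "J x \<le> D" "0 \<le> J x" using assms(1)[OF x] by blast
  have "((\<lambda>_. \<Phi> l) has_real_derivative D) (at x)"
  proof (rule has_field_derivative_transform_within_open[OF D(1), of "{l<..<u}"])
    fix y assume "y \<in> {l<..<u}"
    hence "y \<in> {l..u}" by simp
    thus "\<Phi> y = \<Phi> l" by (rule const)
  qed (use x in auto)
  hence "D = 0" by (rule DERIV_unique) simp
  thus ?thesis using D by simp
qed

context model
begin

definition steady :: "(real \<Rightarrow> real) \<Rightarrow> (real \<Rightarrow> real) \<Rightarrow> (real \<Rightarrow> real) \<Rightarrow> (real \<Rightarrow> real) \<Rightarrow> bool" where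
  "steady U Ux W Wx \<longleftrightarrow> (\<forall>x\<in>{0..L}. U x > 0) \<and> (\<forall>x\<in>{0..x2}. W x > 0) \<and>
     bvp d1 a1 0 L {x2} U Ux (\<lambda>x. U x * (r - U x - m * chi x2 x * W x)) \<and>
     bvp d2 a2 (a2 / d2) x2 {} W Wx (\<lambda>x. h - q * W x - p * U x * W x) \<and>
     continuous_on {0..L} Ux \<and> continuous_on {0..x2} Wx"

lemma w_conds: "0 < x2" "0 < d2" "0 \<le> a2" "d2 * (a2 / d2) \<le> a2" "finite ({}::real set)"
  using ppos by auto

lemma u_conds: "0 < L" "0 < d1" "0 \<le> a1" "d1 * 0 \<le> a1" "finite {x2}"
  using ppos by auto

lemma wb_max: assumes x: "x \<in> {0..x2}" shows "wb x \<le> wb x2"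
proof -
  obtain wb' where b: "bvp d2 a2 (a2 / d2) x2 {} wb wb' (\<lambda>x. h - q * wb x)" by (rule wb_bvp)
  interpret G: green_op d2 a2 "a2 / d2" 1 x2 using ppos by unfold_locales auto
  have c': "continuous_on {0..x2} wb'"
  proof (rule G.bvp_deriv_cont)
    show "bvp d2 a2 (a2 / d2) x2 {} wb wb' (\<lambda>x. (h + (1 - q) * wb x) - 1 * wb x)"
      using b by (simp add: algebra_simps)
    have c: "continuous_on {0..x2} (\<lambda>x. h + (1 - q) * wb x)" by (intro continuous_intros wb_cont)
    thus "bint x2 (\<lambda>x. h + (1 - q) * wb x)" by (rule bint_cont)
    show "isCont (\<lambda>x. h + (1 - q) * wb x) x" if "x \<in> {0<..<x2} - {}" for x
      using continuous_on_interior[OF c, of x] that by auto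
  qed simp
  define M where "M = max (wb x2) (h / q)"
  have M: "wb x2 \<le> M" "h / q \<le> M" by (auto simp: M_def)
  have M: "wb x2 \<le> M" "h \<le> q * M" "0 \<le> M"
    using M ppos wb_pos[of x2] by (auto simp: field_simps)
  have le: "wb x - M \<le> 0" if "x \<in> {0..x2}" for x
  proof (rule elliptic_max_principle[of 0 x2 d2 a2 "{}" q "\<lambda>x. wb x - M" wb'])
    show "((\<lambda>x. wb x - M) has_real_derivative wb' x) (at x within {0..x2})" if "x \<in> {0..x2}" for x
      using b that by (auto simp: bvp_def intro!: derivative_eq_intros)
    show "a2 * (wb 0 - M) \<le> d2 * wb' 0" using b M ppos by (simp add: bvp_def algebra_simps)
    show "d2 * wb' x2 \<le> a2 * (wb x2 - M)" if "0 < wb x2 - M" using that M by simp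
    fix x assume "x \<in> {0<..<x2} - {}"
    then obtain w2 where w2: "(wb' has_real_derivative w2) (at x)" "d2 * w2 - a2 * wb' x + (h - q * wb x) = 0"
      using b unfolding bvp_def by blast
    have "q * (wb x - M) \<le> d2 * w2 - a2 * wb' x" using w2(2) M(2) by (simp add: algebra_simps)
    thus "\<exists>w2. (wb' has_real_derivative w2) (at x) \<and> q * (wb x - M) \<le> d2 * w2 - a2 * wb' x" using w2 by blast
  qed (use ppos that in auto)
  have "h / q \<le> wb x2"
  proof (rule ccontr)
    assume neg: "\<not> h / q \<le> wb x2"
    hence le': "wb x \<le> h / q" if "x \<in> {0..x2}" for x using le[OF that] by (simp add: M_def)
    define g where "g = (\<lambda>x. d2 * wb' x - a2 * wb x)"
    have gc: "continuous_on {0..x2} g" unfolding g_def by (intro continuous_intros c' wb_cont)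
    have Dg: "(g has_real_derivative q * wb x - h) (at x)" if x: "x \<in> {0<..<x2}" for x
    proof -
      obtain w2 where w2: "(wb' has_real_derivative w2) (at x)" "d2 * w2 - a2 * wb' x + (h - q * wb x) = 0"
        using b x unfolding bvp_def by blast
      have "(wb has_real_derivative wb' x) (at x within {0..x2})" using b x by (simp add: bvp_def)
      hence "(wb has_real_derivative wb' x) (at x)" using x at_within_interior[of x "{0..x2}"] by simp
      hence "(g has_real_derivative d2 * w2 - a2 * wb' x) (at x)"
        unfolding g_def by (intro DERIV_diff DERIV_cmult w2)
      thus ?thesis by (rule DERIV_cong) (use w2(2) in linarith)
    qed
    have Dn: "q * wb x - h \<le> 0" if "x \<in> {0..x2}" for x using le'[OF that] ppos by (simp add: field_simps)
    have mono: "g y \<le> g x" if "0 \<le> x" "x \<le> y" "y \<le> x2" for x y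
    proof (rule DERIV_nonpos_imp_decreasing_open[OF that(2)])
      show "\<exists>D. (g has_real_derivative D) (at s) \<and> D \<le> 0" if "x < s" "s < y" for s
        using Dg[of s] Dn[of s] that \<open>0 \<le> x\<close> \<open>y \<le> x2\<close> by auto
      show "continuous_on {x..y} g" by (rule continuous_on_subset[OF gc]) (use that in auto)
    qed
    have "g 0 = 0" "g x2 = 0" using b ppos by (simp_all add: g_def bvp_def)
    hence g0: "g x = 0" if "x \<in> {0..x2}" for x using mono[of 0 x] mono[of x x2] that by simp
    have "wb x = h / q" if x: "x \<in> {0<..<x2}" for x
    proof -
      have "((\<lambda>_. 0) has_real_derivative q * wb x - h) (at x)"
        by (rule has_field_derivative_transform_within_open[OF Dg[OF x], of "{0<..<x2}"]) (use x g0 in auto)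
      hence "q * wb x - h = 0" by (rule DERIV_unique) simp
      thus ?thesis using ppos by (simp add: field_simps)
    qed
    moreover have "closure {0<..<x2} = {0..x2}" using ppos by (simp add: closure_greaterThanLessThan)
    ultimately have "wb x2 = h / q"
      using continuous_constant_on_closure[of "{0<..<x2}" wb "h / q" x2] wb_cont ppos by auto
    thus False using neg by simp
  qed
  thus ?thesis using le[OF x] by (simp add: M_def)
qed

lemma w_le_wb:
  assumes "bvp d2 a2 (a2 / d2) x2 {} W Wx (\<lambda>x. h - q * W x - p * U x * W x)"
    and "\<And>x. x \<in> {0..x2} \<Longrightarrow> W x \<ge> 0" "\<And>x. x \<in> {0..x2} \<Longrightarrow> U x \<ge> 0" and x: "x \<in> {0..x2}"
  shows "W x \<le> wb x"
proof -
  obtain wb' where b: "bvp d2 a2 (a2 / d2) x2 {} wb wb' (\<lambda>x. h - q * wb x)" by (rule wb_bvp)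
  have "W x - wb x \<le> 0"
  proof (rule bvp_nonpos[OF bvp_diff[OF assms(1) b] w_conds ppos(6) _ x])
    fix x assume "x \<in> {0<..<x2} - {}"
    hence "p * U x * W x \<ge> 0" using assms(2,3) ppos by simp
    thus "h - q * W x - p * U x * W x - (h - q * wb x) \<le> - q * (W x - wb x)" by (simp add: algebra_simps)
  qed
  thus ?thesis by simp
qed

lemma ordered_steady_unique:
  assumes s1: "steady U1 U1x W1 W1x" and s2: "steady U2 U2x W2 W2x"
    and ord: "\<And>x. x \<in> {0..L} \<Longrightarrow> U2 x \<le> U1 x" "\<And>x. x \<in> {0..x2} \<Longrightarrow> W1 x \<le> W2 x"
    and m: "m \<le> exp (- \<bar>a1/d1 - a2/d2\<bar> * x2) / p" and h: "(wb x2)\<^sup>2 \<le> h"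
  shows "\<forall>x\<in>{0..L}. U1 x = U2 x" "\<forall>x\<in>{0..x2}. W1 x = W2 x"
proof -
  note b1 = s1[unfolded steady_def] and b2 = s2[unfolded steady_def]
  have Up: "U1 x > 0" "U2 x > 0" if "x \<in> {0..L}" for x using b1 b2 that by auto
  have Wp: "W1 x > 0" "W2 x > 0" if "x \<in> {0..x2}" for x using b1 b2 that by auto
  have sub: "x \<in> {0..L}" if "x \<in> {0..x2}" for x using that ppos by auto
  have cU: "continuous_on {0..L} U1" "continuous_on {0..L} U2" "continuous_on {0..L} U1x" "continuous_on {0..L} U2x"
    and cW: "continuous_on {0..x2} W1" "continuous_on {0..x2} W2" "continuous_on {0..x2} W1x" "continuous_on {0..x2} W2x"
    using b1 b2 bvp_cont by blast+
  define \<Phi> where "\<Phi> = ratio_flux d1 a1 U1 U1x U2 U2x"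
  define \<Psi> where "\<Psi> = ratio_flux d2 a2 W2 W2x W1 W1x"
  have cPhi: "continuous_on {0..L} \<Phi>" unfolding \<Phi>_def ratio_flux_def[abs_def]
    using Up ppos by (intro continuous_intros cU) (auto simp: less_imp_neq[symmetric] dest!: Up(1) Up(2))
  have cPsi: "continuous_on {0..x2} \<Psi>" unfolding \<Psi>_def ratio_flux_def[abs_def]
    using Wp ppos by (intro continuous_intros cW) (auto simp: less_imp_neq[symmetric] dest!: Wp(1) Wp(2))
  have bU: "d1 * U1x 0 = a1 * U1 0" "d1 * U2x 0 = a1 * U2 0" "U1x L = 0" "U2x L = 0"
    using b1 b2 by (simp_all add: bvp_def)
  have bW: "d2 * W1x 0 = a2 * W1 0" "d2 * W2x 0 = a2 * W2 0" "W1x x2 = a2 / d2 * W1 x2" "W2x x2 = a2 / d2 * W2 x2"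
    using b1 b2 by (simp_all add: bvp_def)
  have rf0: "ratio_flux d a y yx z zx x = 0" if "d * (yx x * z x - y x * zx x) = 0" for d a y yx z zx x
    unfolding ratio_flux_def using that by auto
  have P0: "\<Phi> 0 = 0" unfolding \<Phi>_def
  proof (rule rf0)
    have "d1 * (U1x 0 * U2 0 - U1 0 * U2x 0) = (d1 * U1x 0) * U2 0 - U1 0 * (d1 * U2x 0)" by (simp add: algebra_simps)
    thus "d1 * (U1x 0 * U2 0 - U1 0 * U2x 0) = 0" unfolding bU by simp
  qed
  have PL: "\<Phi> L = 0" unfolding \<Phi>_def by (rule rf0) (simp add: bU)
  have Q0: "\<Psi> 0 = 0" unfolding \<Psi>_def
  proof (rule rf0)
    have "d2 * (W2x 0 * W1 0 - W2 0 * W1x 0) = (d2 * W2x 0) * W1 0 - W2 0 * (d2 * W1x 0)" by (simp add: algebra_simps)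
    thus "d2 * (W2x 0 * W1 0 - W2 0 * W1x 0) = 0" unfolding bW by simp
  qed
  have Q1: "\<Psi> x2 = 0" unfolding \<Psi>_def by (rule rf0) (simp add: bW)
  define E1 where "E1 = (\<lambda>x. exp (- a1 / d1 * x))"
  define E2 where "E2 = (\<lambda>x. exp (- a2 / d2 * x))"
  define f where "f = (\<lambda>x. U1 x - U2 x)"
  define w where "w = (\<lambda>x. W2 x - W1 x)"
  have f0: "f x \<ge> 0" if "x \<in> {0..L}" for x using ord(1)[OF that] by (simp add: f_def)
  have w0: "w x \<ge> 0" if "x \<in> {0..x2}" for x using ord(2)[OF that] by (simp add: w_def)
  have DPhi: "\<exists>D. (\<Phi> has_real_derivative D) (at x) \<and> E1 x * ((f x)\<^sup>2 * (f x - m * chi x2 x * w x)) \<le> D"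
    if x: "x \<in> {0<..<L} - {x2}" for x
  proof -
    have xL: "x \<in> {0..L}" using x by simp
    have at: "at x within {0..L} = at x" using x by (intro at_within_interior) auto
    obtain u1 where u1: "(U1x has_real_derivative u1) (at x)"
      "d1 * u1 - a1 * U1x x + U1 x * (r - U1 x - m * chi x2 x * W1 x) = 0" using b1 x unfolding bvp_def by blast
    obtain u2 where u2: "(U2x has_real_derivative u2) (at x)"
      "d1 * u2 - a1 * U2x x + U2 x * (r - U2 x - m * chi x2 x * W2 x) = 0" using b2 x unfolding bvp_def by blast
    have D: "(U1 has_real_derivative U1x x) (at x)" "(U2 has_real_derivative U2x x) (at x)"
      using b1 b2 xL at unfolding bvp_def by metis+
    from ratio_flux_deriv[OF ppos(1) Up(2)[OF xL] ord(1)[OF xL] D u1(1) u2(1) u1(2) u2(2)]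
    obtain D where D: "(\<Phi> has_real_derivative D) (at x)"
      "exp (- a1 / d1 * x) * ((U1 x - U2 x)\<^sup>2 / (U1 x * U2 x)) * (U2 x * (r - U2 x - m * chi x2 x * W2 x) * U1 x - U1 x * (r - U1 x - m * chi x2 x * W1 x) * U2 x) \<le> D"
      unfolding \<Phi>_def by blast
    have "U2 x * (r - U2 x - m * chi x2 x * W2 x) * U1 x - U1 x * (r - U1 x - m * chi x2 x * W1 x) * U2 x
      = (U1 x * U2 x) * (f x - m * chi x2 x * w x)" by (simp add: f_def w_def algebra_simps)
    moreover have "U1 x * U2 x \<noteq> 0" using Up[OF xL] by simp
    ultimately have "E1 x * ((f x)\<^sup>2 * (f x - m * chi x2 x * w x)) \<le> D"
      using D(2) by (simp add: E1_def f_def mult.assoc)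
    thus ?thesis using D(1) by blast
  qed
  have DPsi: "\<exists>D. (\<Psi> has_real_derivative D) (at x) \<and> E2 x * ((w x)\<^sup>2 * (h * w x / (W1 x * W2 x) - p * f x)) \<le> D"
    if x: "x \<in> {0<..<x2}" for x
  proof -
    have xL: "x \<in> {0..x2}" using x by simp
    have at: "at x within {0..x2} = at x" using x by (intro at_within_interior) auto
    obtain u1 where u1: "(W1x has_real_derivative u1) (at x)"
      "d2 * u1 - a2 * W1x x + (h - q * W1 x - p * U1 x * W1 x) = 0" using b1 x unfolding bvp_def by blast
    obtain u2 where u2: "(W2x has_real_derivative u2) (at x)"
      "d2 * u2 - a2 * W2x x + (h - q * W2 x - p * U2 x * W2 x) = 0" using b2 x unfolding bvp_def by blast
    have D: "(W1 has_real_derivative W1x x) (at x)" "(W2 has_real_derivative W2x x) (at x)"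
      using b1 b2 xL at unfolding bvp_def by metis+
    from ratio_flux_deriv[OF ppos(2) Wp(1)[OF xL] ord(2)[OF xL] D(2,1) u2(1) u1(1) u2(2) u1(2)]
    obtain D where D: "(\<Psi> has_real_derivative D) (at x)"
      "exp (- a2 / d2 * x) * ((W2 x - W1 x)\<^sup>2 / (W2 x * W1 x)) * ((h - q * W1 x - p * U1 x * W1 x) * W2 x - (h - q * W2 x - p * U2 x * W2 x) * W1 x) \<le> D"
      unfolding \<Psi>_def by blast
    have WW: "W1 x * W2 x \<noteq> 0" using Wp[OF xL] by simp
    have "(h - q * W1 x - p * U1 x * W1 x) * W2 x - (h - q * W2 x - p * U2 x * W2 x) * W1 x
      = h * w x - W1 x * W2 x * (p * f x)" by (simp add: f_def w_def algebra_simps)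
    also have "\<dots> = (W2 x * W1 x) * (h * w x / (W1 x * W2 x) - p * f x)"
      using WW by (simp add: field_simps)
    finally have "E2 x * ((w x)\<^sup>2 * (h * w x / (W1 x * W2 x) - p * f x)) \<le> D"
      using D(2) WW by (simp add: E2_def w_def mult.assoc)
    thus ?thesis using D(1) by blast
  qed
  define \<Delta> where "\<Delta> = a1 / d1 - a2 / d2"
  define c where "c = exp (- max \<Delta> 0 * x2) / p^3"
  have c: "c > 0" using ppos by (simp add: c_def)
  define J where "J = (\<lambda>x. E1 x * ((f x)\<^sup>2 * (f x - m * w x)) + c * (E2 x * ((w x)\<^sup>2 * (h * w x / (W1 x * W2 x) - p * f x))))"
  have Jlow: "J x \<ge> c * (E2 x * ((h / (W1 x * W2 x) - 1) * w x ^ 3))" if x: "x \<in> {0..x2}" for x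
  proof -
    define e where "e = w x / p"
    define k where "k = exp (\<Delta> * x - max \<Delta> 0 * x2)"
    define s where "s = exp (- \<bar>\<Delta>\<bar> * x2)"
    have we: "w x = p * e" using ppos by (simp add: e_def)
    have kE: "c * E2 x * p^3 = k * E1 x"
    proof -
      have "c * E2 x * p^3 = exp (- max \<Delta> 0 * x2) * E2 x" using ppos by (simp add: c_def)
      also have "\<dots> = exp (- max \<Delta> 0 * x2 - a2 / d2 * x)" by (simp add: E2_def flip: exp_add)
      also have "\<dots> = k * E1 x" by (simp add: k_def E1_def \<Delta>_def algebra_simps flip: exp_add)
      finally show ?thesis .
    qed
    have k: "s \<le> k" "k \<le> 1"
    proof -
      have "\<Delta> * x \<le> max \<Delta> 0 * x2" using x by (intro mult_mono) auto
      thus "k \<le> 1" by (simp add: k_def)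
      have "- \<bar>\<Delta>\<bar> * x2 \<le> \<Delta> * x - max \<Delta> 0 * x2"
      proof (cases "\<Delta> \<ge> 0")
        case True thus ?thesis using x by (simp add: max_def)
      next
        case False
        hence "\<Delta> * x2 \<le> \<Delta> * x" using x by (intro mult_left_mono_neg) auto
        thus ?thesis using False by (simp add: max_def)
      qed
      thus "s \<le> k" by (simp add: k_def s_def)
    qed
    have "m * p \<le> s" using m ppos by (simp add: s_def \<Delta>_def field_simps)
    hence "0 \<le> f x ^ 3 - m * p * (f x)\<^sup>2 * e - k * (f x * e\<^sup>2 - e^3)"
      using f0[OF sub[OF x]] w0[OF x] ppos k by (intro cubic_form_nonneg[of _ _ s]) (auto simp: e_def s_def)
    hence "0 \<le> E1 x * (f x ^ 3 - m * p * (f x)\<^sup>2 * e - k * (f x * e\<^sup>2 - e^3))" by (simp add: E1_def)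
    also have "\<dots> = E1 x * ((f x)\<^sup>2 * (f x - m * w x)) - (k * E1 x) * (f x * e\<^sup>2 - e^3)"
      by (simp add: we algebra_simps power2_eq_square power3_eq_cube)
    also have "\<dots> = E1 x * ((f x)\<^sup>2 * (f x - m * w x)) + c * (E2 x * ((w x)\<^sup>2 * (w x - p * f x)))"
      unfolding kE[symmetric] by (simp add: we algebra_simps power2_eq_square power3_eq_cube)
    also have "\<dots> = J x - c * (E2 x * ((h / (W1 x * W2 x) - 1) * w x ^ 3))"
      by (simp add: J_def algebra_simps power2_eq_square power3_eq_cube)
    finally show ?thesis by simp
  qed
  have hW: "h / (W1 x * W2 x) - 1 > 0" if x: "x \<in> {0..x2}" and wp: "w x > 0" for x
  proof -
    have "W2 x \<le> wb x"
      by (rule w_le_wb[of W2 W2x U2]) (use b2 x Up(2) Wp(2) sub in \<open>auto intro: less_imp_le\<close>)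
    hence "W2 x \<le> wb x2" using wb_max[OF x] by simp
    hence "W2 x * W2 x \<le> wb x2 * wb x2" using Wp(2)[OF x] by (intro mult_mono) auto
    moreover have "W1 x * W2 x < W2 x * W2 x" using wp Wp[OF x] by (intro mult_strict_right_mono) (auto simp: w_def)
    ultimately have "W1 x * W2 x < h" using h by (simp add: power2_eq_square)
    thus ?thesis using Wp[OF x] by (simp add: field_simps)
  qed
  have low: "0 \<le> c * (E2 x * ((h / (W1 x * W2 x) - 1) * w x ^ 3))"
     and low0: "w x > 0 \<Longrightarrow> 0 < c * (E2 x * ((h / (W1 x * W2 x) - 1) * w x ^ 3))" if x: "x \<in> {0..x2}" for x
  proof -
    show gt: "0 < c * (E2 x * ((h / (W1 x * W2 x) - 1) * w x ^ 3))" if "w x > 0"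
      using hW[OF x that] c that by (simp add: E2_def)
    show "0 \<le> c * (E2 x * ((h / (W1 x * W2 x) - 1) * w x ^ 3))"
    proof (cases "w x > 0")
      case False thus ?thesis using w0[OF x] by simp
    qed (use gt in simp)
  qed
  have DPhiR: "\<exists>D. (\<Phi> has_real_derivative D) (at x) \<and> E1 x * (f x)^3 \<le> D \<and> 0 \<le> E1 x * (f x)^3" if "x2 < x" "x < L" for x
    using DPhi[of x] that ppos f0[of x] by (auto simp: chi_def E1_def power3_eq_cube power2_eq_square mult.assoc)
  have PhiR: "\<Phi> x2 \<le> \<Phi> L"
  proof (rule DERIV_nonneg_imp_increasing_open[OF ppos(12)])
    show "\<exists>D. (\<Phi> has_real_derivative D) (at x) \<and> 0 \<le> D" if "x2 < x" "x < L" for x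
      using DPhiR[OF that] by (meson order_trans)
    show "continuous_on {x2..L} \<Phi>" by (rule continuous_on_subset[OF cPhi]) (use ppos in auto)
  qed
  have J0: "J x = 0" if x: "x \<in> {0<..<x2}" for x
  proof (rule nondecreasing_no_gain[of 0 x2 "\<lambda>x. \<Phi> x + c * \<Psi> x" J])
    fix x assume x: "0 < x" "x < x2"
    obtain D where D: "(\<Phi> has_real_derivative D) (at x)" "E1 x * ((f x)\<^sup>2 * (f x - m * w x)) \<le> D"
      using DPhi[of x] x ppos by (auto simp: chi_def)
    obtain D' where D': "(\<Psi> has_real_derivative D') (at x)"
      "E2 x * ((w x)\<^sup>2 * (h * w x / (W1 x * W2 x) - p * f x)) \<le> D'" using DPsi[of x] x by auto
    have "J x \<le> D + c * D'" unfolding J_def using D(2) D'(2) c by (intro add_mono mult_left_mono) auto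
    moreover have "((\<lambda>x. \<Phi> x + c * \<Psi> x) has_real_derivative D + c * D') (at x)"
      by (intro DERIV_add DERIV_cmult D D')
    moreover have "0 \<le> J x" using Jlow[of x] low[of x] x by simp
    ultimately show "\<exists>D. ((\<lambda>x. \<Phi> x + c * \<Psi> x) has_real_derivative D) (at x) \<and> J x \<le> D \<and> 0 \<le> J x" by blast
  next
    show "continuous_on {0..x2} (\<lambda>x. \<Phi> x + c * \<Psi> x)"
      by (intro continuous_intros cPsi continuous_on_subset[OF cPhi]) (use ppos in auto)
    show "\<Phi> x2 + c * \<Psi> x2 \<le> \<Phi> 0 + c * \<Psi> 0" using PhiR P0 PL Q0 Q1 by simp
  qed (use x in auto)
  have wz: "w x = 0" if x: "x \<in> {0<..<x2}" for x
  proof (rule ccontr)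
    assume "w x \<noteq> 0"
    hence "w x > 0" using w0[of x] x by simp
    thus False using low0[of x] Jlow[of x] J0[OF x] x by simp
  qed
  have fz: "f x = 0" if x: "x \<in> {0<..<x2}" for x
    using J0[OF x] wz[OF x] by (simp add: J_def E1_def)
  have clo: "closure {0<..<x2} = {0..x2}" using ppos by (simp add: closure_greaterThanLessThan)
  have cf: "continuous_on {0..L} f" unfolding f_def by (intro continuous_intros cU)
  have cw: "continuous_on {0..x2} w" unfolding w_def by (intro continuous_intros cW)
  have wz': "w x = 0" if "x \<in> {0..x2}" for x
    using continuous_constant_on_closure[of "{0<..<x2}" w 0 x] wz cw that clo by auto
  have fz': "f x = 0" if "x \<in> {0..x2}" for x
    using continuous_constant_on_closure[of "{0<..<x2}" f 0 x] fz continuous_on_subset[OF cf, of "{0..x2}"] that clo ppos by auto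
  have Phix2: "\<Phi> x2 = 0"
  proof -
    have "U1 x2 = U2 x2" using fz'[of x2] ppos by (simp add: f_def)
    thus ?thesis using Up[of x2] ppos by (simp add: \<Phi>_def ratio_flux_def)
  qed
  have fR: "f x = 0" if x: "x2 < x" "x < L" for x
  proof -
    have "E1 x * (f x)^3 = 0"
    proof (rule nondecreasing_no_gain[of x2 L \<Phi> "\<lambda>x. E1 x * (f x)^3"])
      show "continuous_on {x2..L} \<Phi>" by (rule continuous_on_subset[OF cPhi]) (use ppos in auto)
      show "\<Phi> L \<le> \<Phi> x2" using PL Phix2 by simp
    qed (use DPhiR x in auto)
    thus ?thesis by (simp add: E1_def)
  qed
  have "f x = 0" if "x \<in> {0..L}" for x
  proof (cases "x \<le> x2")
    case True thus ?thesis using fz' that by auto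
  next
    case False
    hence "closure {x2<..<L} = {x2..L}" using that by (simp add: closure_greaterThanLessThan)
    thus ?thesis using continuous_constant_on_closure[of "{x2<..<L}" f 0 x] fR
        continuous_on_subset[OF cf, of "{x2..L}"] that False ppos by auto
  qed
  thus "\<forall>x\<in>{0..L}. U1 x = U2 x" by (simp add: f_def)
  show "\<forall>x\<in>{0..x2}. W1 x = W2 x" using wz' by (simp add: w_def)
qed

end

section \<open>Monotone iteration\<close>

lemma Dini_decreasing:
  fixes F :: "nat \<Rightarrow> real \<Rightarrow> real"
  assumes cF: "\<And>n. continuous_on {l..r} (F n)" and cf: "continuous_on {l..r} f"
    and dec: "\<And>n x. x \<in> {l..r} \<Longrightarrow> F (Suc n) x \<le> F n x"
    and lim: "\<And>x. x \<in> {l..r} \<Longrightarrow> (\<lambda>n. F n x) \<longlonglongrightarrow> f x" and e: "e > 0"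
  obtains N where "\<And>n x. N \<le> n \<Longrightarrow> x \<in> {l..r} \<Longrightarrow> F n x \<le> f x + e"
proof -
  have mono: "F n x \<le> F k x" if "k \<le> n" "x \<in> {l..r}" for n k x
    using lift_Suc_antimono_le[of "\<lambda>n. F n x", OF dec[OF that(2)] that(1)] .
  have "\<exists>N. \<forall>x\<in>{l..r}. F N x \<le> f x + e"
  proof (rule ccontr)
    assume "\<nexists>N. \<forall>x\<in>{l..r}. F N x \<le> f x + e"
    then obtain X where X: "\<And>n. X n \<in> {l..r}" "\<And>n. F n (X n) > f (X n) + e"
      by (metis linorder_not_le)
    obtain x s where x: "x \<in> {l..r}" "strict_mono s" "(X \<circ> s) \<longlonglongrightarrow> x"
      using compact_imp_seq_compact[OF compact_Icc, of l r] X(1) unfolding seq_compact_def by metis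
    have "F N x \<ge> f x + e" for N
    proof -
      have 1: "(\<lambda>k. F N (X (s k))) \<longlonglongrightarrow> F N x" and 2: "(\<lambda>k. f (X (s k)) + e) \<longlonglongrightarrow> f x + e"
        using continuous_on_tendsto_compose[OF cF x(3,1)] continuous_on_tendsto_compose[OF cf x(3,1)] X(1)
        by (auto simp: o_def intro!: tendsto_intros)
      have "f (X (s k)) + e \<le> F N (X (s k))" if "k \<ge> N" for k
      proof -
        have "N \<le> s k" using that seq_suble[OF x(2), of k] by simp
        thus ?thesis using mono[OF _ X(1), of N "s k" "s k"] X(2)[of "s k"] by simp
      qed
      thus ?thesis using LIMSEQ_le[OF 2 1] by blast
    qed
    hence "f x + e \<le> f x" using LIMSEQ_le_const[OF lim[OF x(1)]] by blast
    thus False using e by simp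
  qed
  then obtain N where "\<And>x. x \<in> {l..r} \<Longrightarrow> F N x \<le> f x + e" by blast
  thus ?thesis using that mono by (meson order_trans)
qed

lemma mono_lim:
  fixes s :: "nat \<Rightarrow> real"
  shows "(\<And>n. s (Suc n) \<le> s n) \<Longrightarrow> (\<And>n. c \<le> s n) \<Longrightarrow> s \<longlonglongrightarrow> lim s"
    "(\<And>n. s n \<le> s (Suc n)) \<Longrightarrow> (\<And>n. s n \<le> c) \<Longrightarrow> s \<longlonglongrightarrow> lim s"
  by (metis convergent_LIMSEQ_iff decseq_SucI decseq_convergent convergentI)
     (metis convergent_LIMSEQ_iff incseq_SucI incseq_convergent convergentI)

locale sandwich = model +
  fixes K Ub Wb :: real and ul uu wl wu :: "real \<Rightarrow> real"
  assumes K: "2 * Ub + m * Wb \<le> K" "q + p * Ub \<le> K"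
    and cont0: "continuous_on {0..L} ul" "continuous_on {0..L} uu" "continuous_on {0..x2} wl" "continuous_on {0..x2} wu"
    and box_u: "\<And>x. x \<in> {0..L} \<Longrightarrow> 0 < ul x \<and> ul x \<le> uu x \<and> uu x \<le> Ub"
    and box_w: "\<And>x. x \<in> {0..x2} \<Longrightarrow> 0 \<le> wl x \<and> wl x \<le> wu x \<and> wu x \<le> Wb"
    and sub_u: "\<And>x. x \<in> {0..L} \<Longrightarrow> ul x \<le> green_op.green d1 a1 0 K L (\<lambda>x. ul x * (K + r - ul x - m * chi x2 x * wu x)) x"
    and sup_u: "\<And>x. x \<in> {0..L} \<Longrightarrow> green_op.green d1 a1 0 K L (\<lambda>x. uu x * (K + r - uu x - m * chi x2 x * wl x)) x \<le> uu x"
    and sub_w: "\<And>x. x \<in> {0..x2} \<Longrightarrow> wl x \<le> green_op.green d2 a2 (a2 / d2) K x2 (\<lambda>x. h + (K - q - p * uu x) * wl x) x"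
    and sup_w: "\<And>x. x \<in> {0..x2} \<Longrightarrow> green_op.green d2 a2 (a2 / d2) K x2 (\<lambda>x. h + (K - q - p * ul x) * wu x) x \<le> wu x"
begin

lemma bounds: "0 < Ub" "0 \<le> Wb" "0 < K"
proof -
  show 1: "0 < Ub" using box_u[of 0] ppos by auto
  show "0 \<le> Wb" using box_w[of 0] ppos by auto
  have "p * Ub > 0" using 1 ppos by simp
  thus "0 < K" using K(2) ppos by linarith
qed

sublocale G1: green_op d1 a1 0 K L using ppos bounds by unfold_locales auto
sublocale G2: green_op d2 a2 "a2 / d2" K x2 using ppos bounds by unfold_locales auto

definition "F1 u w x = u x * (K + r - u x - m * chi x2 x * w x)"
definition "F2 u w x = h + (K - q - p * u x) * w x"
definition "step X = (G1.green (F1 (fst X) (snd X)), G2.green (F2 (fst X) (snd X)))"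

definition inbox :: "(real \<Rightarrow> real) \<times> (real \<Rightarrow> real) \<Rightarrow> bool" where
  "inbox X \<longleftrightarrow> continuous_on {0..L} (fst X) \<and> continuous_on {0..x2} (snd X) \<and>
    (\<forall>x\<in>{0..L}. ul x \<le> fst X x \<and> fst X x \<le> uu x) \<and> (\<forall>x\<in>{0..x2}. wl x \<le> snd X x \<and> snd X x \<le> wu x)"

definition ord :: "(real \<Rightarrow> real) \<times> (real \<Rightarrow> real) \<Rightarrow> (real \<Rightarrow> real) \<times> (real \<Rightarrow> real) \<Rightarrow> bool" where
  "ord X Y \<longleftrightarrow> (\<forall>x\<in>{0..L}. fst X x \<le> fst Y x) \<and> (\<forall>x\<in>{0..x2}. snd Y x \<le> snd X x)"

lemma F1_approx:
  assumes y: "0 \<le> y" "y \<le> Ub" "0 \<le> y'" "y' \<le> Ub" and v: "0 \<le> v" "v \<le> Wb" "0 \<le> v'" "v' \<le> Wb"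
    and c: "0 \<le> c" "c \<le> 1" and e: "0 \<le> e" "y \<le> y' + e" "v' \<le> v + e"
  shows "y * (K + r - y - m * c * v) \<le> y' * (K + r - y' - m * c * v') + (K + r + m * Ub) * e"
proof -
  have "c * v' \<le> 1 * Wb" using c v by (intro mult_mono) auto
  hence "m * (c * v') \<le> m * Wb" using ppos by simp
  hence "K + r - y - y' - m * c * v' \<ge> 0" using K(1) y ppos(3) unfolding mult.assoc by linarith
  moreover have "m * c * v' \<ge> 0" using c v ppos by simp
  ultimately have 1: "(y - y') * (K + r - y - y' - m * c * v') \<le> e * (K + r)"
  proof -
    have "(y - y') * (K + r - y - y' - m * c * v') \<le> e * (K + r - y - y' - m * c * v')"
      using e \<open>K + r - y - y' - m * c * v' \<ge> 0\<close> by (intro mult_right_mono) auto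
    also have "\<dots> \<le> e * (K + r)" using e y \<open>m * c * v' \<ge> 0\<close> by (intro mult_left_mono) auto
    finally show ?thesis .
  qed
  have "m * (c * y) * (v' - v) \<le> m * (c * y) * e" using e ppos c y by (intro mult_left_mono) auto
  also have "\<dots> \<le> m * (1 * Ub) * e" using e ppos c y by (intro mult_mono) auto
  finally have 2: "m * (c * y) * (v' - v) \<le> m * Ub * e" by simp
  have "y * (K + r - y - m * c * v) - y' * (K + r - y' - m * c * v') =
     (y - y') * (K + r - y - y' - m * c * v') + m * (c * y) * (v' - v)" by (simp add: algebra_simps)
  also have "\<dots> \<le> e * (K + r) + m * Ub * e" using 1 2 by simp
  finally show ?thesis by (simp add: algebra_simps)
qed

lemma F2_approx:
  assumes y: "0 \<le> y" "y \<le> Ub" "0 \<le> y'" "y' \<le> Ub" and v: "0 \<le> v" "v \<le> Wb" "0 \<le> v'" "v' \<le> Wb"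
    and e: "0 \<le> e" "y' \<le> y + e" "v \<le> v' + e"
  shows "h + (K - q - p * y) * v \<le> h + (K - q - p * y') * v' + (K + p * Wb) * e"
proof -
  have "p * y' \<le> p * Ub" "0 \<le> p * y'" using y ppos by simp_all
  hence f: "K - q - p * y' \<ge> 0" "K - q - p * y' \<le> K" using K(2) ppos(6) by linarith+
  have "(K - q - p * y') * (v - v') \<le> (K - q - p * y') * e" using f e by (intro mult_left_mono) auto
  also have "\<dots> \<le> K * e" using f e by (intro mult_right_mono) auto
  finally have 1: "(K - q - p * y') * (v - v') \<le> K * e" .
  have "p * v * (y' - y) \<le> p * v * e" using e v ppos by (intro mult_left_mono) auto
  also have "\<dots> \<le> p * Wb * e" using e v ppos by (intro mult_right_mono) auto
  finally have 2: "p * v * (y' - y) \<le> p * Wb * e" .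
  have "(K - q - p * y) * v - (K - q - p * y') * v' = (K - q - p * y') * (v - v') + p * v * (y' - y)"
    by (simp add: algebra_simps)
  also have "\<dots> \<le> K * e + p * Wb * e" using 1 2 by simp
  finally show ?thesis by (simp add: algebra_simps)
qed

lemma F1_bint:
  assumes "continuous_on {0..L} u" "continuous_on {0..x2} w"
  shows "bint L (F1 u w)"
proof -
  have "bint L (\<lambda>x. u x * (K + r - u x - m * (chi x2 x * w x)))"
    by (intro bint_mult bint_diff bint_chi bint_cont continuous_intros assms)
  thus ?thesis by (rule bint_cong) (simp add: F1_def)
qed

lemma F1_isCont:
  assumes u: "continuous_on {0..L} u" and w: "continuous_on {0..x2} w" and x: "x \<in> {0<..<L} - {x2}"
  shows "isCont (F1 u w) x"
proof -
  have "isCont (\<lambda>x. u x * (K + r - u x - m * (chi x2 x * w x))) x"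
    by (intro isCont_mult isCont_diff isCont_on[OF u x] isCont_chi[OF w x] continuous_const)
  thus ?thesis by (simp add: F1_def[abs_def] mult.assoc)
qed

lemma F2_cont:
  assumes "continuous_on {0..L} u" "continuous_on {0..x2} w"
  shows "continuous_on {0..x2} (F2 u w)"
  unfolding F2_def[abs_def]
  by (intro continuous_intros assms continuous_on_subset[OF assms(1)]) (use ppos in auto)

lemma F2_bint: "continuous_on {0..L} u \<Longrightarrow> continuous_on {0..x2} w \<Longrightarrow> bint x2 (F2 u w)"
  by (intro bint_cont F2_cont)

lemma F2_isCont:
  assumes "continuous_on {0..L} u" "continuous_on {0..x2} w" "x \<in> {0<..<x2} - {}"
  shows "isCont (F2 u w) x"
  using continuous_on_interior[OF F2_cont[OF assms(1,2)], of x] assms(3) by auto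

lemma inbox_u: "inbox X \<Longrightarrow> x \<in> {0..L} \<Longrightarrow> 0 < fst X x \<and> fst X x \<le> Ub"
  using box_u unfolding inbox_def by (meson less_le_trans order_trans)

lemma inbox_w: "inbox X \<Longrightarrow> x \<in> {0..x2} \<Longrightarrow> 0 \<le> snd X x \<and> snd X x \<le> Wb"
  using box_w unfolding inbox_def by (meson order_trans)

lemma in_L: "x \<in> {0..x2} \<Longrightarrow> x \<in> {0..L}" using ppos by auto

lemma F1_mono_approx:
  assumes X: "inbox X" and x: "x \<in> {0..L}" and e: "0 \<le> e"
    and y: "0 \<le> y" "y \<le> Ub" and v: "x \<in> {0..x2} \<Longrightarrow> 0 \<le> v \<and> v \<le> Wb"
  shows "y \<le> fst X x + e \<Longrightarrow> (x \<in> {0..x2} \<Longrightarrow> snd X x \<le> v + e) \<Longrightarrow>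
      y * (K + r - y - m * chi x2 x * v) \<le> F1 (fst X) (snd X) x + (K + r + m * Ub) * e"
    "fst X x \<le> y + e \<Longrightarrow> (x \<in> {0..x2} \<Longrightarrow> v \<le> snd X x + e) \<Longrightarrow>
      F1 (fst X) (snd X) x \<le> y * (K + r - y - m * chi x2 x * v) + (K + r + m * Ub) * e"
proof -
  have u: "0 \<le> fst X x" "fst X x \<le> Ub" using inbox_u[OF X x] by auto
  note W0 = bounds(2)
  show "y * (K + r - y - m * chi x2 x * v) \<le> F1 (fst X) (snd X) x + (K + r + m * Ub) * e"
    if "y \<le> fst X x + e" "x \<in> {0..x2} \<Longrightarrow> snd X x \<le> v + e"
  proof (cases "x < x2")
    case True
    hence x': "x \<in> {0..x2}" using x by simp
    show ?thesis unfolding F1_def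
      by (rule F1_approx) (use y u v[OF x'] inbox_w[OF X x'] e that x' in \<open>auto simp: chi_def\<close>)
  next
    case False
    hence "chi x2 x = 0" by (simp add: chi_def)
    thus ?thesis unfolding F1_def using F1_approx[OF y u, of 0 0 0 e] that(1) e W0 by simp
  qed
  show "F1 (fst X) (snd X) x \<le> y * (K + r - y - m * chi x2 x * v) + (K + r + m * Ub) * e"
    if "fst X x \<le> y + e" "x \<in> {0..x2} \<Longrightarrow> v \<le> snd X x + e"
  proof (cases "x < x2")
    case True
    hence x': "x \<in> {0..x2}" using x by simp
    show ?thesis unfolding F1_def
      by (rule F1_approx) (use y u v[OF x'] inbox_w[OF X x'] e that x' in \<open>auto simp: chi_def\<close>)
  next
    case False
    hence "chi x2 x = 0" by (simp add: chi_def)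
    thus ?thesis unfolding F1_def using F1_approx[OF u y, of 0 0 0 e] that(1) e W0 by simp
  qed
qed

lemma F2_mono_approx:
  assumes X: "inbox X" and x: "x \<in> {0..x2}" and e: "0 \<le> e"
    and y: "0 \<le> y" "y \<le> Ub" and v: "0 \<le> v" "v \<le> Wb"
  shows "fst X x \<le> y + e \<Longrightarrow> v \<le> snd X x + e \<Longrightarrow>
      h + (K - q - p * y) * v \<le> F2 (fst X) (snd X) x + (K + p * Wb) * e"
    "y \<le> fst X x + e \<Longrightarrow> snd X x \<le> v + e \<Longrightarrow>
      F2 (fst X) (snd X) x \<le> h + (K - q - p * y) * v + (K + p * Wb) * e"
  using F2_approx[of y "fst X x" v "snd X x" e] F2_approx[of "fst X x" y "snd X x" v e]
    inbox_u[OF X in_L[OF x]] inbox_w[OF X x] e y v by (auto simp: F2_def)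

lemma step_mono:
  assumes X: "inbox X" and Y: "inbox Y" and o: "ord X Y"
  shows "ord (step X) (step Y)"
proof -
  note c = X[unfolded inbox_def] Y[unfolded inbox_def]
  have "F1 (fst X) (snd X) x \<le> F1 (fst Y) (snd Y) x" if x: "x \<in> {0..L}" for x
    using F1_mono_approx(1)[OF Y x order_refl, of "fst X x" "snd X x"] inbox_u[OF X x] inbox_w[OF X, of x] o x
    unfolding ord_def F1_def by auto
  moreover have "F2 (fst Y) (snd Y) x \<le> F2 (fst X) (snd X) x" if x: "x \<in> {0..x2}" for x
    using F2_mono_approx(1)[OF X x order_refl, of "fst Y x" "snd Y x"] inbox_u[OF Y in_L[OF x]] inbox_w[OF Y x] o x in_L[OF x]
    unfolding ord_def F2_def by auto
  ultimately show ?thesis unfolding ord_def step_def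
    using c by (auto intro!: G1.green_mono G2.green_mono F1_bint F2_bint)
qed

lemma ord_trans: "ord X Y \<Longrightarrow> ord Y Z \<Longrightarrow> ord X Z" unfolding ord_def by (meson order_trans)

lemma ends:
  shows "inbox (uu, wl)" "inbox (ul, wu)" "ord (step (uu, wl)) (uu, wl)" "ord (ul, wu) (step (ul, wu))"
    "ord (ul, wu) (uu, wl)"
  using box_u box_w cont0 sub_u sup_u sub_w sup_w
  by (auto simp: inbox_def ord_def step_def F1_def[abs_def] F2_def[abs_def])

lemma inbox_ord: "inbox X \<longleftrightarrow> continuous_on {0..L} (fst X) \<and> continuous_on {0..x2} (snd X) \<and>
    ord (ul, wu) X \<and> ord X (uu, wl)"
  by (auto simp: inbox_def ord_def)

lemma step_cont:
  assumes "inbox X"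
  shows "continuous_on {0..L} (fst (step X))" "continuous_on {0..x2} (snd (step X))"
  using assms by (auto simp: step_def inbox_def intro!: G1.green_cont G2.green_cont F1_bint F2_bint)

lemma step_inbox: assumes "inbox X" shows "inbox (step X)"
proof -
  have "ord (ul, wu) X" "ord X (uu, wl)" using assms by (auto simp: inbox_ord)
  hence "ord (step (ul, wu)) (step X)" "ord (step X) (step (uu, wl))"
    using step_mono ends assms by auto
  hence "ord (ul, wu) (step X)" "ord (step X) (uu, wl)" using ends ord_trans by blast+
  thus ?thesis using step_cont[OF assms] by (simp add: inbox_ord)
qed

definition "hi n = (step ^^ n) (uu, wl)"
definition "lo n = (step ^^ n) (ul, wu)"

lemma hi_lo_Suc: "hi (Suc n) = step (hi n)" "lo (Suc n) = step (lo n)"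
  by (simp_all add: hi_def lo_def)

lemma hi_lo: "inbox (hi n)" "inbox (lo n)" "ord (hi (Suc n)) (hi n)" "ord (lo n) (lo (Suc n))" "ord (lo n) (hi n)"
proof -
  have "inbox (hi n) \<and> inbox (lo n) \<and> ord (hi (Suc n)) (hi n) \<and> ord (lo n) (lo (Suc n)) \<and> ord (lo n) (hi n)"
  proof (induction n)
    case 0
    show ?case using ends by (simp add: hi_def lo_def)
  next
    case (Suc n)
    thus ?case using step_inbox step_mono by (simp add: hi_lo_Suc)
  qed
  thus "inbox (hi n)" "inbox (lo n)" "ord (hi (Suc n)) (hi n)" "ord (lo n) (lo (Suc n))" "ord (lo n) (hi n)" by auto
qed

lemma steady_limit:
  assumes X: "\<And>n. inbox (X n)" and S: "\<And>n. X (Suc n) = step (X n)"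
    and U: "\<And>x. x \<in> {0..L} \<Longrightarrow> (\<lambda>n. fst (X n) x) \<longlonglongrightarrow> U x"
    and W: "\<And>x. x \<in> {0..x2} \<Longrightarrow> (\<lambda>n. snd (X n) x) \<longlonglongrightarrow> W x"
  obtains V Vx Z Zx where "steady V Vx Z Zx"
    "\<And>x. x \<in> {0..L} \<Longrightarrow> (\<lambda>n. fst (X n) x) \<longlonglongrightarrow> V x"
    "\<And>x. x \<in> {0..x2} \<Longrightarrow> (\<lambda>n. snd (X n) x) \<longlonglongrightarrow> Z x"
proof -
  have cX: "continuous_on {0..L} (fst (X n))" "continuous_on {0..x2} (snd (X n))" for n
    using X[of n] by (auto simp: inbox_def)
  have b1: "\<bar>F1 (fst (X n)) (snd (X n)) x\<bar> \<le> Ub * (K + r)" if x: "x \<in> {0..L}" for n x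
  proof -
    have u: "0 < fst (X n) x" "fst (X n) x \<le> Ub" using inbox_u[OF X x] by auto
    have cw: "0 \<le> m * chi x2 x * snd (X n) x" "m * chi x2 x * snd (X n) x \<le> m * Wb"
      using inbox_w[OF X, of x n] x ppos bounds by (auto simp: chi_def)
    have "0 \<le> K + r - fst (X n) x - m * chi x2 x * snd (X n) x" using cw u K(1) ppos bounds by linarith
    moreover have "K + r - fst (X n) x - m * chi x2 x * snd (X n) x \<le> K + r" using cw u by linarith
    ultimately show ?thesis using u unfolding F1_def abs_mult by (intro mult_mono) auto
  qed
  have b2: "\<bar>F2 (fst (X n)) (snd (X n)) x\<bar> \<le> h + K * Wb" and F2h: "h \<le> F2 (fst (X n)) (snd (X n)) x"
    if x: "x \<in> {0..x2}" for n x
  proof -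
    have "0 \<le> p * fst (X n) x" "p * fst (X n) x \<le> p * Ub" using inbox_u[OF X in_L[OF x], of n] ppos by auto
    hence k: "0 \<le> K - q - p * fst (X n) x" "K - q - p * fst (X n) x \<le> K" using K(2) ppos by linarith+
    have w: "0 \<le> snd (X n) x" "snd (X n) x \<le> Wb" using inbox_w[OF X x] by auto
    have "(K - q - p * fst (X n) x) * snd (X n) x \<le> K * Wb" using k w bounds by (intro mult_mono) auto
    moreover have "0 \<le> (K - q - p * fst (X n) x) * snd (X n) x" using k w by simp
    ultimately show "\<bar>F2 (fst (X n)) (snd (X n)) x\<bar> \<le> h + K * Wb" "h \<le> F2 (fst (X n)) (snd (X n)) x"
      using ppos unfolding F2_def by auto
  qed
  have l1: "(\<lambda>n. F1 (fst (X n)) (snd (X n)) x) \<longlonglongrightarrow> F1 U W x" if x: "x \<in> {0..L}" for x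
  proof (cases "x < x2")
    case True
    thus ?thesis unfolding F1_def using x by (intro tendsto_intros U W) auto
  next
    case False
    hence "chi x2 x = 0" by (simp add: chi_def)
    thus ?thesis unfolding F1_def using x by (auto intro!: tendsto_intros U)
  qed
  have l2: "(\<lambda>n. F2 (fst (X n)) (snd (X n)) x) \<longlonglongrightarrow> F2 U W x" if x: "x \<in> {0..x2}" for x
    unfolding F2_def using x in_L[OF x] by (intro tendsto_intros U W) auto
  have B1: "bint L (F1 U W)" by (rule dominated_convergence_bint[OF F1_bint[OF cX] b1 l1])
  have B2: "bint x2 (F2 U W)" by (rule dominated_convergence_bint[OF F2_bint[OF cX] b2 l2])
  have eU: "U x = G1.green (F1 U W) x" if x: "x \<in> {0..L}" for x
  proof (rule LIMSEQ_unique)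
    show "(\<lambda>n. fst (X (Suc n)) x) \<longlonglongrightarrow> U x" by (rule LIMSEQ_Suc[OF U[OF x]])
    show "(\<lambda>n. fst (X (Suc n)) x) \<longlonglongrightarrow> G1.green (F1 U W) x"
      unfolding S step_def fst_conv by (rule G1.green_tendsto[OF F1_bint[OF cX] b1 l1 x])
  qed
  have eW: "W x = G2.green (F2 U W) x" if x: "x \<in> {0..x2}" for x
  proof (rule LIMSEQ_unique)
    show "(\<lambda>n. snd (X (Suc n)) x) \<longlonglongrightarrow> W x" by (rule LIMSEQ_Suc[OF W[OF x]])
    show "(\<lambda>n. snd (X (Suc n)) x) \<longlonglongrightarrow> G2.green (F2 U W) x"
      unfolding S step_def snd_conv by (rule G2.green_tendsto[OF F2_bint[OF cX] b2 l2 x])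
  qed
  have cU: "continuous_on {0..L} U" using continuous_on_eq[OF G1.green_cont(1)[OF B1]] eU by force
  have cW: "continuous_on {0..x2} W" using continuous_on_eq[OF G2.green_cont(1)[OF B2]] eW by force
  define V where "V = G1.green (F1 U W)"
  define Z where "Z = G2.green (F2 U W)"
  have V: "V x = U x" if "x \<in> {0..L}" for x using eU[OF that] by (simp add: V_def)
  have Z: "Z x = W x" if "x \<in> {0..x2}" for x using eW[OF that] by (simp add: Z_def)
  have "steady V (G1.green' (F1 U W)) Z (G2.green' (F2 U W))" unfolding steady_def
  proof (intro conjI ballI)
    fix x assume x: "x \<in> {0..L}"
    have "ul x \<le> U x" by (rule LIMSEQ_le_const[OF U[OF x]]) (use X x in \<open>auto simp: inbox_def\<close>)
    thus "0 < V x" using box_u[OF x] V[OF x] by simp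
  next
    fix x assume x: "x \<in> {0..x2}"
    have hF: "h \<le> F2 U W y" if "y \<in> {0..x2}" for y
      by (rule LIMSEQ_le_const[OF l2[OF that]]) (use F2h[OF that] in auto)
    show "0 < Z x" unfolding Z_def
      by (rule G2.green_pos[OF B2 _ _ x _ x, of "\<lambda>_. h"]) (use hF ppos in auto)
  next
    have "bvp d1 a1 0 L {x2} V (G1.green' (F1 U W)) (\<lambda>x. F1 U W x - K * V x)"
      unfolding V_def by (rule G1.green_bvp[OF B1 _ F1_isCont[OF cU cW]]) auto
    thus "bvp d1 a1 0 L {x2} V (G1.green' (F1 U W)) (\<lambda>x. V x * (r - V x - m * chi x2 x * Z x))"
    proof (rule bvp_mono[OF _ order_refl])
      fix x assume x: "x \<in> {0<..<L} - {x2}"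
      hence "chi x2 x * Z x = chi x2 x * W x" using Z[of x] by (auto simp: chi_def)
      hence "m * chi x2 x * Z x = m * chi x2 x * W x" by (simp add: mult.assoc)
      thus "F1 U W x - K * V x = V x * (r - V x - m * chi x2 x * Z x)"
        using V[of x] x unfolding F1_def by (auto simp: algebra_simps)
    qed
    have "bvp d2 a2 (a2 / d2) x2 {} Z (G2.green' (F2 U W)) (\<lambda>x. F2 U W x - K * Z x)"
      unfolding Z_def by (rule G2.green_bvp[OF B2 _ F2_isCont[OF cU cW]]) auto
    thus "bvp d2 a2 (a2 / d2) x2 {} Z (G2.green' (F2 U W)) (\<lambda>x. h - q * Z x - p * V x * Z x)"
    proof (rule bvp_mono[OF _ order_refl])
      fix x assume x: "x \<in> {0<..<x2} - {}"
      thus "F2 U W x - K * Z x = h - q * Z x - p * V x * Z x"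
        using V[of x] Z[of x] ppos by (simp add: F2_def algebra_simps)
    qed
    show "continuous_on {0..L} (G1.green' (F1 U W))" by (rule G1.green_cont(2)[OF B1])
    show "continuous_on {0..x2} (G2.green' (F2 U W))" by (rule G2.green_cont(2)[OF B2])
  qed
  thus ?thesis by (rule that) (use U W V Z in auto)
qed

lemma common_limit:
  assumes m: "m \<le> exp (- \<bar>a1/d1 - a2/d2\<bar> * x2) / p" and h: "(wb x2)\<^sup>2 \<le> h"
  obtains U Ux W Wx where "steady U Ux W Wx"
    "\<And>x. x \<in> {0..L} \<Longrightarrow> (\<lambda>n. fst (hi n) x) \<longlonglongrightarrow> U x" "\<And>x. x \<in> {0..x2} \<Longrightarrow> (\<lambda>n. snd (hi n) x) \<longlonglongrightarrow> W x"
    "\<And>x. x \<in> {0..L} \<Longrightarrow> (\<lambda>n. fst (lo n) x) \<longlonglongrightarrow> U x" "\<And>x. x \<in> {0..x2} \<Longrightarrow> (\<lambda>n. snd (lo n) x) \<longlonglongrightarrow> W x"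
proof -
  note tb = hi_lo[unfolded ord_def inbox_def]
  obtain U1 U1x W1 W1x where 1: "steady U1 U1x W1 W1x"
    "\<And>x. x \<in> {0..L} \<Longrightarrow> (\<lambda>n. fst (hi n) x) \<longlonglongrightarrow> U1 x" "\<And>x. x \<in> {0..x2} \<Longrightarrow> (\<lambda>n. snd (hi n) x) \<longlonglongrightarrow> W1 x"
  proof (rule steady_limit[of hi "\<lambda>x. lim (\<lambda>n. fst (hi n) x)" "\<lambda>x. lim (\<lambda>n. snd (hi n) x)"])
    show "(\<lambda>n. fst (hi n) x) \<longlonglongrightarrow> lim (\<lambda>n. fst (hi n) x)" if "x \<in> {0..L}" for x
      by (rule mono_lim(1)[of _ "ul x"]) (use tb that in auto)
    show "(\<lambda>n. snd (hi n) x) \<longlonglongrightarrow> lim (\<lambda>n. snd (hi n) x)" if "x \<in> {0..x2}" for x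
      by (rule mono_lim(2)[of _ "wu x"]) (use tb that in auto)
  qed (use hi_lo hi_lo_Suc in auto)
  obtain U2 U2x W2 W2x where 2: "steady U2 U2x W2 W2x"
    "\<And>x. x \<in> {0..L} \<Longrightarrow> (\<lambda>n. fst (lo n) x) \<longlonglongrightarrow> U2 x" "\<And>x. x \<in> {0..x2} \<Longrightarrow> (\<lambda>n. snd (lo n) x) \<longlonglongrightarrow> W2 x"
  proof (rule steady_limit[of lo "\<lambda>x. lim (\<lambda>n. fst (lo n) x)" "\<lambda>x. lim (\<lambda>n. snd (lo n) x)"])
    show "(\<lambda>n. fst (lo n) x) \<longlonglongrightarrow> lim (\<lambda>n. fst (lo n) x)" if "x \<in> {0..L}" for x
      by (rule mono_lim(2)[of _ "uu x"]) (use tb that in auto)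
    show "(\<lambda>n. snd (lo n) x) \<longlonglongrightarrow> lim (\<lambda>n. snd (lo n) x)" if "x \<in> {0..x2}" for x
      by (rule mono_lim(1)[of _ "wl x"]) (use tb that in auto)
  qed (use hi_lo hi_lo_Suc in auto)
  have "U2 x \<le> U1 x" if "x \<in> {0..L}" for x
    by (rule LIMSEQ_le[OF 2(2) 1(2)]) (use tb that in auto)
  moreover have "W1 x \<le> W2 x" if "x \<in> {0..x2}" for x
    by (rule LIMSEQ_le[OF 1(3) 2(3)]) (use tb that in auto)
  ultimately have "\<forall>x\<in>{0..L}. U1 x = U2 x" "\<forall>x\<in>{0..x2}. W1 x = W2 x"
    using ordered_steady_unique[OF 1(1) 2(1) _ _ m h] by blast+
  thus ?thesis using that[OF 1] 2 by auto
qed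

end

section \<open>Bounds for solutions of the parabolic system\<close>

context model
begin

definition psol :: "real \<Rightarrow> (real \<Rightarrow> real \<Rightarrow> real) \<Rightarrow> (real \<Rightarrow> real \<Rightarrow> real) \<Rightarrow> bool" where
  "psol T u w \<longleftrightarrow>
    parab d1 a1 0 L {x2} T u (\<lambda>x t. u x t * (r - u x t - m * chi x2 x * w x t)) \<and>
    parab d2 a2 (a2 / d2) x2 {} T w (\<lambda>x t. h - q * w x t - p * u x t * w x t)"

definition converges_to :: "(real \<Rightarrow> real \<Rightarrow> real) \<Rightarrow> (real \<Rightarrow> real \<Rightarrow> real) \<Rightarrow> (real \<Rightarrow> real) \<Rightarrow> (real \<Rightarrow> real) \<Rightarrow> bool" where
  "converges_to u w U W \<longleftrightarrow> (\<forall>\<epsilon>>0. \<exists>T. \<forall>t\<ge>T.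
     (\<forall>x\<in>{0..L}. \<bar>u x t - U x\<bar> < \<epsilon>) \<and> (\<forall>x\<in>{0..x2}. \<bar>w x t - W x\<bar> < \<epsilon>))"

end

context sandwich
begin

lemma hi_lo_cont:
  "continuous_on {0..L} (fst (hi n))" "continuous_on {0..x2} (snd (hi n))"
  "continuous_on {0..L} (fst (lo n))" "continuous_on {0..x2} (snd (lo n))"
  using hi_lo(1,2)[of n] by (auto simp: inbox_def)

lemma step_parab:
  assumes "inbox X"
  shows "parab d1 a1 0 L {x2} T (\<lambda>x t. fst (step X) x) (\<lambda>x t. F1 (fst X) (snd X) x - K * fst (step X) x)"
    "parab d2 a2 (a2 / d2) x2 {} T (\<lambda>x t. snd (step X) x) (\<lambda>x t. F2 (fst X) (snd X) x - K * snd (step X) x)"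
proof -
  have c: "continuous_on {0..L} (fst X)" "continuous_on {0..x2} (snd X)" using assms by (auto simp: inbox_def)
  show "parab d1 a1 0 L {x2} T (\<lambda>x t. fst (step X) x) (\<lambda>x t. F1 (fst X) (snd X) x - K * fst (step X) x)"
    unfolding step_def fst_conv by (rule bvp_parab[OF G1.green_bvp[OF F1_bint[OF c] _ F1_isCont[OF c]]]) auto
  show "parab d2 a2 (a2 / d2) x2 {} T (\<lambda>x t. snd (step X) x) (\<lambda>x t. F2 (fst X) (snd X) x - K * snd (step X) x)"
    unfolding step_def snd_conv by (rule bvp_parab[OF G2.green_bvp[OF F2_bint[OF c] _ F2_isCont[OF c]]]) auto
qed

context
  fixes T0 :: real and u w :: "real \<Rightarrow> real \<Rightarrow> real"
  assumes sol: "psol T0 u w"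
    and bu: "\<And>x t. x \<in> {0..L} \<Longrightarrow> T0 \<le> t \<Longrightarrow> ul x \<le> u x t \<and> u x t \<le> uu x"
    and bw: "\<And>x t. x \<in> {0..x2} \<Longrightarrow> T0 \<le> t \<Longrightarrow> wl x \<le> w x t \<and> w x t \<le> wu x"
begin

lemma box_sol_u: "x \<in> {0..L} \<Longrightarrow> T0 \<le> t \<Longrightarrow> 0 \<le> u x t \<and> u x t \<le> Ub"
  using bu[of x t] box_u[of x] by linarith

lemma box_sol_w: "x \<in> {0..x2} \<Longrightarrow> T0 \<le> t \<Longrightarrow> 0 \<le> w x t \<and> w x t \<le> Wb"
  using bw[of x t] box_w[of x] by linarith

lemma u_parab: "parab d1 a1 0 L {x2} T0 u (\<lambda>x t. u x t * (r - u x t - m * chi x2 x * w x t))"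
  and w_parab: "parab d2 a2 (a2 / d2) x2 {} T0 w (\<lambda>x t. h - q * w x t - p * u x t * w x t)"
  using sol by (auto simp: psol_def)

lemma iterate_bounds:
  assumes "e > 0"
  shows "\<exists>T\<ge>T0. \<forall>t\<ge>T. (\<forall>x\<in>{0..L}. fst (lo n) x - e \<le> u x t \<and> u x t \<le> fst (hi n) x + e) \<and>
    (\<forall>x\<in>{0..x2}. snd (hi n) x - e \<le> w x t \<and> w x t \<le> snd (lo n) x + e)"
  using assms
proof (induction n arbitrary: e)
  case 0
  thus ?case using bu bw by (intro exI[of _ T0]) (fastforce simp: hi_def lo_def)
next
  case (Suc n)
  define A where "A = (K + r + m * Ub) + (K + p * Wb)"
  have A1: "0 < K + r + m * Ub" "0 < K + p * Wb" using bounds ppos by (simp_all add: add_pos_nonneg)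
  have A: "A > 0" "K + r + m * Ub \<le> A" "K + p * Wb \<le> A" using A1 by (auto simp: A_def)
  have near: "\<exists>T\<ge>T0. \<forall>t\<ge>T. (\<forall>x\<in>{0..L}. fst (lo n) x - c / A \<le> u x t \<and> u x t \<le> fst (hi n) x + c / A) \<and>
    (\<forall>x\<in>{0..x2}. snd (hi n) x - c / A \<le> w x t \<and> w x t \<le> snd (lo n) x + c / A)" if "c > 0" for c
    using Suc.IH[of "c / A"] that A by simp
  have cA: "(K + r + m * Ub) * (c / A) \<le> c" "(K + p * Wb) * (c / A) \<le> c" "0 \<le> c / A" if "c > 0" for c
    using mult_right_mono[OF A(2), of "c / A"] mult_right_mono[OF A(3), of "c / A"] A(1) that by auto
  have 1: "\<exists>T\<ge>T0. \<forall>t\<ge>T. \<forall>x\<in>{0..L}. u x t - fst (step (hi n)) x \<le> e"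
  proof (rule parab_limsup_nonpos[OF parab_diff[OF u_parab step_parab(1)[OF hi_lo(1)]] u_conds bounds(3) _ Suc.prems])
    fix c :: real assume c: "c > 0"
    from near[OF c] obtain T where T: "T \<ge> T0" "\<And>t x. t \<ge> T \<Longrightarrow> x \<in> {0..L} \<Longrightarrow> u x t \<le> fst (hi n) x + c / A"
      "\<And>t x. t \<ge> T \<Longrightarrow> x \<in> {0..x2} \<Longrightarrow> snd (hi n) x - c / A \<le> w x t" by blast
    have "u x t * (r - u x t - m * chi x2 x * w x t) - (F1 (fst (hi n)) (snd (hi n)) x - K * fst (step (hi n)) x)
      \<le> - K * (u x t - fst (step (hi n)) x) + c" if t: "t > T" and x: "x \<in> {0<..<L} - {x2}" for t x
    proof -
      have "u x t * (K + r - u x t - m * chi x2 x * w x t) \<le> F1 (fst (hi n)) (snd (hi n)) x + (K + r + m * Ub) * (c / A)"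
        by (rule F1_mono_approx(1)[OF hi_lo(1)])
           (use x t T(1) T(2)[of t x] T(3)[of t x] box_sol_u[of x t] box_sol_w[of x t] cA[OF c] in auto)
      thus ?thesis using cA(1)[OF c] by (simp add: algebra_simps)
    qed
    thus "\<exists>T\<ge>T0. \<forall>t>T. \<forall>x\<in>{0<..<L} - {x2}. 0 < u x t - fst (step (hi n)) x \<longrightarrow>
       u x t * (r - u x t - m * chi x2 x * w x t) - (F1 (fst (hi n)) (snd (hi n)) x - K * fst (step (hi n)) x)
      \<le> - K * (u x t - fst (step (hi n)) x) + c" using T(1) by blast
  qed
  have 2: "\<exists>T\<ge>T0. \<forall>t\<ge>T. \<forall>x\<in>{0..L}. fst (step (lo n)) x - u x t \<le> e"
  proof (rule parab_limsup_nonpos[OF parab_diff[OF step_parab(1)[OF hi_lo(2)] u_parab] u_conds bounds(3) _ Suc.prems])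
    fix c :: real assume c: "c > 0"
    from near[OF c] obtain T where T: "T \<ge> T0" "\<And>t x. t \<ge> T \<Longrightarrow> x \<in> {0..L} \<Longrightarrow> fst (lo n) x - c / A \<le> u x t"
      "\<And>t x. t \<ge> T \<Longrightarrow> x \<in> {0..x2} \<Longrightarrow> w x t \<le> snd (lo n) x + c / A" by blast
    have "F1 (fst (lo n)) (snd (lo n)) x - K * fst (step (lo n)) x - u x t * (r - u x t - m * chi x2 x * w x t)
      \<le> - K * (fst (step (lo n)) x - u x t) + c" if t: "t > T" and x: "x \<in> {0<..<L} - {x2}" for t x
    proof -
      have "F1 (fst (lo n)) (snd (lo n)) x \<le> u x t * (K + r - u x t - m * chi x2 x * w x t) + (K + r + m * Ub) * (c / A)"
        by (rule F1_mono_approx(2)[OF hi_lo(2)])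
           (use x t T(1) T(2)[of t x] T(3)[of t x] box_sol_u[of x t] box_sol_w[of x t] cA[OF c] in auto)
      thus ?thesis using cA(1)[OF c] by (simp add: algebra_simps)
    qed
    thus "\<exists>T\<ge>T0. \<forall>t>T. \<forall>x\<in>{0<..<L} - {x2}. 0 < fst (step (lo n)) x - u x t \<longrightarrow>
       F1 (fst (lo n)) (snd (lo n)) x - K * fst (step (lo n)) x - u x t * (r - u x t - m * chi x2 x * w x t)
      \<le> - K * (fst (step (lo n)) x - u x t) + c" using T(1) by blast
  qed
  have 3: "\<exists>T\<ge>T0. \<forall>t\<ge>T. \<forall>x\<in>{0..x2}. w x t - snd (step (lo n)) x \<le> e"
  proof (rule parab_limsup_nonpos[OF parab_diff[OF w_parab step_parab(2)[OF hi_lo(2)]] w_conds bounds(3) _ Suc.prems])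
    fix c :: real assume c: "c > 0"
    from near[OF c] obtain T where T: "T \<ge> T0" "\<And>t x. t \<ge> T \<Longrightarrow> x \<in> {0..L} \<Longrightarrow> fst (lo n) x - c / A \<le> u x t"
      "\<And>t x. t \<ge> T \<Longrightarrow> x \<in> {0..x2} \<Longrightarrow> w x t \<le> snd (lo n) x + c / A" by blast
    have "h - q * w x t - p * u x t * w x t - (F2 (fst (lo n)) (snd (lo n)) x - K * snd (step (lo n)) x)
      \<le> - K * (w x t - snd (step (lo n)) x) + c" if t: "t > T" and x: "x \<in> {0<..<x2} - {}" for t x
    proof -
      have "h + (K - q - p * u x t) * w x t \<le> F2 (fst (lo n)) (snd (lo n)) x + (K + p * Wb) * (c / A)"
        by (rule F2_mono_approx(1)[OF hi_lo(2)])
           (use x t T(1) T(2)[of t x] T(3)[of t x] box_sol_u[of x t] box_sol_w[of x t] cA[OF c] ppos in auto)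
      thus ?thesis using cA(2)[OF c] by (simp add: algebra_simps)
    qed
    thus "\<exists>T\<ge>T0. \<forall>t>T. \<forall>x\<in>{0<..<x2} - {}. 0 < w x t - snd (step (lo n)) x \<longrightarrow>
       h - q * w x t - p * u x t * w x t - (F2 (fst (lo n)) (snd (lo n)) x - K * snd (step (lo n)) x)
      \<le> - K * (w x t - snd (step (lo n)) x) + c" using T(1) by blast
  qed
  have 4: "\<exists>T\<ge>T0. \<forall>t\<ge>T. \<forall>x\<in>{0..x2}. snd (step (hi n)) x - w x t \<le> e"
  proof (rule parab_limsup_nonpos[OF parab_diff[OF step_parab(2)[OF hi_lo(1)] w_parab] w_conds bounds(3) _ Suc.prems])
    fix c :: real assume c: "c > 0"
    from near[OF c] obtain T where T: "T \<ge> T0" "\<And>t x. t \<ge> T \<Longrightarrow> x \<in> {0..L} \<Longrightarrow> u x t \<le> fst (hi n) x + c / A"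
      "\<And>t x. t \<ge> T \<Longrightarrow> x \<in> {0..x2} \<Longrightarrow> snd (hi n) x - c / A \<le> w x t" by blast
    have "F2 (fst (hi n)) (snd (hi n)) x - K * snd (step (hi n)) x - (h - q * w x t - p * u x t * w x t)
      \<le> - K * (snd (step (hi n)) x - w x t) + c" if t: "t > T" and x: "x \<in> {0<..<x2} - {}" for t x
    proof -
      have "F2 (fst (hi n)) (snd (hi n)) x \<le> h + (K - q - p * u x t) * w x t + (K + p * Wb) * (c / A)"
        by (rule F2_mono_approx(2)[OF hi_lo(1)])
           (use x t T(1) T(2)[of t x] T(3)[of t x] box_sol_u[of x t] box_sol_w[of x t] cA[OF c] ppos in auto)
      thus ?thesis using cA(2)[OF c] by (simp add: algebra_simps)
    qed
    thus "\<exists>T\<ge>T0. \<forall>t>T. \<forall>x\<in>{0<..<x2} - {}. 0 < snd (step (hi n)) x - w x t \<longrightarrow>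
       F2 (fst (hi n)) (snd (hi n)) x - K * snd (step (hi n)) x - (h - q * w x t - p * u x t * w x t)
      \<le> - K * (snd (step (hi n)) x - w x t) + c" using T(1) by blast
  qed
  from 1 obtain T1 where T1: "T1 \<ge> T0" "\<And>t x. t \<ge> T1 \<Longrightarrow> x \<in> {0..L} \<Longrightarrow> u x t - fst (step (hi n)) x \<le> e" by blast
  from 2 obtain T2 where T2: "\<And>t x. t \<ge> T2 \<Longrightarrow> x \<in> {0..L} \<Longrightarrow> fst (step (lo n)) x - u x t \<le> e" by blast
  from 3 obtain T3 where T3: "\<And>t x. t \<ge> T3 \<Longrightarrow> x \<in> {0..x2} \<Longrightarrow> w x t - snd (step (lo n)) x \<le> e" by blast
  from 4 obtain T4 where T4: "\<And>t x. t \<ge> T4 \<Longrightarrow> x \<in> {0..x2} \<Longrightarrow> snd (step (hi n)) x - w x t \<le> e" by blast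
  show ?case unfolding hi_lo_Suc
  proof (intro exI[of _ "max (max T1 T2) (max T3 T4)"] conjI allI impI ballI)
    fix t x assume t: "max (max T1 T2) (max T3 T4) \<le> t"
    { assume x: "x \<in> {0..L}"
      show "fst (step (lo n)) x - e \<le> u x t" using T2[of t x] t x by simp
      show "u x t \<le> fst (step (hi n)) x + e" using T1(2)[of t x] t x by simp }
    { assume x: "x \<in> {0..x2}"
      show "snd (step (hi n)) x - e \<le> w x t" using T4[of t x] t x by simp
      show "w x t \<le> snd (step (lo n)) x + e" using T3[of t x] t x by simp }
  qed (use T1(1) in auto)
qed

lemma sol_converges:
  assumes st: "steady U Ux W Wx"
    and lim: "\<And>x. x \<in> {0..L} \<Longrightarrow> (\<lambda>n. fst (hi n) x) \<longlonglongrightarrow> U x" "\<And>x. x \<in> {0..x2} \<Longrightarrow> (\<lambda>n. snd (hi n) x) \<longlonglongrightarrow> W x"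
    "\<And>x. x \<in> {0..L} \<Longrightarrow> (\<lambda>n. fst (lo n) x) \<longlonglongrightarrow> U x" "\<And>x. x \<in> {0..x2} \<Longrightarrow> (\<lambda>n. snd (lo n) x) \<longlonglongrightarrow> W x"
  shows "converges_to u w U W"
  unfolding converges_to_def
proof (intro allI impI)
  fix e :: real assume e: "e > 0"
  have cU: "continuous_on {0..L} U" and cW: "continuous_on {0..x2} W"
    using st unfolding steady_def by (meson bvp_cont)+
  have e3: "e / 3 > 0" using e by simp
  note o = hi_lo(3,4)[unfolded ord_def]
  obtain N1 where N1: "\<And>n x. N1 \<le> n \<Longrightarrow> x \<in> {0..L} \<Longrightarrow> fst (hi n) x \<le> U x + e / 3"
    using Dini_decreasing[OF hi_lo_cont(1) cU _ lim(1) e3] o by blast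
  obtain N2 where N2: "\<And>n x. N2 \<le> n \<Longrightarrow> x \<in> {0..x2} \<Longrightarrow> snd (lo n) x \<le> W x + e / 3"
    using Dini_decreasing[OF hi_lo_cont(4) cW _ lim(4) e3] o by blast
  obtain N3 where N3: "\<And>n x. N3 \<le> n \<Longrightarrow> x \<in> {0..L} \<Longrightarrow> - fst (lo n) x \<le> - U x + e / 3"
    using Dini_decreasing[OF continuous_on_minus[OF hi_lo_cont(3)] continuous_on_minus[OF cU] _ tendsto_minus[OF lim(3)] e3] o by auto
  obtain N4 where N4: "\<And>n x. N4 \<le> n \<Longrightarrow> x \<in> {0..x2} \<Longrightarrow> - snd (hi n) x \<le> - W x + e / 3"
    using Dini_decreasing[OF continuous_on_minus[OF hi_lo_cont(2)] continuous_on_minus[OF cW] _ tendsto_minus[OF lim(2)] e3] o by auto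
  define n where "n = max (max N1 N2) (max N3 N4)"
  have n: "N1 \<le> n" "N2 \<le> n" "N3 \<le> n" "N4 \<le> n" by (auto simp: n_def)
  obtain T where T: "\<And>t x. t \<ge> T \<Longrightarrow> x \<in> {0..L} \<Longrightarrow> fst (lo n) x - e / 3 \<le> u x t \<and> u x t \<le> fst (hi n) x + e / 3"
    "\<And>t x. t \<ge> T \<Longrightarrow> x \<in> {0..x2} \<Longrightarrow> snd (hi n) x - e / 3 \<le> w x t \<and> w x t \<le> snd (lo n) x + e / 3"
    using iterate_bounds[OF e3, of n] by blast
  show "\<exists>T. \<forall>t\<ge>T. (\<forall>x\<in>{0..L}. \<bar>u x t - U x\<bar> < e) \<and> (\<forall>x\<in>{0..x2}. \<bar>w x t - W x\<bar> < e)"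
  proof (intro exI[of _ T] allI impI conjI ballI)
    fix t x assume t: "T \<le> t"
    show "\<bar>u x t - U x\<bar> < e" if x: "x \<in> {0..L}"
      using T(1)[OF t x] N1[OF n(1) x] N3[OF n(3) x] e unfolding abs_less_iff by linarith
    show "\<bar>w x t - W x\<bar> < e" if x: "x \<in> {0..x2}"
      using T(2)[OF t x] N2[OF n(2) x] N4[OF n(4) x] e unfolding abs_less_iff by linarith
  qed
qed

end

end

lemma parab_bounded:
  assumes "parab d a b R S T z f"
  obtains N where "0 < N" "\<And>x t. x \<in> {0..R} \<Longrightarrow> t \<in> {T..T1} \<Longrightarrow> \<bar>z x t\<bar> \<le> N"
proof -
  have "compact ((\<lambda>(x, t). z x t) ` ({0..R} \<times> {T..T1}))"
    by (intro compact_continuous_image continuous_on_subset[OF parab_cont[OF assms]] compact_Times) auto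
  then obtain N where N: "\<And>y. y \<in> (\<lambda>(x, t). z x t) ` ({0..R} \<times> {T..T1}) \<Longrightarrow> norm y \<le> N"
    using compact_imp_bounded bounded_iff by metis
  have "\<bar>z x t\<bar> \<le> \<bar>N\<bar> + 1" if "x \<in> {0..R}" "t \<in> {T..T1}" for x t
    using N[of "z x t"] that by force
  thus ?thesis by (rule that[of "\<bar>N\<bar> + 1", rotated]) auto
qed

lemma DERIV_pos_part:
  fixes y :: real
  shows "((\<lambda>y. (max 0 y)\<^sup>2) has_real_derivative 2 * max 0 y) (at y)"
    "0 < y \<Longrightarrow> ((\<lambda>y. max 0 y) has_real_derivative 1) (at y)"
proof -
  show 1: "((\<lambda>y. max 0 y) has_real_derivative 1) (at y)" if "0 < y"
    by (rule has_field_derivative_transform_within_open[of "\<lambda>y. y" _ _ "{0<..}"]) (use that in auto)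
  consider "y > 0" | "y < 0" | "y = 0" by linarith
  thus "((\<lambda>y. (max 0 y)\<^sup>2) has_real_derivative 2 * max 0 y) (at y)"
  proof cases
    case 1
    have "((\<lambda>y. y\<^sup>2) has_real_derivative 2 * y) (at y)" by (auto intro!: derivative_eq_intros)
    hence "((\<lambda>y. (max 0 y)\<^sup>2) has_real_derivative 2 * y) (at y)"
      by (rule has_field_derivative_transform_within_open[of _ _ _ "{0<..}"]) (use 1 in auto)
    thus ?thesis using 1 by simp
  next
    case 2
    have "((\<lambda>y. (max 0 y)\<^sup>2) has_real_derivative 0) (at y)"
      by (rule has_field_derivative_transform_within_open[of "\<lambda>_. 0" _ _ "{..<0}"]) (use 2 in auto)
    thus ?thesis using 2 by simp
  next
    case 3
    have "((\<lambda>h::real. (max 0 h)\<^sup>2 / h) \<longlongrightarrow> 0) (at 0)"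
    proof (rule tendsto_0_le[where K=1])
      show "((\<lambda>h::real. h) \<longlongrightarrow> 0) (at 0)" by (rule tendsto_ident_at)
      show "eventually (\<lambda>h::real. norm ((max 0 h)\<^sup>2 / h) \<le> norm h * 1) (at 0)"
        by (rule always_eventually) (auto simp: max_def power2_eq_square)
    qed
    thus ?thesis using 3 by (simp add: DERIV_def)
  qed
qed

context model
begin

lemma psol_nonneg:
  assumes sol: "psol 0 u w" and u0: "\<And>x. x \<in> {0..L} \<Longrightarrow> 0 \<le> u x 0" and w0: "\<And>x. x \<in> {0..x2} \<Longrightarrow> 0 \<le> w x 0"
    and t: "0 \<le> t"
  shows "x \<in> {0..L} \<Longrightarrow> 0 \<le> u x t" "x \<in> {0..x2} \<Longrightarrow> 0 \<le> w x t"
proof -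
  note pu = sol[unfolded psol_def, THEN conjunct1] and pw = sol[unfolded psol_def, THEN conjunct2]
  obtain N where N: "0 < N" "\<And>x s. x \<in> {0..L} \<Longrightarrow> s \<in> {0..t} \<Longrightarrow> \<bar>u x s\<bar> \<le> N" using parab_bounded[OF pu] by blast
  obtain M where M: "0 < M" "\<And>x s. x \<in> {0..x2} \<Longrightarrow> s \<in> {0..t} \<Longrightarrow> \<bar>w x s\<bar> \<le> M" using parab_bounded[OF pw] by blast
  have "- u x t \<le> 0" if x: "x \<in> {0..L}" for x
  proof (rule parab_nonpos[OF parab_minus[OF pu] u_conds, of t "r + N + m * M"])
    fix y s assume s: "0 < s" "s \<le> t" and y: "y \<in> {0<..<L} - {x2}" and up: "0 < - u y s"
    have "\<bar>chi x2 y * w y s\<bar> \<le> M" using M(2)[of y s] M(1) y s by (auto simp: chi_def)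
    hence "m * \<bar>chi x2 y * w y s\<bar> \<le> m * M" using ppos by simp
    hence "\<bar>m * (chi x2 y * w y s)\<bar> \<le> m * M" using ppos by (simp add: abs_mult)
    hence "r - u y s - m * chi x2 y * w y s \<le> r + N + m * M"
      using N(2)[of y s] y s by (simp add: mult.assoc)
    hence "(- u y s) * (r - u y s - m * chi x2 y * w y s) \<le> (- u y s) * (r + N + m * M)"
      using up by (intro mult_left_mono) auto
    thus "- (u y s * (r - u y s - m * chi x2 y * w y s)) \<le> (r + N + m * M) * - u y s" by (simp add: mult.commute)
  qed (use u0 x t in auto)
  thus "x \<in> {0..L} \<Longrightarrow> 0 \<le> u x t" by simp
  have "- w x t \<le> 0" if x: "x \<in> {0..x2}" for x
  proof (rule parab_nonpos[OF parab_minus[OF pw] w_conds, of t "p * N"])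
    fix y s assume s: "0 < s" "s \<le> t" and y: "y \<in> {0<..<x2} - {}" and wp: "0 < - w y s"
    have "p * (- u y s) \<le> p * N" using N(2)[of y s] y s ppos by (intro mult_left_mono) auto
    hence "p * (- u y s) * (- w y s) \<le> p * N * (- w y s)" using wp by (intro mult_right_mono) auto
    moreover have "q * w y s \<le> 0" using wp ppos by (simp add: mult_le_0_iff)
    ultimately show "- (h - q * w y s - p * u y s * w y s) \<le> p * N * - w y s" using ppos(7) by simp
  qed (use w0 x t in auto)
  thus "x \<in> {0..x2} \<Longrightarrow> 0 \<le> w x t" by simp
qed

lemma psol_u_upper:
  assumes sol: "psol 0 u w" and u0: "\<And>x. x \<in> {0..L} \<Longrightarrow> 0 \<le> u x 0" and w0: "\<And>x. x \<in> {0..x2} \<Longrightarrow> 0 \<le> w x 0"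
    and C: "r \<le> C" "\<And>x. x \<in> {0..L} \<Longrightarrow> u x 0 \<le> C" and t: "0 \<le> t" and x: "x \<in> {0..L}"
  shows "u x t \<le> C * exp (a1 / d1 * x)"
proof -
  note pu = sol[unfolded psol_def, THEN conjunct1]
  have e1: "1 \<le> exp (a1 / d1 * y)" if "0 \<le> y" for y using that ppos by simp
  have Ce: "C \<le> C * exp (a1 / d1 * y)" if "0 \<le> y" for y
    using mult_left_mono[OF e1[OF that], of C] C(1) ppos by simp
  show ?thesis
  proof (rule parab_le_exp[OF pu u_conds, of t "\<lambda>_. C" "\<lambda>_. 0" 0])
    show "u y 0 \<le> C * exp (a1 / d1 * y)" if "y \<in> {0..L}" for y using C(2)[OF that] Ce[of y] that by simp
    fix y s assume s: "0 < s" and y: "y \<in> {0<..<L} - {x2}" and up: "C * exp (a1 / d1 * y) < u y s"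
    have "u y s > r" using up C(1) Ce[of y] y by simp
    moreover have "m * chi x2 y * w y s \<ge> 0"
      using psol_nonneg(2)[OF sol u0 w0, of s y] s y ppos by (auto simp: chi_def)
    ultimately have "u y s * (r - u y s - m * chi x2 y * w y s) \<le> 0" using ppos(3) by (intro mult_nonneg_nonpos) auto
    thus "u y s * (r - u y s - m * chi x2 y * w y s) \<le> 0 * exp (a1 / d1 * y) + 0 * (u y s - C * exp (a1 / d1 * y))" by simp
  qed (use x t C ppos in auto)
qed

lemma psol_w_upper:
  assumes sol: "psol 0 u w" and u0: "\<And>x. x \<in> {0..L} \<Longrightarrow> 0 \<le> u x 0" and w0: "\<And>x. x \<in> {0..x2} \<Longrightarrow> 0 \<le> w x 0"
    and k: "1 < k"
  obtains T where "0 < T" "\<And>x t. T \<le> t \<Longrightarrow> x \<in> {0..x2} \<Longrightarrow> w x t \<le> k * wb x"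
proof -
  note pw = sol[unfolded psol_def, THEN conjunct2]
  obtain wb' where b: "bvp d2 a2 (a2 / d2) x2 {} wb wb' (\<lambda>x. h - q * wb x)" by (rule wb_bvp)
  obtain e where e: "0 < e" "\<And>x. x \<in> {0..x2} \<Longrightarrow> e \<le> wb x"
    using positive_min_on_interval[OF wb_cont wb_pos] by blast
  have "\<exists>T\<ge>0. \<forall>t\<ge>T. \<forall>x\<in>{0..x2}. w x t - wb x \<le> (k - 1) * e"
  proof (rule parab_limsup_nonpos[OF parab_diff[OF pw bvp_parab[OF b]] w_conds ppos(6)])
    fix c :: real assume c: "c > 0"
    have "h - q * w x t - p * u x t * w x t - (h - q * wb x) \<le> - q * (w x t - wb x) + c"
      if "t > 0" "x \<in> {0<..<x2} - {}" for x t
    proof -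
      have "0 \<le> p * u x t * w x t"
        using psol_nonneg[OF sol u0 w0, of t x] that ppos by auto
      thus ?thesis using c by (simp add: algebra_simps)
    qed
    thus "\<exists>T\<ge>0. \<forall>t>T. \<forall>x\<in>{0<..<x2} - {}. 0 < w x t - wb x \<longrightarrow>
        h - q * w x t - p * u x t * w x t - (h - q * wb x) \<le> - q * (w x t - wb x) + c" by blast
  qed (use k e in auto)
  then obtain T where T: "T \<ge> 0" "\<And>t x. t \<ge> T \<Longrightarrow> x \<in> {0..x2} \<Longrightarrow> w x t - wb x \<le> (k - 1) * e" by blast
  show ?thesis
  proof (rule that[of "T + 1"])
    fix x t assume "T + 1 \<le> t" and x: "x \<in> {0..x2}"
    hence "w x t - wb x \<le> (k - 1) * e" using T(2) by simp
    also have "\<dots> \<le> (k - 1) * wb x" using e(2)[OF x] k by (intro mult_left_mono) auto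
    finally show "w x t \<le> k * wb x" by (simp add: algebra_simps)
  qed (use T in auto)
qed

text \<open>The barrier is \<open>\<eta> exp (- \<kappa> t) \<omega>(x) Q\<^sup>2\<close> on the set where
  \<open>Q = \<rho>\<^sup>2 + \<beta> t - (x - x0)\<^sup>2\<close> is positive, a set which spreads over \<open>[0, L]\<close> by time \<open>T\<close>; the
  weight \<open>\<omega>\<close> satisfies both boundary conditions.\<close>

lemma psol_u_pos:
  assumes sol: "psol 0 u w" and u0: "\<And>x. x \<in> {0..L} \<Longrightarrow> 0 \<le> u x 0" and w0: "\<And>x. x \<in> {0..x2} \<Longrightarrow> 0 \<le> w x 0"
    and x0: "x0 \<in> {0..L}" "u x0 0 \<noteq> 0" and T: "0 < T" and X: "X \<in> {0..L}"
  shows "0 < u X T"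
proof -
  note pu = sol[unfolded psol_def, THEN conjunct1] and pw = sol[unfolded psol_def, THEN conjunct2]
  obtain N where N: "0 < N" "\<And>x s. x \<in> {0..L} \<Longrightarrow> s \<in> {0..T} \<Longrightarrow> \<bar>u x s\<bar> \<le> N" using parab_bounded[OF pu] by blast
  obtain M where M: "0 < M" "\<And>x s. x \<in> {0..x2} \<Longrightarrow> s \<in> {0..T} \<Longrightarrow> \<bar>w x s\<bar> \<le> M" using parab_bounded[OF pw] by blast
  define C0 where "C0 = N + m * M"
  have C0: "C0 > 0" using N M ppos by (simp add: C0_def add_pos_nonneg)
  have gC0: "- C0 \<le> r - u x s - m * chi x2 x * w x s" if "x \<in> {0..L}" "s \<in> {0..T}" for x s
  proof -
    have "chi x2 x * w x s \<le> M" using M(2)[of x s] M(1) that by (auto simp: chi_def)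
    hence "m * (chi x2 x * w x s) \<le> m * M" using ppos by simp
    thus ?thesis using N(2)[OF that] ppos(3) unfolding C0_def mult.assoc by linarith
  qed
  define h0 where "h0 = u x0 0 / 2"
  have h0: "h0 > 0" using u0[OF x0(1)] x0(2) by (simp add: h0_def)
  obtain \<rho> where \<rho>: "\<rho> > 0" "\<And>x. x \<in> {0..L} \<Longrightarrow> \<bar>x - x0\<bar> < \<rho> \<Longrightarrow> h0 \<le> u x 0"
  proof -
    have "continuous_on {0..L} (\<lambda>x. u x 0)" by (rule parab_cont_space[OF pu order_refl])
    then obtain \<rho> where \<rho>: "\<rho> > 0" "\<And>x. x \<in> {0..L} \<Longrightarrow> dist x x0 < \<rho> \<Longrightarrow> dist (u x 0) (u x0 0) < h0"
      using x0(1) h0 unfolding continuous_on_iff by blast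
    show ?thesis
    proof (rule that[OF \<rho>(1)])
      fix x assume "x \<in> {0..L}" "\<bar>x - x0\<bar> < \<rho>"
      hence "\<bar>u x 0 - u x0 0\<bar> < h0" using \<rho>(2)[of x] by (simp add: dist_real_def)
      thus "h0 \<le> u x 0" unfolding h0_def abs_less_iff by linarith
    qed
  qed
  define \<beta> where "\<beta> = L\<^sup>2 / T"
  have \<beta>: "\<beta> \<ge> 0" "\<beta> * T = L\<^sup>2" using T by (auto simp: \<beta>_def)
  define al where "al = a1 / d1"
  have al: "d1 * al = a1" "al > 0" using ppos by (auto simp: al_def)
  define \<theta> where "\<theta> = (\<lambda>x. al * (1 - x / L))"
  define \<omega> where "\<omega> = (\<lambda>x. exp (al * (x - x\<^sup>2 / (2 * L))))"
  have D\<omega>: "(\<omega> has_real_derivative \<theta> x * \<omega> x) (at x within A)" for x A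
    unfolding \<omega>_def \<theta>_def using ppos(8) by (auto intro!: derivative_eq_intros simp: field_simps)
  have D\<theta>: "(\<theta> has_real_derivative - al / L) (at x within A)" for x A
    unfolding \<theta>_def using ppos(8) by (auto intro!: derivative_eq_intros simp: field_simps)
  have \<omega>pos: "\<omega> x > 0" for x by (simp add: \<omega>_def)
  have \<omega>le: "\<omega> x \<le> exp (al * L)" if "x \<in> {0..L}" for x
  proof -
    have "0 \<le> x\<^sup>2 / (2 * L)" using ppos(8) by simp
    hence "x - x\<^sup>2 / (2 * L) \<le> L" using that unfolding atLeastAtMost_iff by linarith
    thus ?thesis unfolding \<omega>_def using al by simp
  qed
  have \<theta>: "0 \<le> \<theta> x" "\<theta> x \<le> al" if "x \<in> {0..L}" for x
    using that al ppos(8) by (auto simp: \<theta>_def field_simps)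
  define C1 where "C1 = a1 * al + a1 / L"
  define Bq where "Bq = 12 * d1 + 4 * a1 * L + 2 * \<beta>"
  define \<kappa> where "\<kappa> = C0 + C1 + Bq\<^sup>2 / (32 * d1 * \<rho>\<^sup>2)"
  define \<eta> where "\<eta> = h0 / (exp (al * L) * \<rho>^4)"
  have \<eta>: "\<eta> > 0" using h0 \<rho> by (simp add: \<eta>_def)
  define c where "c = (\<lambda>t. \<eta> * exp (- \<kappa> * t))"
  have cpos: "c t > 0" for t using \<eta> by (simp add: c_def)
  define Q where "Q = (\<lambda>x t. \<rho>\<^sup>2 + \<beta> * t - (x - x0)\<^sup>2)"
  define P where "P = (\<lambda>x t. max 0 (Q x t))"
  have Pnn: "P x t \<ge> 0" for x t by (simp add: P_def)
  define s where "s = (\<lambda>x t. c t * (\<omega> x * (P x t)\<^sup>2))"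
  define sx where "sx = (\<lambda>t x. c t * (\<omega> x * (\<theta> x * (P x t)\<^sup>2 - 4 * P x t * (x - x0))))"
  have DQ: "((\<lambda>x. Q x t) has_real_derivative - 2 * (x - x0)) (at x within A)" for x t A
    unfolding Q_def by (auto intro!: derivative_eq_intros)
  have DP2: "((\<lambda>x. (P x t)\<^sup>2) has_real_derivative 2 * P x t * (- 2 * (x - x0))) (at x within A)" for x t A
    unfolding P_def using DERIV_chain2[OF DERIV_pos_part(1) DQ] .
  have Ds: "((\<lambda>x. s x t) has_real_derivative sx t x) (at x within A)" for x t A
    unfolding s_def sx_def
    by (rule DERIV_cong[OF DERIV_cmult[OF DERIV_mult'[OF D\<omega> DP2]]]) (simp add: algebra_simps)
  have DP: "((\<lambda>x. P x t) has_real_derivative 1 * (- 2 * (x - x0))) (at x)" if "Q x t > 0" for x t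
    unfolding P_def by (rule DERIV_chain2[OF DERIV_pos_part(2)[OF that] DQ])
  have Dsx: "(sx t has_real_derivative c t * (\<omega> x * ((\<theta> x ^ 2 - al / L) * (P x t)\<^sup>2
      - 8 * \<theta> x * P x t * (x - x0) + 8 * (x - x0)\<^sup>2 - 4 * P x t))) (at x)" if "Q x t > 0" for x t
  proof -
    have D1: "((\<lambda>x. 4 * P x t * (x - x0)) has_real_derivative 4 * P x t * 1 + 4 * (1 * (- 2 * (x - x0))) * (x - x0)) (at x)"
      by (intro DERIV_mult' DERIV_cmult DP that) (auto intro!: derivative_eq_intros)
    show ?thesis unfolding sx_def
      by (rule DERIV_cong[OF DERIV_cmult[OF DERIV_mult'[OF D\<omega> DERIV_diff[OF DERIV_mult'[OF D\<theta> DP2] D1]]]])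
         (simp add: algebra_simps power2_eq_square)
  qed
  have Dst: "((\<lambda>t. s x t) has_real_derivative c t * (\<omega> x * (2 * \<beta> * P x t - \<kappa> * (P x t)\<^sup>2))) (at t)" for x t
  proof -
    have Qt: "((\<lambda>t. Q x t) has_real_derivative \<beta>) (at t)" unfolding Q_def by (auto intro!: derivative_eq_intros)
    have Pt: "((\<lambda>t. (P x t)\<^sup>2) has_real_derivative 2 * P x t * \<beta>) (at t)"
      unfolding P_def using DERIV_chain2[OF DERIV_pos_part(1) Qt] .
    have ct: "(c has_real_derivative - \<kappa> * c t) (at t)" unfolding c_def by (auto intro!: derivative_eq_intros)
    show ?thesis unfolding s_def
      by (rule DERIV_cong[OF DERIV_mult'[OF ct DERIV_cmult[OF Pt]]]) (simp add: algebra_simps)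
  qed
  have key: "2 * \<beta> * P x t - \<kappa> * (P x t)\<^sup>2 \<le>
      d1 * ((\<theta> x ^ 2 - al / L) * (P x t)\<^sup>2 - 8 * \<theta> x * P x t * (x - x0) + 8 * (x - x0)\<^sup>2 - 4 * P x t)
      - a1 * (\<theta> x * (P x t)\<^sup>2 - 4 * P x t * (x - x0)) - C0 * (P x t)\<^sup>2"
    if x: "x \<in> {0..L}" and t: "0 \<le> t" and Qp: "Q x t > 0" for x t
  proof -
    define y where "y = P x t"
    define z where "z = x - x0"
    have y: "y > 0" "y = \<rho>\<^sup>2 + \<beta> * t - z\<^sup>2" using Qp by (auto simp: y_def P_def Q_def z_def)
    have z2: "z\<^sup>2 \<ge> \<rho>\<^sup>2 - y" using y(2) \<beta>(1) t by simp
    have zL: "\<bar>z\<bar> \<le> L" using x x0(1) by (auto simp: z_def)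
    have t1: "d1 * \<theta> x ^ 2 - a1 * \<theta> x \<ge> - (a1 * al)"
    proof -
      have "a1 * \<theta> x \<le> a1 * al" using \<theta>[OF x] ppos by simp
      moreover have "d1 * \<theta> x ^ 2 \<ge> 0" using ppos by simp
      ultimately show ?thesis by linarith
    qed
    have t2: "(4 * a1 - 8 * d1 * \<theta> x) * z * y \<ge> - (4 * a1 * L * y)"
    proof -
      have "0 \<le> d1 * \<theta> x" "d1 * \<theta> x \<le> d1 * al" using \<theta>[OF x] ppos by auto
      hence "\<bar>4 * a1 - 8 * d1 * \<theta> x\<bar> \<le> 4 * a1" unfolding abs_le_iff al(1) by auto
      hence "\<bar>4 * a1 - 8 * d1 * \<theta> x\<bar> * \<bar>z\<bar> \<le> 4 * a1 * L" using zL ppos by (intro mult_mono) auto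
      hence "\<bar>(4 * a1 - 8 * d1 * \<theta> x) * z\<bar> * y \<le> 4 * a1 * L * y" using y(1) by (intro mult_right_mono) (auto simp: abs_mult)
      moreover have "- \<bar>(4 * a1 - 8 * d1 * \<theta> x) * z\<bar> * y \<le> (4 * a1 - 8 * d1 * \<theta> x) * z * y"
        using y(1) by (intro mult_right_mono) auto
      ultimately show ?thesis by simp
    qed
    have t3: "8 * d1 * z\<^sup>2 \<ge> 8 * d1 * (\<rho>\<^sup>2 - y)" using z2 ppos by (intro mult_left_mono) auto
    have sq: "0 \<le> 8 * d1 * \<rho>\<^sup>2 - Bq * y + Bq\<^sup>2 / (32 * d1 * \<rho>\<^sup>2) * y\<^sup>2"
    proof -
      have nz: "d1 \<noteq> 0" "\<rho> \<noteq> 0" using ppos \<rho> by auto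
      have "8 * d1 * \<rho>\<^sup>2 - Bq * y + Bq\<^sup>2 / (32 * d1 * \<rho>\<^sup>2) * y\<^sup>2 = 8 * d1 * \<rho>\<^sup>2 * (1 - Bq * y / (16 * d1 * \<rho>\<^sup>2))\<^sup>2"
        using nz by (simp add: power2_diff power_divide power_mult_distrib divide_simps)
          (simp add: algebra_simps power2_eq_square power4_eq_xxxx)
      also have "\<dots> \<ge> 0" using ppos by simp
      finally show ?thesis .
    qed
    have t4: "(d1 * \<theta> x ^ 2 - a1 * \<theta> x) * y\<^sup>2 \<ge> - (a1 * al) * y\<^sup>2" using t1 by (intro mult_right_mono) auto
    have "d1 * ((\<theta> x ^ 2 - al / L) * y\<^sup>2 - 8 * \<theta> x * y * z + 8 * z\<^sup>2 - 4 * y) - a1 * (\<theta> x * y\<^sup>2 - 4 * y * z) - C0 * y\<^sup>2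
        = (d1 * \<theta> x ^ 2 - a1 * \<theta> x) * y\<^sup>2 - (d1 * al) / L * y\<^sup>2 + (4 * a1 - 8 * d1 * \<theta> x) * z * y + 8 * d1 * z\<^sup>2 - 4 * d1 * y - C0 * y\<^sup>2"
      by (simp add: algebra_simps)
    also have "\<dots> \<ge> - (a1 * al) * y\<^sup>2 - a1 / L * y\<^sup>2 - 4 * a1 * L * y + 8 * d1 * (\<rho>\<^sup>2 - y) - 4 * d1 * y - C0 * y\<^sup>2"
      unfolding al(1) using t4 t2 t3 by linarith
    also have "- (a1 * al) * y\<^sup>2 - a1 / L * y\<^sup>2 - 4 * a1 * L * y + 8 * d1 * (\<rho>\<^sup>2 - y) - 4 * d1 * y - C0 * y\<^sup>2
        = 2 * \<beta> * y - \<kappa> * y\<^sup>2 + (8 * d1 * \<rho>\<^sup>2 - Bq * y + Bq\<^sup>2 / (32 * d1 * \<rho>\<^sup>2) * y\<^sup>2)"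
      by (simp add: \<kappa>_def C1_def Bq_def algebra_simps)
    finally show ?thesis using sq unfolding y_def z_def by linarith
  qed
  define v where "v = (\<lambda>x t. s x t - u x t)"
  have "v X T \<le> 0"
  proof (rule parabolic_max_principle[OF ppos(8,1) less_imp_le[OF ppos(9)], of "{x2}" 0 T v "- C0"])
    have "continuous_on ({0..L} \<times> {0..T}) (\<lambda>p. u (fst p) (snd p))"
      using parab_cont[OF pu] unfolding case_prod_unfold by (rule continuous_on_subset) auto
    moreover have "continuous_on ({0..L} \<times> {0..T}) (\<lambda>p. s (fst p) (snd p))"
      unfolding s_def c_def \<omega>_def P_def Q_def using ppos(8) by (intro continuous_intros) auto
    ultimately show "continuous_on ({0..L} \<times> {0..T}) (\<lambda>(x, t). v x t)"
      unfolding v_def case_prod_unfold by (intro continuous_intros)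
    show "v x 0 \<le> 0" if x: "x \<in> {0..L}" for x
    proof (cases "Q x 0 > 0")
      case True
      hence "(x - x0)\<^sup>2 < \<rho>\<^sup>2" by (simp add: Q_def)
      hence "\<bar>x - x0\<bar> < \<rho>" using \<rho>(1) power2_less_imp_less[of "\<bar>x - x0\<bar>" \<rho>] by simp
      hence "h0 \<le> u x 0" using \<rho>(2) x by blast
      moreover have "s x 0 \<le> h0"
      proof -
        have "P x 0 \<le> \<rho>\<^sup>2" using True by (simp add: P_def Q_def)
        hence "(P x 0)\<^sup>2 \<le> (\<rho>\<^sup>2)\<^sup>2" using Pnn by (intro power_mono) auto
        hence "\<omega> x * (P x 0)\<^sup>2 \<le> exp (al * L) * \<rho>^4"
          using \<omega>le[OF x] \<omega>pos[of x] by (intro mult_mono) (auto simp flip: power_mult)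
        hence "\<eta> * (\<omega> x * (P x 0)\<^sup>2) \<le> \<eta> * (exp (al * L) * \<rho>^4)" using \<eta> by simp
        also have "\<dots> = h0" using \<rho> by (simp add: \<eta>_def)
        finally show ?thesis by (simp add: s_def c_def)
      qed
      ultimately show ?thesis by (simp add: v_def)
    next
      case False
      thus ?thesis using u0[OF x] by (simp add: v_def s_def P_def)
    qed
    fix t assume t: "0 < t" "t \<le> T"
    have unn: "u x t \<ge> 0" if "x \<in> {0..L}" for x using psol_nonneg(1)[OF sol u0 w0] t that by auto
    from parabD[OF pu t(1)] obtain ux where ux:
      "\<And>x. x \<in> {0..L} \<Longrightarrow> ((\<lambda>y. u y t) has_real_derivative ux x) (at x within {0..L})"
      "\<And>x. x \<in> {0<..<L} - {x2} \<Longrightarrow> \<exists>uxx ut. (ux has_real_derivative uxx) (at x) \<and>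
         ((\<lambda>s. u x s) has_real_derivative ut) (at t) \<and> ut = d1 * uxx - a1 * ux x + u x t * (r - u x t - m * chi x2 x * w x t)"
      "d1 * ux 0 = a1 * u 0 t" "ux L = 0 * u L t" by blast
    define vx where "vx = (\<lambda>x. sx t x - ux x)"
    have 1: "((\<lambda>y. v y t) has_real_derivative vx x) (at x within {0..L})" if "x \<in> {0..L}" for x
      unfolding v_def vx_def by (intro DERIV_diff Ds ux that)
    have left: "a1 * v 0 t \<le> d1 * vx 0"
    proof -
      have "d1 * sx t 0 = c t * (\<omega> 0 * (d1 * al * (P 0 t)\<^sup>2 + 4 * d1 * P 0 t * x0))"
        by (simp add: sx_def \<theta>_def algebra_simps)
      also have "\<dots> = a1 * s 0 t + c t * (\<omega> 0 * (4 * d1 * P 0 t * x0))" unfolding al(1) by (simp add: s_def algebra_simps)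
      also have "\<dots> \<ge> a1 * s 0 t"
        using cpos[of t] \<omega>pos[of 0] ppos Pnn[of 0 t] x0 by simp
      finally show ?thesis using ux(3) by (simp add: v_def vx_def algebra_simps)
    qed
    have right: "d1 * vx L \<le> a1 * v L t" if "v L t > 0"
    proof -
      have "sx t L = - (c t * (\<omega> L * (4 * P L t * (L - x0))))" using ppos(8) by (simp add: sx_def \<theta>_def algebra_simps)
      hence "sx t L \<le> 0" using cpos[of t] \<omega>pos[of L] Pnn[of L t] x0 by simp
      hence "d1 * vx L \<le> 0" using ux(4) ppos by (simp add: vx_def mult_le_0_iff)
      also have "0 \<le> a1 * v L t" using that ppos by simp
      finally show ?thesis .
    qed
    have int: "\<exists>vxx vt. (vx has_real_derivative vxx) (at x) \<and> ((\<lambda>s. v x s) has_real_derivative vt) (at t) \<and>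
           vt \<le> d1 * vxx - a1 * vx x + - C0 * v x t" if x: "x \<in> {0<..<L} - {x2}" and vp: "v x t > 0" for x
    proof -
      have xL: "x \<in> {0..L}" using x by simp
      have "s x t > 0" using vp unn[OF xL] by (simp add: v_def)
      hence "P x t \<noteq> 0" by (auto simp: s_def)
      hence Qp: "Q x t > 0" by (auto simp: P_def max_def split: if_splits)
      obtain uxx ut where u2: "(ux has_real_derivative uxx) (at x)" "((\<lambda>s. u x s) has_real_derivative ut) (at t)"
        "ut = d1 * uxx - a1 * ux x + u x t * (r - u x t - m * chi x2 x * w x t)" using ux(2)[OF x] by blast
      define S where "S = (\<theta> x ^ 2 - al / L) * (P x t)\<^sup>2 - 8 * \<theta> x * P x t * (x - x0) + 8 * (x - x0)\<^sup>2 - 4 * P x t"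
      define St where "St = 2 * \<beta> * P x t - \<kappa> * (P x t)\<^sup>2"
      have D2: "(vx has_real_derivative c t * (\<omega> x * S) - uxx) (at x)"
        unfolding vx_def S_def by (intro DERIV_diff Dsx[OF Qp] u2)
      have D3: "((\<lambda>s. v x s) has_real_derivative c t * (\<omega> x * St) - ut) (at t)"
        unfolding v_def St_def by (intro DERIV_diff Dst u2)
      have "c t * (\<omega> x * St) \<le> c t * (\<omega> x * (d1 * S - a1 * (\<theta> x * (P x t)\<^sup>2 - 4 * P x t * (x - x0)) - C0 * (P x t)\<^sup>2))"
        using key[OF xL _ Qp] t cpos[of t] \<omega>pos[of x] unfolding S_def St_def by (intro mult_left_mono) auto
      also have "\<dots> = d1 * (c t * (\<omega> x * S)) - a1 * sx t x - C0 * s x t" by (simp add: sx_def s_def algebra_simps)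
      finally have k1: "c t * (\<omega> x * St) \<le> d1 * (c t * (\<omega> x * S)) - a1 * sx t x - C0 * s x t" .
      have "u x t * (- C0) \<le> u x t * (r - u x t - m * chi x2 x * w x t)"
        using gC0[OF xL, of t] unn[OF xL] t by (intro mult_left_mono) auto
      hence "c t * (\<omega> x * St) - ut \<le> d1 * (c t * (\<omega> x * S) - uxx) - a1 * vx x + - C0 * v x t"
        using k1 unfolding u2(3) vx_def v_def by (simp add: algebra_simps)
      thus ?thesis using D2 D3 by blast
    qed
    show "\<exists>vx. (\<forall>x\<in>{0..L}. ((\<lambda>y. v y t) has_real_derivative vx x) (at x within {0..L})) \<and>
        (v 0 t > 0 \<longrightarrow> a1 * v 0 t \<le> d1 * vx 0) \<and> (v L t > 0 \<longrightarrow> d1 * vx L \<le> a1 * v L t) \<and>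
        (\<forall>x\<in>{0<..<L} - {x2}. v x t > 0 \<longrightarrow> (\<exists>vxx vt. (vx has_real_derivative vxx) (at x) \<and>
           ((\<lambda>s. v x s) has_real_derivative vt) (at t) \<and> vt \<le> d1 * vxx - a1 * vx x + - C0 * v x t))"
      using 1 left right int by (intro exI[of _ vx]) blast
  qed (use X T in auto)
  moreover have "s X T > 0"
  proof -
    have "\<bar>X - x0\<bar> \<le> L" using X x0(1) by auto
    hence "\<bar>X - x0\<bar>\<^sup>2 \<le> L\<^sup>2" by (intro power_mono) auto
    moreover have "\<rho>\<^sup>2 > 0" using \<rho>(1) by simp
    ultimately have "Q X T > 0" unfolding Q_def \<beta>(2) power2_abs by linarith
    thus ?thesis using cpos \<omega>pos by (simp add: s_def P_def)
  qed
  ultimately show ?thesis by (simp add: v_def)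
qed

end

section \<open>Attraction and uniqueness\<close>

context model
begin

lemma steady_psol:
  assumes "steady U Ux W Wx"
  shows "psol 0 (\<lambda>x t. U x) (\<lambda>x t. W x)"
  using assms unfolding steady_def psol_def by (auto intro: bvp_parab)

lemma converges_const:
  assumes "converges_to (\<lambda>x t. U x) (\<lambda>x t. W x) V Z"
  shows "\<forall>x\<in>{0..L}. U x = V x" "\<forall>x\<in>{0..x2}. W x = Z x"
proof -
  have "\<bar>U x - V x\<bar> \<le> 0 + e" if "e > 0" "x \<in> {0..L}" for x e
    using assms that unfolding converges_to_def by (metis add_0 less_imp_le order_refl)
  hence "\<bar>U x - V x\<bar> \<le> 0" if "x \<in> {0..L}" for x using that field_le_epsilon by blast
  thus "\<forall>x\<in>{0..L}. U x = V x" by simp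
  have "\<bar>W x - Z x\<bar> \<le> 0 + e" if "e > 0" "x \<in> {0..x2}" for x e
    using assms that unfolding converges_to_def by (metis add_0 less_imp_le order_refl)
  hence "\<bar>W x - Z x\<bar> \<le> 0" if "x \<in> {0..x2}" for x using that field_le_epsilon by blast
  thus "\<forall>x\<in>{0..x2}. W x = Z x" by simp
qed

lemma converges_to_cong:
  assumes "converges_to u w U W" "\<forall>x\<in>{0..L}. U x = V x" "\<forall>x\<in>{0..x2}. W x = Z x"
  shows "converges_to u w V Z"
  using assms unfolding converges_to_def by simp

end

locale persistent_model = model +
  fixes m' \<delta> :: real and \<phi> \<phi>x g :: "real \<Rightarrow> real"
  assumes m': "m < m'" and \<delta>: "0 < \<delta>" and \<phi>pos: "\<And>x. x \<in> {0..L} \<Longrightarrow> \<phi> x > 0"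
    and \<phi>bvp: "bvp d1 a1 0 L {x2} \<phi> \<phi>x g"
    and g: "\<And>x. x \<in> {0<..<L} - {x2} \<Longrightarrow> g x \<le> (sp m' x - \<delta>) * \<phi> x"
begin

definition "kap = m' / m"

lemma kap: "1 < kap" "m * kap = m'" using m' ppos by (auto simp: kap_def)

lemma \<phi>cont: "continuous_on {0..L} \<phi>" by (rule bvp_cont[OF \<phi>bvp])

definition trapped :: "real \<Rightarrow> real \<Rightarrow> real \<Rightarrow> (real \<Rightarrow> real \<Rightarrow> real) \<Rightarrow> (real \<Rightarrow> real \<Rightarrow> real) \<Rightarrow> bool" where
  "trapped T \<epsilon> C u w \<longleftrightarrow> (\<forall>t\<ge>T. (\<forall>x\<in>{0..L}. \<epsilon> * \<phi> x \<le> u x t \<and> u x t \<le> C * exp (a1 / d1 * x)) \<and>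
     (\<forall>x\<in>{0..x2}. 0 \<le> w x t \<and> w x t \<le> kap * wb x))"

lemma eventually_trapped:
  assumes sol: "psol 0 u w" and u0: "\<And>x. x \<in> {0..L} \<Longrightarrow> 0 \<le> u x 0" and w0: "\<And>x. x \<in> {0..x2} \<Longrightarrow> 0 \<le> w x 0"
    and x0: "x0 \<in> {0..L}" "u x0 0 \<noteq> 0"
  obtains T \<epsilon> C where "0 \<le> T" "0 < \<epsilon>" "\<And>\<epsilon>' C'. 0 < \<epsilon>' \<Longrightarrow> \<epsilon>' \<le> \<epsilon> \<Longrightarrow> C \<le> C' \<Longrightarrow> trapped T \<epsilon>' C' u w"
proof -
  note pu = sol[unfolded psol_def, THEN conjunct1]
  obtain T where T: "0 < T" "\<And>x t. T \<le> t \<Longrightarrow> x \<in> {0..x2} \<Longrightarrow> w x t \<le> kap * wb x"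
    using psol_w_upper[OF sol u0 w0 kap(1)] by blast
  obtain N where N: "0 < N" "\<And>x. x \<in> {0..L} \<Longrightarrow> \<bar>u x 0\<bar> \<le> N"
    using bounded_above_on_interval[OF parab_cont_space[OF pu order_refl]] by blast
  define C where "C = r + N"
  have C: "r \<le> C" "\<And>x. x \<in> {0..L} \<Longrightarrow> u x 0 \<le> C" using N(1) N(2) ppos by (force simp: C_def)+
  obtain M where M: "0 < M" "\<And>x. x \<in> {0..L} \<Longrightarrow> \<bar>\<phi> x\<bar> \<le> M" using bounded_above_on_interval[OF \<phi>cont] by blast
  obtain e where e: "0 < e" "\<And>x. x \<in> {0..L} \<Longrightarrow> e \<le> u x T"
    using positive_min_on_interval[OF parab_cont_space[OF pu less_imp_le[OF T(1)]] psol_u_pos[OF sol u0 w0 x0 T(1)]] by blast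
  define \<epsilon> where "\<epsilon> = min (e / M) (\<delta> / M)"
  have \<epsilon>: "\<epsilon> > 0" using e(1) M(1) \<delta> by (simp add: \<epsilon>_def)
  have sub: "c * \<phi> x \<le> e \<and> c * \<phi> x \<le> \<delta>" if "0 < c" "c \<le> \<epsilon>" "x \<in> {0..L}" for c x
  proof -
    have "c * \<phi> x \<le> \<epsilon> * M" using that M(2)[OF that(3)] \<phi>pos[OF that(3)] \<epsilon> by (intro mult_mono) auto
    moreover have "\<epsilon> * M \<le> e / M * M" "\<epsilon> * M \<le> \<delta> / M * M"
      using M(1) by (intro mult_right_mono; simp add: \<epsilon>_def)+
    ultimately show ?thesis using M(1) by simp
  qed
  have lower: "c * \<phi> x \<le> u x t" if c: "0 < c" "c \<le> \<epsilon>" and t: "T \<le> t" and x: "x \<in> {0..L}" for c x t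
  proof -
    have puT: "parab d1 a1 0 L {x2} T u (\<lambda>x t. u x t * (r - u x t - m * chi x2 x * w x t))"
      by (rule parab_mono[OF pu]) (use T in auto)
    note dp = parab_lincomb[OF bvp_parab[OF \<phi>bvp] puT, of c "-1"]
    have "c * \<phi> x + - 1 * u x t \<le> 0"
    proof (rule parab_nonpos[OF dp u_conds, of t r])
      fix y assume y: "y \<in> {0..L}"
      thus "c * \<phi> y + - 1 * u y T \<le> 0" using sub[OF c y] e(2)[OF y] by simp
    next
      fix y s assume s: "T < s" "s \<le> t" and y: "y \<in> {0<..<L} - {x2}" and p: "0 < c * \<phi> y + - 1 * u y s"
      have yL: "y \<in> {0..L}" using y by simp
      have un: "0 \<le> u y s" using psol_nonneg(1)[OF sol u0 w0, of s y] s T yL by simp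
      have cw: "chi x2 y * w y s \<le> chi x2 y * (kap * wb y)" using T(2)[of s y] s yL by (auto simp: chi_def)
      have "m * (chi x2 y * w y s) \<le> m * (chi x2 y * (kap * wb y))"
        using mult_left_mono[OF cw, of m] ppos(4) by simp
      also have "\<dots> = (m * kap) * chi x2 y * wb y" by simp
      also have "\<dots> = m' * chi x2 y * wb y" unfolding kap(2) ..
      finally have "sp m' y - u y s \<le> r - u y s - m * chi x2 y * w y s" by (simp add: sp_def mult.assoc)
      hence 1: "u y s * (sp m' y - u y s) \<le> u y s * (r - u y s - m * chi x2 y * w y s)" using un by (intro mult_left_mono) auto
      have 2: "c * g y \<le> c * ((sp m' y - \<delta>) * \<phi> y)" using g[OF y] c by (intro mult_left_mono) auto
      have "u y s * u y s \<le> c * \<phi> y * (c * \<phi> y)" using p un by (intro mult_mono) auto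
      also have "\<dots> \<le> \<delta> * (c * \<phi> y)" using sub[OF c yL] c \<phi>pos[OF yL] by (intro mult_right_mono) auto
      finally have 3: "u y s * u y s \<le> \<delta> * (c * \<phi> y)" .
      have "sp m' y \<le> r" using m' ppos wb_pos[of y] yL by (auto simp: sp_def chi_def)
      hence "sp m' y * (c * \<phi> y - u y s) \<le> r * (c * \<phi> y - u y s)" using p by (intro mult_right_mono) auto
      moreover have "c * g y - u y s * (r - u y s - m * chi x2 y * w y s) \<le> sp m' y * (c * \<phi> y - u y s)"
        using 1 2 3 by (simp add: algebra_simps)
      ultimately show "c * g y + - 1 * (u y s * (r - u y s - m * chi x2 y * w y s)) \<le> r * (c * \<phi> y + - 1 * u y s)"
        by simp
    qed (use x t in auto)
    thus ?thesis by simp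
  qed
  show ?thesis
  proof (rule that[of T \<epsilon> C])
    fix c C' assume c: "0 < c" "c \<le> \<epsilon>" and C': "C \<le> C'"
    have "u x t \<le> C' * exp (a1 / d1 * x)" if "T \<le> t" "x \<in> {0..L}" for x t
      using psol_u_upper[OF sol u0 w0, of C' t x] C C' T that by force
    thus "trapped T c C' u w" unfolding trapped_def
      using lower[OF c] T psol_nonneg(2)[OF sol u0 w0] by auto
  qed (use T \<epsilon> in auto)
qed

lemma sandwich_exists:
  obtains \<epsilon> C where "0 < \<epsilon>"
    "\<And>\<epsilon>' C'. 0 < \<epsilon>' \<Longrightarrow> \<epsilon>' \<le> \<epsilon> \<Longrightarrow> C \<le> C' \<Longrightarrow> \<exists>K Ub Wb. sandwich d1 d2 r m p q h L a1 a2 x2 wb K Ub Wb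
       (\<lambda>x. \<epsilon>' * \<phi> x) (\<lambda>x. C' * exp (a1 / d1 * x)) (\<lambda>_. 0) (\<lambda>x. kap * wb x)"
proof -
  obtain M where M: "0 < M" "\<And>x. x \<in> {0..L} \<Longrightarrow> \<bar>\<phi> x\<bar> \<le> M" using bounded_above_on_interval[OF \<phi>cont] by blast
  obtain B where B: "0 < B" "\<And>x. x \<in> {0..x2} \<Longrightarrow> \<bar>wb x\<bar> \<le> B" using bounded_above_on_interval[OF wb_cont] by blast
  obtain wb' where wbb: "bvp d2 a2 (a2 / d2) x2 {} wb wb' (\<lambda>x. h - q * wb x)" by (rule wb_bvp)
  define \<epsilon> where "\<epsilon> = \<delta> / M"
  show ?thesis
  proof (rule that[of \<epsilon> "r + \<delta>"])
    show "0 < \<epsilon>" using \<delta> M by (simp add: \<epsilon>_def)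
    fix c C assume c: "0 < c" "c \<le> \<epsilon>" and C: "r + \<delta> \<le> C"
    define E where "E = (\<lambda>x. exp (a1 / d1 * x))"
    have E1: "1 \<le> E x" if "0 \<le> x" for x using that ppos by (simp add: E_def)
    have EL: "E x \<le> E L" if "x \<le> L" for x using that ppos by (simp add: E_def divide_right_mono)
    have Cp: "C > 0" using C ppos \<delta> by linarith
    have CE: "C \<le> C * E x" if "0 \<le> x" for x using mult_left_mono[OF E1[OF that], of C] Cp by simp
    have DE: "(E has_real_derivative a1 / d1 * E x) (at x within A)" for x A
      unfolding E_def using ppos(1) by (auto intro!: derivative_eq_intros)
    have cE: "continuous_on A E" for A unfolding E_def using ppos(1) by (intro continuous_intros) auto
    have c\<phi>: "0 < c * \<phi> x" "c * \<phi> x \<le> \<delta>" if "x \<in> {0..L}" for x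
    proof -
      show "0 < c * \<phi> x" using c \<phi>pos[OF that] by simp
      have "c * \<phi> x \<le> \<epsilon> * M" using c M(2)[OF that] \<phi>pos[OF that] by (intro mult_mono) auto
      thus "c * \<phi> x \<le> \<delta>" using M(1) by (simp add: \<epsilon>_def)
    qed
    define Ub where "Ub = C * E L"
    define Wb where "Wb = kap * B"
    define K where "K = 2 * Ub + m * Wb + q + p * Ub"
    have Ub: "Ub > 0" and Wb: "Wb > 0" using Cp B kap by (auto simp: Ub_def Wb_def E_def)
    have K: "K > 0" "2 * Ub + m * Wb \<le> K" "q + p * Ub \<le> K"
      using Ub Wb ppos by (auto simp: K_def add_pos_pos intro!: add_nonneg_nonneg)
    interpret G1: green_op d1 a1 0 K L using ppos K by unfold_locales auto
    interpret G2: green_op d2 a2 "a2 / d2" K x2 using ppos K by unfold_locales auto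
    have c\<phi>c: "continuous_on {0..L} (\<lambda>x. c * \<phi> x)" by (intro continuous_intros \<phi>cont)
    have kwc: "continuous_on {0..x2} (\<lambda>x. kap * wb x)" by (intro continuous_intros wb_cont)
    have bF: "bint L (\<lambda>x. u x * (K + r - u x - m * chi x2 x * w x))"
      if "continuous_on {0..L} u" "continuous_on {0..x2} w" for u w
    proof -
      have "bint L (\<lambda>x. u x * (K + r - u x - m * (chi x2 x * w x)))"
        by (intro bint_mult bint_diff bint_chi bint_cont continuous_intros that)
      thus ?thesis by (simp add: mult.assoc)
    qed
    have iF: "isCont (\<lambda>x. u x * (K + r - u x - m * chi x2 x * w x)) x"
      if u: "continuous_on {0..L} u" and w: "continuous_on {0..x2} w" and x: "x \<in> {0<..<L} - {x2}" for u w x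
    proof -
      have "isCont (\<lambda>x. u x * (K + r - u x - m * (chi x2 x * w x))) x"
        by (intro isCont_mult isCont_diff isCont_on[OF u x] isCont_chi[OF w x] continuous_const)
      thus ?thesis by (simp add: mult.assoc)
    qed
    have "sandwich d1 d2 r m p q h L a1 a2 x2 wb K Ub Wb (\<lambda>x. c * \<phi> x) (\<lambda>x. C * E x) (\<lambda>_. 0) (\<lambda>x. kap * wb x)"
    proof unfold_locales
      show "2 * Ub + m * Wb \<le> K" "q + p * Ub \<le> K" by fact+
      show "continuous_on {0..L} (\<lambda>x. c * \<phi> x)" "continuous_on {0..x2} (\<lambda>x. kap * wb x)" by fact+
      show "continuous_on {0..L} (\<lambda>x. C * E x)" by (intro continuous_intros cE)
      show "continuous_on {0..x2} (\<lambda>_. 0::real)" by simp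
      show "0 < c * \<phi> x \<and> c * \<phi> x \<le> C * E x \<and> C * E x \<le> Ub" if x: "x \<in> {0..L}" for x
      proof -
        have "c * \<phi> x \<le> C * E x" using c\<phi>(2)[OF x] CE[of x] C ppos(3) x unfolding atLeastAtMost_iff by linarith
        thus ?thesis using c\<phi>(1)[OF x] EL[of x] x Cp by (simp add: Ub_def)
      qed
      show "0 \<le> (0::real) \<and> 0 \<le> kap * wb x \<and> kap * wb x \<le> Wb" if x: "x \<in> {0..x2}" for x
        using wb_pos[OF x] B(2)[OF x] kap(1) by (auto simp: Wb_def)
    next
      fix x assume x: "x \<in> {0..L}"
      define F where "F = (\<lambda>x. c * \<phi> x * (K + r - c * \<phi> x - m * chi x2 x * (kap * wb x)))"
      have b: "bvp d1 a1 0 L {x2} (G1.green F) (G1.green' F) (\<lambda>x. F x - K * G1.green F x)"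
        unfolding F_def by (rule G1.green_bvp[OF bF[OF c\<phi>c kwc] _ iF[OF c\<phi>c kwc]]) auto
      have "c * \<phi> x + - 1 * G1.green F x \<le> 0"
      proof (rule bvp_nonpos[OF bvp_lincomb[OF \<phi>bvp b] u_conds K(1) _ x])
        fix y assume y: "y \<in> {0<..<L} - {x2}"
        hence yL: "y \<in> {0..L}" by simp
        have "F y = c * \<phi> y * (K + (r - (m * kap) * chi x2 y * wb y) - c * \<phi> y)"
          unfolding F_def by (simp add: algebra_simps)
        hence Fy: "F y = c * \<phi> y * (K + sp m' y - c * \<phi> y)" unfolding kap(2) sp_def .
        have "c * g y \<le> c * ((sp m' y - \<delta>) * \<phi> y)" using g[OF y] c by (intro mult_left_mono) auto
        moreover have "c * \<phi> y * (c * \<phi> y) \<le> c * \<phi> y * \<delta>" using c\<phi>[OF yL] by (intro mult_left_mono) auto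
        ultimately show "c * g y + - 1 * (F y - K * G1.green F y) \<le> - K * (c * \<phi> y + - 1 * G1.green F y)"
          unfolding Fy by (simp add: algebra_simps)
      qed
      thus "c * \<phi> x \<le> G1.green (\<lambda>x. c * \<phi> x * (K + r - c * \<phi> x - m * chi x2 x * (kap * wb x))) x"
        by (simp add: F_def)
    next
      fix x assume x: "x \<in> {0..L}"
      define F where "F = (\<lambda>x. C * E x * (K + r - C * E x - m * chi x2 x * 0))"
      have cCE: "continuous_on {0..L} (\<lambda>x. C * E x)" by (intro continuous_intros cE)
      have c0: "continuous_on {0..x2} (\<lambda>_. 0::real)" by simp
      have b: "bvp d1 a1 0 L {x2} (G1.green F) (G1.green' F) (\<lambda>x. F x - K * G1.green F x)"
        unfolding F_def by (rule G1.green_bvp[OF bF[OF cCE c0] _ iF[OF cCE c0]]) auto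
      have "G1.green F x - C * E x \<le> 0"
      proof (rule elliptic_max_principle[OF u_conds(1,2,3,5) K(1) _ _ _ _ x, of "\<lambda>x. G1.green F x - C * E x" "\<lambda>x. G1.green' F x - C * (a1 / d1 * E x)"])
        show "((\<lambda>x. G1.green F x - C * E x) has_real_derivative G1.green' F y - C * (a1 / d1 * E y)) (at y within {0..L})"
          if "y \<in> {0..L}" for y using b that unfolding bvp_def by (intro DERIV_diff DERIV_cmult DE) auto
        have "d1 * G1.green' F 0 = a1 * G1.green F 0" "G1.green' F L = 0" using b by (simp_all add: bvp_def)
        thus "a1 * (G1.green F 0 - C * E 0) \<le> d1 * (G1.green' F 0 - C * (a1 / d1 * E 0))"
          using ppos(1) by (simp add: algebra_simps)
        assume p: "0 < G1.green F L - C * E L"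
        have "C * E L > 0" using Cp by (simp add: E_def)
        hence "0 \<le> a1 * G1.green F L" using p ppos by simp
        thus "d1 * (G1.green' F L - C * (a1 / d1 * E L)) \<le> a1 * (G1.green F L - C * E L)"
          using \<open>G1.green' F L = 0\<close> ppos(1) by (simp add: algebra_simps)
      next
        fix y assume y: "y \<in> {0<..<L} - {x2}"
        obtain g2 where g2: "(G1.green' F has_real_derivative g2) (at y)" "d1 * g2 - a1 * G1.green' F y + (F y - K * G1.green F y) = 0"
          using b y unfolding bvp_def by blast
        have D: "((\<lambda>x. G1.green' F x - C * (a1 / d1 * E x)) has_real_derivative g2 - C * (a1 / d1 * (a1 / d1 * E y))) (at y)"
          by (intro DERIV_diff DERIV_cmult DE g2)
        have "r \<le> C * E y" using CE[of y] C \<delta> y by simp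
        hence "C * E y * (K + r - C * E y) \<le> C * E y * K" using Cp by (intro mult_left_mono) (auto simp: E_def)
        hence Fy: "F y \<le> K * (C * E y)" by (simp add: F_def mult.commute)
        have "d1 * (g2 - C * (a1 / d1 * (a1 / d1 * E y))) - a1 * (G1.green' F y - C * (a1 / d1 * E y)) = d1 * g2 - a1 * G1.green' F y"
          using ppos(1) by (simp add: algebra_simps)
        also have "\<dots> = K * G1.green F y - F y" using g2(2) by linarith
        also have "\<dots> \<ge> K * (G1.green F y - C * E y)" using Fy by (simp add: right_diff_distrib)
        finally show "\<exists>yxx. ((\<lambda>x. G1.green' F x - C * (a1 / d1 * E x)) has_real_derivative yxx) (at y) \<and>
          K * (G1.green F y - C * E y) \<le> d1 * yxx - a1 * (G1.green' F y - C * (a1 / d1 * E y))" using D by blast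
      qed
      thus "G1.green (\<lambda>x. C * E x * (K + r - C * E x - m * chi x2 x * 0)) x \<le> C * E x" by (simp add: F_def)
    next
      fix x assume x: "x \<in> {0..x2}"
      have "G2.green (\<lambda>_. 0) x \<le> G2.green (\<lambda>x. h + (K - q - p * (C * E x)) * 0) x"
        by (rule G2.green_mono[OF _ _ _ x]) (use ppos(7) in \<open>auto intro!: bint_cont\<close>)
      thus "0 \<le> G2.green (\<lambda>x. h + (K - q - p * (C * E x)) * 0) x" by (simp add: G2.green_zero)
    next
      fix x assume x: "x \<in> {0..x2}"
      define F where "F = (\<lambda>x. h + (K - q - p * (c * \<phi> x)) * (kap * wb x))"
      have Fc: "continuous_on {0..x2} F" unfolding F_def
        by (intro continuous_intros kwc continuous_on_subset[OF \<phi>cont] wb_cont) (use ppos in auto)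
      have b: "bvp d2 a2 (a2 / d2) x2 {} (G2.green F) (G2.green' F) (\<lambda>x. F x - K * G2.green F x)"
      proof (rule G2.green_bvp[OF bint_cont[OF Fc]])
        show "isCont F y" if "y \<in> {0<..<x2} - {}" for y using continuous_on_interior[OF Fc, of y] that by auto
      qed simp
      have "1 * G2.green F x + - kap * wb x \<le> 0"
      proof (rule bvp_nonpos[OF bvp_lincomb[OF b wbb] w_conds K(1) _ x])
        fix y assume "y \<in> {0<..<x2} - {}"
        hence y: "y \<in> {0..x2}" by simp
        have "0 \<le> p * (c * \<phi> y) * (kap * wb y)" using c\<phi>(1)[of y] y wb_pos[OF y] kap(1) ppos by auto
        moreover have "h \<le> kap * h" using kap(1) ppos(7) by simp
        ultimately show "1 * (F y - K * G2.green F y) + - kap * (h - q * wb y) \<le> - K * (1 * G2.green F y + - kap * wb y)"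
          unfolding F_def by (simp add: algebra_simps)
      qed
      thus "G2.green (\<lambda>x. h + (K - q - p * (c * \<phi> x)) * (kap * wb x)) x \<le> kap * wb x" by (simp add: F_def)
    qed
    thus "\<exists>K Ub Wb. sandwich d1 d2 r m p q h L a1 a2 x2 wb K Ub Wb
       (\<lambda>x. c * \<phi> x) (\<lambda>x. C * exp (a1 / d1 * x)) (\<lambda>_. 0) (\<lambda>x. kap * wb x)" unfolding E_def by blast
  qed
qed

lemma trapped_solutions_converge:
  assumes sw: "sandwich d1 d2 r m p q h L a1 a2 x2 wb K Ub Wb
       (\<lambda>x. \<epsilon> * \<phi> x) (\<lambda>x. C * exp (a1 / d1 * x)) (\<lambda>_. 0) (\<lambda>x. kap * wb x)"
    and m: "m \<le> exp (- \<bar>a1/d1 - a2/d2\<bar> * x2) / p" and h: "(wb x2)\<^sup>2 \<le> h"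
  obtains U Ux W Wx where "steady U Ux W Wx"
    "\<And>T u w. 0 \<le> T \<Longrightarrow> psol 0 u w \<Longrightarrow> trapped T \<epsilon> C u w \<Longrightarrow> converges_to u w U W"
proof -
  interpret S: sandwich d1 d2 r m p q h L a1 a2 x2 wb K Ub Wb
    "\<lambda>x. \<epsilon> * \<phi> x" "\<lambda>x. C * exp (a1 / d1 * x)" "\<lambda>_. 0" "\<lambda>x. kap * wb x" by (rule sw)
  obtain U Ux W Wx where st: "steady U Ux W Wx"
    "\<And>x. x \<in> {0..L} \<Longrightarrow> (\<lambda>n. fst (S.hi n) x) \<longlonglongrightarrow> U x" "\<And>x. x \<in> {0..x2} \<Longrightarrow> (\<lambda>n. snd (S.hi n) x) \<longlonglongrightarrow> W x"
    "\<And>x. x \<in> {0..L} \<Longrightarrow> (\<lambda>n. fst (S.lo n) x) \<longlonglongrightarrow> U x" "\<And>x. x \<in> {0..x2} \<Longrightarrow> (\<lambda>n. snd (S.lo n) x) \<longlonglongrightarrow> W x"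
    using S.common_limit[OF m h] by blast
  show ?thesis
  proof (rule that[OF st(1)])
    fix T u w assume T: "0 \<le> T" and sol: "psol 0 u w" and tr: "trapped T \<epsilon> C u w"
    have solT: "psol T u w" using sol unfolding psol_def by (auto intro: parab_mono[OF _ order_refl T])
    show "converges_to u w U W"
      by (rule S.sol_converges[OF solT _ _ st]) (use tr in \<open>auto simp: trapped_def\<close>)
  qed
qed

lemma steady_exists_attracting:
  assumes m: "m \<le> exp (- \<bar>a1/d1 - a2/d2\<bar> * x2) / p" and h: "(wb x2)\<^sup>2 \<le> h"
  obtains U Ux W Wx where "steady U Ux W Wx"
    "\<And>u w x0. psol 0 u w \<Longrightarrow> (\<And>x. x \<in> {0..L} \<Longrightarrow> 0 \<le> u x 0) \<Longrightarrow> (\<And>x. x \<in> {0..x2} \<Longrightarrow> 0 \<le> w x 0) \<Longrightarrow>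
       x0 \<in> {0..L} \<Longrightarrow> u x0 0 \<noteq> 0 \<Longrightarrow> converges_to u w U W"
proof -
  obtain e C where e: "0 < e" and sw: "\<And>\<epsilon>' C'. 0 < \<epsilon>' \<Longrightarrow> \<epsilon>' \<le> e \<Longrightarrow> C \<le> C' \<Longrightarrow> \<exists>K Ub Wb. sandwich d1 d2 r m p q h L a1 a2 x2 wb K Ub Wb
       (\<lambda>x. \<epsilon>' * \<phi> x) (\<lambda>x. C' * exp (a1 / d1 * x)) (\<lambda>_. 0) (\<lambda>x. kap * wb x)"
    using sandwich_exists by blast
  from sw[OF e order_refl order_refl] obtain K0 U0 W0 where sw0: "sandwich d1 d2 r m p q h L a1 a2 x2 wb K0 U0 W0
       (\<lambda>x. e * \<phi> x) (\<lambda>x. C * exp (a1 / d1 * x)) (\<lambda>_. 0) (\<lambda>x. kap * wb x)" by blast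
  obtain U Ux W Wx where st: "steady U Ux W Wx"
    by (rule trapped_solutions_converge[OF sw0 m h])
  show ?thesis
  proof (rule that[OF st])
    fix u w x0 assume sol: "psol 0 u w" and u0: "\<And>x. x \<in> {0..L} \<Longrightarrow> 0 \<le> u x 0"
      and w0: "\<And>x. x \<in> {0..x2} \<Longrightarrow> 0 \<le> w x 0" and x0: "x0 \<in> {0..L}" "u x0 0 \<noteq> 0"
    obtain T1 e1 C1 where t1: "0 \<le> T1" "0 < e1" "\<And>\<epsilon>' C'. 0 < \<epsilon>' \<Longrightarrow> \<epsilon>' \<le> e1 \<Longrightarrow> C1 \<le> C' \<Longrightarrow> trapped T1 \<epsilon>' C' u w"
      using eventually_trapped[OF sol u0 w0 x0] by blast
    have Up: "0 < U x" if "x \<in> {0..L}" for x using st that by (simp add: steady_def)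
    have Wp: "0 < W x" if "x \<in> {0..x2}" for x using st that by (simp add: steady_def)
    have z: "(0::real) \<in> {0..L}" using ppos by simp
    have Un0: "U 0 \<noteq> 0" using Up[OF z] by simp
    obtain T2 e2 C2 where t2: "0 \<le> T2" "0 < e2"
      "\<And>\<epsilon>' C'. 0 < \<epsilon>' \<Longrightarrow> \<epsilon>' \<le> e2 \<Longrightarrow> C2 \<le> C' \<Longrightarrow> trapped T2 \<epsilon>' C' (\<lambda>x t. U x) (\<lambda>x t. W x)"
      using eventually_trapped[OF steady_psol[OF st] less_imp_le[OF Up] less_imp_le[OF Wp] z Un0] by blast
    define e' C' where "e' = min e (min e1 e2)" and "C' = max C (max C1 C2)"
    have e': "0 < e'" "e' \<le> e" "e' \<le> e1" "e' \<le> e2" using e t1(2) t2(2) by (auto simp: e'_def)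
    have C': "C \<le> C'" "C1 \<le> C'" "C2 \<le> C'" by (auto simp: C'_def)
    from sw[OF e'(1,2) C'(1)] obtain K Ub Wb where sw': "sandwich d1 d2 r m p q h L a1 a2 x2 wb K Ub Wb
       (\<lambda>x. e' * \<phi> x) (\<lambda>x. C' * exp (a1 / d1 * x)) (\<lambda>_. 0) (\<lambda>x. kap * wb x)" by blast
    obtain V Vx Z Zx where V: "steady V Vx Z Zx"
      "\<And>T u w. 0 \<le> T \<Longrightarrow> psol 0 u w \<Longrightarrow> trapped T e' C' u w \<Longrightarrow> converges_to u w V Z"
      using trapped_solutions_converge[OF sw' m h] by blast
    have 1: "converges_to u w V Z" by (rule V(2)[OF t1(1) sol t1(3)[OF e'(1,3) C'(2)]])
    have 2: "converges_to (\<lambda>x t. U x) (\<lambda>x t. W x) V Z"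
      by (rule V(2)[OF t2(1) steady_psol[OF st] t2(3)[OF e'(1,4) C'(3)]])
    show "converges_to u w U W"
      by (rule converges_to_cong[OF 1]) (use converges_const[OF 2] in auto)
  qed
qed

end

context model
begin

lemma steady_imp_coexistence:
  assumes "steady U Ux W Wx"
  shows "coexistence_steady_state d1 d2 a1 a2 r m p q h L x2 U W"
  unfolding coexistence_steady_state_def
proof (intro conjI)
  note st = assms[unfolded steady_def]
  show "\<forall>x\<in>{0..L}. U x > 0" "\<forall>x\<in>{0..x2}. W x > 0" using st by auto
  show "\<exists>U'. (\<forall>x\<in>{0..L}. (U has_real_derivative U' x) (at x within {0..L})) \<and>
       continuous_on {0..L} U' \<and>
       (\<forall>x\<in>{0<..<L} - {x2}. \<exists>U''. (U' has_real_derivative U'') (at x) \<and>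
            d1 * U'' - a1 * U' x + U x * (r - U x - m * chi x2 x * W x) = 0) \<and>
       d1 * U' 0 - a1 * U 0 = 0 \<and> U' L = 0"
    using st unfolding bvp_def by (intro exI[of _ Ux]) simp
  have "\<forall>x\<in>{0<..<x2}. \<exists>W''. (Wx has_real_derivative W'') (at x) \<and>
            d2 * W'' - a2 * Wx x + h - q * W x - p * U x * W x = 0"
  proof
    fix x assume "x \<in> {0<..<x2}"
    then obtain w2 where "(Wx has_real_derivative w2) (at x)" "d2 * w2 - a2 * Wx x + (h - q * W x - p * U x * W x) = 0"
      using st unfolding bvp_def by blast
    thus "\<exists>W''. (Wx has_real_derivative W'') (at x) \<and> d2 * W'' - a2 * Wx x + h - q * W x - p * U x * W x = 0"
      by (intro exI[of _ w2]) (auto simp: algebra_simps)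
  qed
  thus "\<exists>W'. (\<forall>x\<in>{0..x2}. (W has_real_derivative W' x) (at x within {0..x2})) \<and>
       (\<forall>x\<in>{0<..<x2}. \<exists>W''. (W' has_real_derivative W'') (at x) \<and>
            d2 * W'' - a2 * W' x + h - q * W x - p * U x * W x = 0) \<and>
       d2 * W' 0 - a2 * W 0 = 0 \<and> d2 * W' x2 - a2 * W x2 = 0"
    using st ppos unfolding bvp_def by (intro exI[of _ Wx]) simp
qed

lemma coexistence_imp_psol:
  assumes "coexistence_steady_state d1 d2 a1 a2 r m p q h L x2 U W"
  shows "psol 0 (\<lambda>x t. U x) (\<lambda>x t. W x)"
proof -
  from assms obtain U' where U': "\<forall>x\<in>{0..L}. (U has_real_derivative U' x) (at x within {0..L})"
       "\<forall>x\<in>{0<..<L} - {x2}. \<exists>U''. (U' has_real_derivative U'') (at x) \<and>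
            d1 * U'' - a1 * U' x + U x * (r - U x - m * chi x2 x * W x) = 0"
       "d1 * U' 0 - a1 * U 0 = 0" "U' L = 0" unfolding coexistence_steady_state_def by blast
  from assms obtain W' where W': "\<forall>x\<in>{0..x2}. (W has_real_derivative W' x) (at x within {0..x2})"
       "\<forall>x\<in>{0<..<x2}. \<exists>W''. (W' has_real_derivative W'') (at x) \<and>
            d2 * W'' - a2 * W' x + h - q * W x - p * U x * W x = 0"
       "d2 * W' 0 - a2 * W 0 = 0" "d2 * W' x2 - a2 * W x2 = 0" unfolding coexistence_steady_state_def by blast
  have bU: "bvp d1 a1 0 L {x2} U U' (\<lambda>x. U x * (r - U x - m * chi x2 x * W x))"
    using U' unfolding bvp_def by simp
  have bW: "bvp d2 a2 (a2 / d2) x2 {} W W' (\<lambda>x. h - q * W x - p * U x * W x)"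
    unfolding bvp_def
  proof (intro conjI ballI)
    fix x assume "x \<in> {0<..<x2} - {}"
    then obtain w2 where "(W' has_real_derivative w2) (at x)" "d2 * w2 - a2 * W' x + h - q * W x - p * U x * W x = 0"
      using W'(2) by blast
    thus "\<exists>w2. (W' has_real_derivative w2) (at x) \<and> d2 * w2 - a2 * W' x + (h - q * W x - p * U x * W x) = 0"
      by (intro exI[of _ w2]) (auto simp: algebra_simps)
  qed (use W' ppos in \<open>auto simp: field_simps\<close>)
  show ?thesis unfolding psol_def using bvp_parab[OF bU] bvp_parab[OF bW] by blast
qed

lemma is_solution_imp_psol:
  assumes "is_solution d1 d2 a1 a2 r m p q h L x2 u0 w0 u w"
  shows "psol 0 u w"
  unfolding psol_def parab_def
proof (intro conjI allI impI)
  show "continuous_on ({0..L} \<times> {0..}) (\<lambda>(x, t). u x t)" "continuous_on ({0..x2} \<times> {0..}) (\<lambda>(x, t). w x t)"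
    using assms by (auto simp: is_solution_def)
  fix t :: real assume t: "0 < t"
  from assms t obtain ux where ux: "\<forall>x\<in>{0..L}. ((\<lambda>y. u y t) has_real_derivative ux x) (at x within {0..L})"
          "\<forall>x\<in>{0<..<L} - {x2}. \<exists>uxx ut. (ux has_real_derivative uxx) (at x) \<and>
              ((\<lambda>s. u x s) has_real_derivative ut) (at t) \<and>
              ut = d1 * uxx - a1 * ux x + u x t * (r - u x t - m * chi x2 x * w x t)"
          "d1 * ux 0 - a1 * u 0 t = 0" "ux L = 0" unfolding is_solution_def by blast
  thus "\<exists>zx. (\<forall>x\<in>{0..L}. ((\<lambda>y. u y t) has_real_derivative zx x) (at x within {0..L})) \<and>
       (\<forall>x\<in>{0<..<L} - {x2}. \<exists>zxx zt. (zx has_real_derivative zxx) (at x) \<and> (u x has_real_derivative zt) (at t) \<and>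
          zt = d1 * zxx - a1 * zx x + u x t * (r - u x t - m * chi x2 x * w x t)) \<and>
       d1 * zx 0 = a1 * u 0 t \<and> zx L = 0 * u L t" by (intro exI[of _ ux]) simp
  from assms t obtain wx where wx: "\<forall>x\<in>{0..x2}. ((\<lambda>y. w y t) has_real_derivative wx x) (at x within {0..x2})"
          "\<forall>x\<in>{0<..<x2}. \<exists>wxx wt. (wx has_real_derivative wxx) (at x) \<and>
              ((\<lambda>s. w x s) has_real_derivative wt) (at t) \<and>
              wt = d2 * wxx - a2 * wx x + h - q * w x t - p * u x t * w x t"
          "d2 * wx 0 - a2 * w 0 t = 0" "d2 * wx x2 - a2 * w x2 t = 0" unfolding is_solution_def by blast
  have "\<forall>x\<in>{0<..<x2} - {}. \<exists>zxx zt. (wx has_real_derivative zxx) (at x) \<and> (w x has_real_derivative zt) (at t) \<and>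
          zt = d2 * zxx - a2 * wx x + (h - q * w x t - p * u x t * w x t)"
    using wx(2) by (simp add: add_diff_eq)
  moreover have "wx x2 = a2 / d2 * w x2 t" using wx(4) ppos by (simp add: field_simps)
  ultimately show "\<exists>zx. (\<forall>x\<in>{0..x2}. ((\<lambda>y. w y t) has_real_derivative zx x) (at x within {0..x2})) \<and>
       (\<forall>x\<in>{0<..<x2} - {}. \<exists>zxx zt. (zx has_real_derivative zxx) (at x) \<and> (w x has_real_derivative zt) (at t) \<and>
          zt = d2 * zxx - a2 * zx x + (h - q * w x t - p * u x t * w x t)) \<and>
       d2 * zx 0 = a2 * w 0 t \<and> zx x2 = a2 / d2 * w x2 t" using wx(1,3) by (intro exI[of _ wx]) simp
qed

lemma unique_GAS:
  assumes m: "m \<le> exp (- \<bar>a1/d1 - a2/d2\<bar> * x2) / p" and h: "(wb x2)\<^sup>2 \<le> h" and m': "m < m'"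
    and ex: "\<exists>\<phi> \<phi>x g \<delta>. \<delta> > 0 \<and> (\<forall>x\<in>{0..L}. \<phi> x > 0) \<and> bvp d1 a1 0 L {x2} \<phi> \<phi>x g \<and>
      (\<forall>x\<in>{0<..<L} - {x2}. g x \<le> (sp m' x - \<delta>) * \<phi> x)"
  shows "unique_GAS_coexistence d1 d2 a1 a2 r m p q h L x2"
proof -
  from ex obtain \<phi> \<phi>x g \<delta> where "\<delta> > 0" "\<forall>x\<in>{0..L}. \<phi> x > 0" "bvp d1 a1 0 L {x2} \<phi> \<phi>x g"
    "\<forall>x\<in>{0<..<L} - {x2}. g x \<le> (sp m' x - \<delta>) * \<phi> x" by blast
  then interpret P: persistent_model d1 d2 r m p q h L a1 a2 x2 wb m' \<delta> \<phi> \<phi>x g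
    using m' by unfold_locales auto
  obtain U Ux W Wx where st: "steady U Ux W Wx"
    and att: "\<And>u w x0. psol 0 u w \<Longrightarrow> (\<And>x. x \<in> {0..L} \<Longrightarrow> 0 \<le> u x 0) \<Longrightarrow> (\<And>x. x \<in> {0..x2} \<Longrightarrow> 0 \<le> w x 0) \<Longrightarrow>
       x0 \<in> {0..L} \<Longrightarrow> u x0 0 \<noteq> 0 \<Longrightarrow> converges_to u w U W"
    using P.steady_exists_attracting[OF m h] by blast
  have "globally_asymptotically_stable d1 d2 a1 a2 r m p q h L x2 U W"
    unfolding globally_asymptotically_stable_def converges_to_def[symmetric]
  proof (intro allI impI)
    fix u0 w0 u w assume ad: "admissible_initial_data L x2 u0 w0"
      and sol: "is_solution d1 d2 a1 a2 r m p q h L x2 u0 w0 u w"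
    have i: "\<And>x. x \<in> {0..L} \<Longrightarrow> u x 0 = u0 x" "\<And>x. x \<in> {0..x2} \<Longrightarrow> w x 0 = w0 x"
      using sol by (auto simp: is_solution_def)
    from ad obtain x0 where x0: "x0 \<in> {0..L}" "u0 x0 \<noteq> 0" by (auto simp: admissible_initial_data_def)
    show "converges_to u w U W"
      by (rule att[OF is_solution_imp_psol[OF sol] _ _ x0(1)])
         (use ad i x0 in \<open>auto simp: admissible_initial_data_def\<close>)
  qed
  moreover have "(\<forall>x\<in>{0..L}. U2 x = U x) \<and> (\<forall>x\<in>{0..x2}. W2 x = W x)"
    if css: "coexistence_steady_state d1 d2 a1 a2 r m p q h L x2 U2 W2" for U2 W2
  proof -
    have pos: "\<And>x. x \<in> {0..L} \<Longrightarrow> 0 < U2 x" "\<And>x. x \<in> {0..x2} \<Longrightarrow> 0 < W2 x"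
      using css by (auto simp: coexistence_steady_state_def)
    have "converges_to (\<lambda>x t. U2 x) (\<lambda>x t. W2 x) U W"
      by (rule att[OF coexistence_imp_psol[OF css], of 0])
         (use pos ppos in \<open>auto intro: less_imp_le simp: less_imp_neq[symmetric]\<close>)
    thus ?thesis using converges_const by blast
  qed
  ultimately show ?thesis unfolding unique_GAS_coexistence_def
    using steady_imp_coexistence[OF st] by blast
qed

end

theorem theorem2p7:
  fixes d1 d2 r m p q h L a1 a2 x2 mbar :: real and wb :: "real \<Rightarrow> real"
  assumes "d1 > 0" "d2 > 0" "r > 0" "m > 0" "p > 0" "q > 0" "h > 0" "L > 0"
    and "a1 > 0" "a2 \<ge> 0" "0 < x2" "x2 \<le> L"
    and "is_wbar d2 a2 h q x2 wb"
    and "a1 < sqrt (4 * d1 * r)"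
    and "L > L1star d1 a1 r"
  shows
    "(L - x2 \<ge> Lstar d1 a1 r \<and>
       m \<le> exp (- \<bar>a1/d1 - a2/d2\<bar> * x2) / p \<and> (wb x2)^2 \<le> h
       \<longrightarrow> unique_GAS_coexistence d1 d2 a1 a2 r m p q h L x2) \<and>
     (L - x2 < Lstar d1 a1 r \<and>
       mbar > 0 \<and> principal_eigenvalue d1 a1 (\<lambda>x. r - mbar * chi x2 x * wb x) 0 L 0 \<and>
       m < min mbar (exp (- \<bar>a1/d1 - a2/d2\<bar> * x2) / p) \<and> (wb x2)^2 \<le> h
       \<longrightarrow> unique_GAS_coexistence d1 d2 a1 a2 r m p q h L x2)"
proof -
  interpret model d1 d2 r m p q h L a1 a2 x2 wb using assms by unfold_locales auto
  show ?thesis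
  proof (intro conjI impI)
    assume A: "L - x2 \<ge> Lstar d1 a1 r \<and> m \<le> exp (- \<bar>a1/d1 - a2/d2\<bar> * x2) / p \<and> (wb x2)^2 \<le> h"
    show "unique_GAS_coexistence d1 d2 a1 a2 r m p q h L x2"
      by (rule unique_GAS[OF _ _ _ subsolution_large_zone[of "2 * m"]]) (use A assms in auto)
  next
    assume A: "L - x2 < Lstar d1 a1 r \<and>
       mbar > 0 \<and> principal_eigenvalue d1 a1 (\<lambda>x. r - mbar * chi x2 x * wb x) 0 L 0 \<and>
       m < min mbar (exp (- \<bar>a1/d1 - a2/d2\<bar> * x2) / p) \<and> (wb x2)^2 \<le> h"
    show "unique_GAS_coexistence d1 d2 a1 a2 r m p q h L x2"
      by (rule unique_GAS[OF _ _ _ subsolution_small_zone[of "(m + mbar) / 2" mbar]]) (use A assms in auto)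
  qed
qed

end
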